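(* The notion of independence $\perp^{\operatorname{cl},P}$ satisfies existence. That is, let $\mathcal{C}$ be a modular quasiminimal class and let $(M,P)$ be a beautiful pair associated to $\mathcal{C}$ with $\dim(M/P(M))\ge\kappa$ and $\dim(P(M))\ge\kappa$ for a sufficiently large cardinal $\kappa$. Let $C\subseteq D\subseteq M$ be small and let $\vec a$ be a finite tuple in $M$. Then there is a tuple $\vec a'$ in $M$ with $\operatorname{tp}_P(\vec a'/C)=\operatorname{tp}_P(\vec a/C)$ and $\vec a'\perp^{\operatorname{cl},P}_C D$.
   Context: **Quasiminimal classes.** Let $\mathcal{L}$ be a countable language. $\operatorname{tp}$ denotes the quantifier-free $\mathcal{L}$-type of a (possibly infinite, enumerated) tuple; in the structures below it is identified with the $\mathcal{L}_{\omega_1\omega}$-type. An $\mathcal{L}$-structure $M$ equipped with a pregeometry $\operatorname{cl}$ is a *quasiminimal pregeometry structure* if: (QM1) if $\operatorname{tp}(a,\vec b)=\operatorname{tp}(a',\vec b')$ then $a\in\operatorname{cl}(\vec b)$ iff $a'\in\operatorname{cl}(\vec b')$; (QM2) $M$ is infinite-dimensional with respect to $\operatorname{cl}$; (QM3) $\operatorname{cl}(A)$ is countable for every finite $A\subseteq M$; (QM4) if $A,A'\subseteq M$ are countable closed subsets enumerated so that $\operatorname{tp}(A)=\operatorname{tp}(A')$, $a\in M\setminus A$ and $a'\in M\setminus A'$, then $\operatorname{tp}(A,a)=\operatorname{tp}(A',a')$; (QM5) if $A,A'\subseteq M$ are countable closed subsets or empty, enumerated so that $\operatorname{tp}(A)=\operatorname{tp}(A')$,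 $\vec b,\vec b'$ are finite tuples with $\operatorname{tp}(A,\vec b)=\operatorname{tp}(A',\vec b')$ and $a\in\operatorname{cl}(A,\vec b)$, then there is $a'\in M$ with $\operatorname{tp}(A,\vec b,a)=\operatorname{tp}(A',\vec b',a')$. It is a *weakly quasiminimal pregeometry structure* if all axioms except possibly QM2 hold. An embedding $\theta:M_1\to M_2$ of such structures is *closed* if $\theta(\operatorname{cl}_{M_1}(A))=\operatorname{cl}_{M_2}(\theta(A))$ for all $A\subseteq M_1$; $M_1\preceq M_2$ means that the inclusion is a closed embedding. A *quasiminimal class* $\mathcal{C}$ is the smallest class of $\mathcal{L}$-structures containing a given quasiminimal pregeometry structure and closed under isomorphism, closed substructures, and unions of chains of closed embeddings; each member is a weakly quasiminimal pregeometry structure with its pregeometry $\operatorname{cl}$. $\dim(\vec a/B)$ is the dimension of $\vec a$ in the localized pregeometry $\operatorname{cl}_B(X)=\operatorname{cl}(X\cup B)$, and $\vec a\perp^{\operatorname{cl}}_C B$ means $\dim(\vec a/B\cup C)=\dim(\vec a/C)$. $\mathcal{C}$ is *modular* if for all $M\in\mathcal{C}$ and all finite tuples $\vec a,\vec b$ in $M$, $\vec a\perp^{\operatorname{cl}}_{\operatorname{cl}(\vec a)\cap\operatorname{cl}(\vec b)}\vec b$. **Beautiful pairs.** Let $P$ be a new unary predicate, $\mathcal{L}_P=\mathcal{L}\cup\{P\}$, $M\in\mathcal{C}$. $(M,P)$ is *dense-codense* if for all $b_1,\dots,b_n\in M$: (density) some $a\in P(M)$ realizes the unique generic type over $\operatorname{cl}(b_1,\dots,b_n)$,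 i.e. $a\notin\operatorname{cl}(b_1,\dots,b_n)$; (codensity) there is $a\in M$ with $a\notin\operatorname{cl}(\{b_1,\dots,b_n\}\cup P(M))$. It is a *beautiful pair* if in addition $P(M)\in\mathcal{C}$ and $P(M)\preceq M$. $\operatorname{tp}_P(\vec a/B)$ denotes the $(\mathcal{L}_P)_{\omega_1\omega}$-type of $\vec a$ over $B$ in $(M,P)$. "Small" means of cardinality less than $\kappa$. **Independence.** $\dim_{\operatorname{scl}}(\vec a/B):=\dim(\vec a/B\cup P(M))$. For $B\subseteq C\subseteq M$, $\vec a\perp^{\operatorname{cl},P}_B C$ means $\dim(\vec a/B)=\dim(\vec a/C)$ and $\dim_{\operatorname{scl}}(\vec a/B)=\dim_{\operatorname{scl}}(\vec a/C)$. *)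

theory Defs
  imports Main "HOL-Library.Countable_Set"
begin

unbundle cardinal_syntax

record ('f, 'r) lang =
  fsyms :: "'f set"
  farity :: "'f \<Rightarrow> nat"
  rsyms :: "'r set"
  rarity :: "'r \<Rightarrow> nat"

definition countable_lang :: "('f, 'r) lang \<Rightarrow> bool" where
  "countable_lang L \<longleftrightarrow> countable (fsyms L) \<and> countable (rsyms L)"

record ('a, 'f, 'r) str =
  univ :: "'a set"
  fint :: "'f \<Rightarrow> 'a list \<Rightarrow> 'a"
  rint :: "'r \<Rightarrow> 'a list \<Rightarrow> bool"

text \<open>A structure together with a closure operator on the subsets of its universe. All values
  outside the universe, or at symbols or arities not in the language, are irrelevant.\<close>

record ('a, 'f, 'r) pstr = "('a, 'f, 'r) str" +
  cl :: "'a set \<Rightarrow> 'a set"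

definition is_str :: "('f, 'r) lang \<Rightarrow> ('a, 'f, 'r, 'z) str_scheme \<Rightarrow> bool" where
  "is_str L S \<longleftrightarrow>
     (\<forall>f \<in> fsyms L. \<forall>xs. length xs = farity L f \<and> set xs \<subseteq> univ S \<longrightarrow> fint S f xs \<in> univ S)"

definition is_pstr :: "('f, 'r) lang \<Rightarrow> ('a, 'f, 'r) pstr \<Rightarrow> bool" where
  "is_pstr L S \<longleftrightarrow> is_str L S \<and> (\<forall>A \<subseteq> univ S. cl S A \<subseteq> univ S)"

datatype ('f, 'v) tm = Var 'v | Fn 'f "('f, 'v) tm list"

text \<open>Formulas of \<open>L\<^sub>\<omega>\<^sub>1\<^sub>\<omega>\<close>. The variables are drawn from an arbitrary type \<open>'v\<close>, so that
  tuples indexed by an arbitrary set have types. The binary conjunction \<open>And\<close> is kept beside the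
  countable one \<open>BigAnd\<close> so that the finitary quantifier-free formulas form a syntactic
  subclass.\<close>

datatype ('f, 'r, 'v) fm =
    Eq "('f, 'v) tm" "('f, 'v) tm"
  | Rel 'r "('f, 'v) tm list"
  | Neg "('f, 'r, 'v) fm"
  | And "('f, 'r, 'v) fm" "('f, 'r, 'v) fm"
  | BigAnd "nat \<Rightarrow> ('f, 'r, 'v) fm"
  | Ex 'v "('f, 'r, 'v) fm"

fun wf_tm :: "('f, 'r) lang \<Rightarrow> ('f, 'v) tm \<Rightarrow> bool" where
  "wf_tm L (Var x) \<longleftrightarrow> True"
| "wf_tm L (Fn f ts) \<longleftrightarrow> f \<in> fsyms L \<and> length ts = farity L f \<and> (\<forall>t \<in> set ts. wf_tm L t)"

fun tm_vars :: "('f, 'v) tm \<Rightarrow> 'v set" where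
  "tm_vars (Var x) = {x}"
| "tm_vars (Fn f ts) = (\<Union>t \<in> set ts. tm_vars t)"

fun tm_val :: "('a, 'f, 'r, 'z) str_scheme \<Rightarrow> ('v \<Rightarrow> 'a) \<Rightarrow> ('f, 'v) tm \<Rightarrow> 'a" where
  "tm_val S e (Var x) = e x"
| "tm_val S e (Fn f ts) = fint S f (map (tm_val S e) ts)"

primrec wf_fm :: "('f, 'r) lang \<Rightarrow> ('f, 'r, 'v) fm \<Rightarrow> bool" where
  "wf_fm L (Eq s t) \<longleftrightarrow> wf_tm L s \<and> wf_tm L t"
| "wf_fm L (Rel r ts) \<longleftrightarrow> r \<in> rsyms L \<and> length ts = rarity L r \<and> (\<forall>t \<in> set ts. wf_tm L t)"
| "wf_fm L (Neg \<phi>) \<longleftrightarrow> wf_fm L \<phi>"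
| "wf_fm L (And \<phi> \<psi>) \<longleftrightarrow> wf_fm L \<phi> \<and> wf_fm L \<psi>"
| "wf_fm L (BigAnd \<Phi>) \<longleftrightarrow> (\<forall>n. wf_fm L (\<Phi> n))"
| "wf_fm L (Ex x \<phi>) \<longleftrightarrow> wf_fm L \<phi>"

primrec fv :: "('f, 'r, 'v) fm \<Rightarrow> 'v set" where
  "fv (Eq s t) = tm_vars s \<union> tm_vars t"
| "fv (Rel r ts) = (\<Union>t \<in> set ts. tm_vars t)"
| "fv (Neg \<phi>) = fv \<phi>"
| "fv (And \<phi> \<psi>) = fv \<phi> \<union> fv \<psi>"
| "fv (BigAnd \<Phi>) = (\<Union>n. fv (\<Phi> n))"
| "fv (Ex x \<phi>) = fv \<phi> - {x}"

primrec sat :: "('a, 'f, 'r, 'z) str_scheme \<Rightarrow> ('v \<Rightarrow> 'a) \<Rightarrow> ('f, 'r, 'v) fm \<Rightarrow> bool" where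
  "sat S e (Eq s t) \<longleftrightarrow> tm_val S e s = tm_val S e t"
| "sat S e (Rel r ts) \<longleftrightarrow> rint S r (map (tm_val S e) ts)"
| "sat S e (Neg \<phi>) \<longleftrightarrow> \<not> sat S e \<phi>"
| "sat S e (And \<phi> \<psi>) \<longleftrightarrow> sat S e \<phi> \<and> sat S e \<psi>"
| "sat S e (BigAnd \<Phi>) \<longleftrightarrow> (\<forall>n. sat S e (\<Phi> n))"
| "sat S e (Ex x \<phi>) \<longleftrightarrow> (\<exists>a \<in> univ S. sat S (e(x := a)) \<phi>)"

primrec quantifier_free :: "('f, 'r, 'v) fm \<Rightarrow> bool" where
  "quantifier_free (Eq s t) \<longleftrightarrow> True"
| "quantifier_free (Rel r ts) \<longleftrightarrow> True"
| "quantifier_free (Neg \<phi>) \<longleftrightarrow> quantifier_free \<phi>"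
| "quantifier_free (And \<phi> \<psi>) \<longleftrightarrow> quantifier_free \<phi> \<and> quantifier_free \<psi>"
| "quantifier_free (BigAnd \<Phi>) \<longleftrightarrow> False"
| "quantifier_free (Ex x \<phi>) \<longleftrightarrow> False"

definition qftp ::
    "('f, 'r) lang \<Rightarrow> ('a, 'f, 'r, 'z) str_scheme \<Rightarrow> 'v set \<Rightarrow> ('v \<Rightarrow> 'a) \<Rightarrow> ('f, 'r, 'v) fm set" where
  "qftp L S I e = {\<phi>. wf_fm L \<phi> \<and> quantifier_free \<phi> \<and> fv \<phi> \<subseteq> I \<and> sat S e \<phi>}"

definition tp_list ::
    "('f, 'r) lang \<Rightarrow> ('a, 'f, 'r, 'z) str_scheme \<Rightarrow> 'a list \<Rightarrow> ('f, 'r, nat) fm set" where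
  "tp_list L S bs = qftp L S {..<length bs} (nth bs)"

text \<open>The type of the concatenation of a family \<open>\<alpha>\<close> indexed by \<open>I\<close> and a finite tuple \<open>bs\<close>.\<close>

definition tp_app ::
    "('f, 'r) lang \<Rightarrow> ('a, 'f, 'r, 'z) str_scheme \<Rightarrow> 'i set \<Rightarrow> ('i \<Rightarrow> 'a) \<Rightarrow> 'a list
      \<Rightarrow> ('f, 'r, 'i + nat) fm set" where
  "tp_app L S I \<alpha> bs = qftp L S (I <+> {..<length bs}) (case_sum \<alpha> (nth bs))"

definition pregeometry :: "'a set \<Rightarrow> ('a set \<Rightarrow> 'a set) \<Rightarrow> bool" where
  "pregeometry M c \<longleftrightarrow>
     (\<forall>A \<subseteq> M. A \<subseteq> c A \<and> c A \<subseteq> M \<and> c (c A) = c A) \<and>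
     (\<forall>A B. A \<subseteq> B \<and> B \<subseteq> M \<longrightarrow> c A \<subseteq> c B) \<and>
     (\<forall>A \<subseteq> M. \<forall>x \<in> c A. \<exists>F \<subseteq> A. finite F \<and> x \<in> c F) \<and>
     (\<forall>A \<subseteq> M. \<forall>a \<in> M. \<forall>b \<in> M. a \<in> c (insert b A) \<and> a \<notin> c A \<longrightarrow> b \<in> c (insert a A))"

definition pg_indep :: "('a set \<Rightarrow> 'a set) \<Rightarrow> 'a set \<Rightarrow> bool" where
  "pg_indep c X \<longleftrightarrow> (\<forall>x \<in> X. x \<notin> c (X - {x}))"

definition pg_basis :: "('a set \<Rightarrow> 'a set) \<Rightarrow> 'a set \<Rightarrow> 'a set \<Rightarrow> bool" where
  "pg_basis c Y X \<longleftrightarrow> X \<subseteq> Y \<and> pg_indep c X \<and> Y \<subseteq> c X"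

definition localize :: "('a set \<Rightarrow> 'a set) \<Rightarrow> 'a set \<Rightarrow> 'a set \<Rightarrow> 'a set" where
  "localize c B X = c (X \<union> B)"

text \<open>Dimensions are cardinals in the sense of HOL, to be compared by \<open>=o\<close> and \<open>\<le>o\<close> only; in
  a pregeometry the value does not depend, up to \<open>=o\<close>, on the basis chosen.\<close>

definition pg_dim :: "('a set \<Rightarrow> 'a set) \<Rightarrow> 'a set \<Rightarrow> 'a rel" where
  "pg_dim c Y = |SOME X. pg_basis c Y X|"

definition dim_over :: "('a set \<Rightarrow> 'a set) \<Rightarrow> 'a set \<Rightarrow> 'a set \<Rightarrow> 'a rel" where
  "dim_over c Y B = pg_dim (localize c B) Y"

definition perp_cl :: "('a set \<Rightarrow> 'a set) \<Rightarrow> 'a list \<Rightarrow> 'a set \<Rightarrow> 'a set \<Rightarrow> bool" where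
  "perp_cl c as C B \<longleftrightarrow> dim_over c (set as) (B \<union> C) =o dim_over c (set as) C"

definition QM1 :: "('f, 'r) lang \<Rightarrow> ('a, 'f, 'r) pstr \<Rightarrow> bool" where
  "QM1 L S \<longleftrightarrow>
     (\<forall>a \<in> univ S. \<forall>a' \<in> univ S. \<forall>bs bs'. set bs \<subseteq> univ S \<and> set bs' \<subseteq> univ S \<and>
        tp_list L S (a # bs) = tp_list L S (a' # bs') \<longrightarrow>
        (a \<in> cl S (set bs) \<longleftrightarrow> a' \<in> cl S (set bs')))"

definition QM2 :: "('a, 'f, 'r) pstr \<Rightarrow> bool" where
  "QM2 S \<longleftrightarrow> natLeq \<le>o pg_dim (cl S) (univ S)"

definition QM3 :: "('a, 'f, 'r) pstr \<Rightarrow> bool" where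
  "QM3 S \<longleftrightarrow> (\<forall>A \<subseteq> univ S. finite A \<longrightarrow> countable (cl S A))"

definition closed_in :: "('a, 'f, 'r) pstr \<Rightarrow> 'a set \<Rightarrow> bool" where
  "closed_in S A \<longleftrightarrow> A \<subseteq> univ S \<and> cl S A = A"

text \<open>Countable sets, possibly finite or empty, are enumerated as \<open>\<alpha> ` I\<close> with \<open>I\<close> a set of
  natural numbers. Types contain equalities, so two enumerations with equal types have the same
  repetitions.\<close>

definition QM4 :: "('f, 'r) lang \<Rightarrow> ('a, 'f, 'r) pstr \<Rightarrow> bool" where
  "QM4 L S \<longleftrightarrow>
     (\<forall>(I :: nat set) \<alpha> \<alpha>'. closed_in S (\<alpha> ` I) \<and> closed_in S (\<alpha>' ` I) \<and>
        qftp L S I \<alpha> = qftp L S I \<alpha>' \<longrightarrow>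
        (\<forall>a \<in> univ S - \<alpha> ` I. \<forall>a' \<in> univ S - \<alpha>' ` I.
           tp_app L S I \<alpha> [a] = tp_app L S I \<alpha>' [a']))"

definition QM5 :: "('f, 'r) lang \<Rightarrow> ('a, 'f, 'r) pstr \<Rightarrow> bool" where
  "QM5 L S \<longleftrightarrow>
     (\<forall>(I :: nat set) \<alpha> \<alpha>'.
        (closed_in S (\<alpha> ` I) \<or> \<alpha> ` I = {}) \<and> (closed_in S (\<alpha>' ` I) \<or> \<alpha>' ` I = {}) \<and>
        qftp L S I \<alpha> = qftp L S I \<alpha>' \<longrightarrow>
        (\<forall>bs bs'. set bs \<subseteq> univ S \<and> set bs' \<subseteq> univ S \<and>
           tp_app L S I \<alpha> bs = tp_app L S I \<alpha>' bs' \<longrightarrow>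
           (\<forall>a \<in> cl S (\<alpha> ` I \<union> set bs). \<exists>a' \<in> univ S.
              tp_app L S I \<alpha> (bs @ [a]) = tp_app L S I \<alpha>' (bs' @ [a']))))"

definition qm_structure :: "('f, 'r) lang \<Rightarrow> ('a, 'f, 'r) pstr \<Rightarrow> bool" where
  "qm_structure L S \<longleftrightarrow>
     is_str L S \<and> pregeometry (univ S) (cl S) \<and> QM1 L S \<and> QM2 S \<and> QM3 S \<and> QM4 L S \<and> QM5 L S"

definition closed_embedding ::
    "('f, 'r) lang \<Rightarrow> ('a, 'f, 'r) pstr \<Rightarrow> ('a, 'f, 'r) pstr \<Rightarrow> ('a \<Rightarrow> 'a) \<Rightarrow> bool" where
  "closed_embedding L S T \<theta> \<longleftrightarrow>
     is_pstr L S \<and> is_pstr L T \<and> \<theta> ` univ S \<subseteq> univ T \<and> inj_on \<theta> (univ S) \<and>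
     (\<forall>f \<in> fsyms L. \<forall>xs. length xs = farity L f \<and> set xs \<subseteq> univ S \<longrightarrow>
        \<theta> (fint S f xs) = fint T f (map \<theta> xs)) \<and>
     (\<forall>r \<in> rsyms L. \<forall>xs. length xs = rarity L r \<and> set xs \<subseteq> univ S \<longrightarrow>
        (rint S r xs \<longleftrightarrow> rint T r (map \<theta> xs))) \<and>
     (\<forall>A \<subseteq> univ S. \<theta> ` cl S A = cl T (\<theta> ` A))"

definition isomorphic :: "('f, 'r) lang \<Rightarrow> ('a, 'f, 'r) pstr \<Rightarrow> ('a, 'f, 'r) pstr \<Rightarrow> bool" where
  "isomorphic L S T \<longleftrightarrow> (\<exists>\<theta>. closed_embedding L S T \<theta> \<and> \<theta> ` univ S = univ T)"

definition closed_sub :: "('f, 'r) lang \<Rightarrow> ('a, 'f, 'r) pstr \<Rightarrow> ('a, 'f, 'r) pstr \<Rightarrow> bool" where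
  "closed_sub L S T \<longleftrightarrow> univ S \<subseteq> univ T \<and> closed_embedding L S T id"

text \<open>\<open>U\<close> is the union of the chain \<open>K\<close>; its closure operator is the finitary one determined by
  those of the members of \<open>K\<close>.\<close>

definition is_chain_union ::
    "('f, 'r) lang \<Rightarrow> ('a, 'f, 'r) pstr set \<Rightarrow> ('a, 'f, 'r) pstr \<Rightarrow> bool" where
  "is_chain_union L K U \<longleftrightarrow>
     K \<noteq> {} \<and> (\<forall>S \<in> K. \<forall>T \<in> K. closed_sub L S T \<or> closed_sub L T S) \<and>
     univ U = (\<Union>S \<in> K. univ S) \<and> (\<forall>S \<in> K. closed_sub L S U) \<and>
     (\<forall>A \<subseteq> univ U. cl U A = \<Union> {cl S F | S F. S \<in> K \<and> finite F \<and> F \<subseteq> A \<inter> univ S})"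

text \<open>The class generated by \<open>S0\<close>, its members being realized on subsets of the type \<open>'a\<close>.
  A chain of closed embeddings becomes a chain of inclusions after transport along the embeddings
  into its limit, so inclusions together with closure under isomorphism suffice.\<close>

inductive_set generated_class ::
    "('f, 'r) lang \<Rightarrow> ('a, 'f, 'r) pstr \<Rightarrow> ('a, 'f, 'r) pstr set"
  for L :: "('f, 'r) lang" and S0 :: "('a, 'f, 'r) pstr" where
  base: "S0 \<in> generated_class L S0"
| iso: "S \<in> generated_class L S0 \<Longrightarrow> isomorphic L S T \<Longrightarrow> T \<in> generated_class L S0"
| sub: "S \<in> generated_class L S0 \<Longrightarrow> closed_sub L T S \<Longrightarrow> T \<in> generated_class L S0"
| chain: "(\<And>S. S \<in> K \<Longrightarrow> S \<in> generated_class L S0) \<Longrightarrow> is_chain_union L K U \<Longrightarrow>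
    U \<in> generated_class L S0"

definition quasiminimal_class :: "('f, 'r) lang \<Rightarrow> ('a, 'f, 'r) pstr set \<Rightarrow> bool" where
  "quasiminimal_class L \<C> \<longleftrightarrow> (\<exists>S0. qm_structure L S0 \<and> \<C> = generated_class L S0)"

definition modular_class :: "('a, 'f, 'r) pstr set \<Rightarrow> bool" where
  "modular_class \<C> \<longleftrightarrow>
     (\<forall>S \<in> \<C>. \<forall>as bs. set as \<subseteq> univ S \<and> set bs \<subseteq> univ S \<longrightarrow>
        perp_cl (cl S) as (cl S (set as) \<inter> cl S (set bs)) (set bs))"

definition dense_codense :: "('a, 'f, 'r) pstr \<Rightarrow> 'a set \<Rightarrow> bool" where
  "dense_codense M P \<longleftrightarrow> P \<subseteq> univ M \<and>
     (\<forall>B \<subseteq> univ M. finite B \<longrightarrow> (\<exists>a \<in> P. a \<notin> cl M B) \<and> (\<exists>a \<in> univ M. a \<notin> cl M (B \<union> P)))"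

text \<open>The closure operator is cut down to \<open>P\<close>, so that \<open>closed_sub L (induced M P) M\<close> does say
  that \<open>P\<close> is closed in \<open>M\<close>.\<close>

definition induced :: "('a, 'f, 'r) pstr \<Rightarrow> 'a set \<Rightarrow> ('a, 'f, 'r) pstr" where
  "induced M P = M\<lparr>univ := P, cl := \<lambda>A. cl M A \<inter> P\<rparr>"

definition beautiful_pair ::
    "('f, 'r) lang \<Rightarrow> ('a, 'f, 'r) pstr set \<Rightarrow> ('a, 'f, 'r) pstr \<Rightarrow> 'a set \<Rightarrow> bool" where
  "beautiful_pair L \<C> M P \<longleftrightarrow>
     M \<in> \<C> \<and> dense_codense M P \<and> induced M P \<in> \<C> \<and> closed_sub L (induced M P) M"

text \<open>The new predicate symbol is \<open>None\<close>.\<close>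

definition lang_P :: "('f, 'r) lang \<Rightarrow> ('f, 'r option) lang" where
  "lang_P L = \<lparr>fsyms = fsyms L, farity = farity L, rsyms = insert None (Some ` rsyms L),
     rarity = case_option 1 (rarity L)\<rparr>"

definition expand_P :: "('a, 'f, 'r) pstr \<Rightarrow> 'a set \<Rightarrow> ('a, 'f, 'r option) str" where
  "expand_P M P = \<lparr>univ = univ M, fint = fint M,
     rint = case_option (\<lambda>xs. \<exists>x \<in> P. xs = [x]) (rint M)\<rparr>"

text \<open>The type of \<open>as\<close> over \<open>B\<close> consists of the infinitary formulas in the variables
  \<open>Inl 0, \<dots>, Inl (length as - 1)\<close> with parameters from \<open>B\<close>, the parameter \<open>b\<close> being
  represented by the variable \<open>Inr b\<close>, which is assigned the value \<open>b\<close>. Like any countable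
  conjunction, a formula may involve countably many parameters.\<close>

definition tp_P ::
    "('f, 'r) lang \<Rightarrow> ('a, 'f, 'r) pstr \<Rightarrow> 'a set \<Rightarrow> 'a list \<Rightarrow> 'a set
      \<Rightarrow> ('f, 'r option, nat + 'a) fm set" where
  "tp_P L M P as B =
     {\<phi>. wf_fm (lang_P L) \<phi> \<and> fv \<phi> \<subseteq> {..<length as} <+> B \<and>
        sat (expand_P M P) (case_sum (nth as) id) \<phi>}"

definition dim_scl :: "('a, 'f, 'r) pstr \<Rightarrow> 'a set \<Rightarrow> 'a set \<Rightarrow> 'a set \<Rightarrow> 'a rel" where
  "dim_scl M P Y B = dim_over (cl M) Y (B \<union> P)"

definition perp_clP :: "('a, 'f, 'r) pstr \<Rightarrow> 'a set \<Rightarrow> 'a list \<Rightarrow> 'a set \<Rightarrow> 'a set \<Rightarrow> bool" where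
  "perp_clP M P as B C \<longleftrightarrow>
     dim_over (cl M) (set as) B =o dim_over (cl M) (set as) C \<and>
     dim_scl M P (set as) B =o dim_scl M P (set as) C"

end

theory Submission
  imports Defs
begin

text \<open>
The idea is to resolve the tuple \<open>as\<close> into generic parts and to move these. A basis \<open>es\<close> of
\<open>as\<close> over \<open>C \<union> P\<close> and a tuple \<open>ps\<close> from \<open>P\<close> that is independent over \<open>C\<close> make \<open>as\<close> algebraic over
\<open>ps\<close>, \<open>es\<close> and finitely many elements \<open>x0\<close> of \<open>C\<close> (\<open>tuple_resolution\<close>). As the dimensions of \<open>P\<close>
and of \<open>M\<close> over \<open>P\<close> are large, there are \<open>ps'\<close> in \<open>P\<close> independent over \<open>D\<close> and \<open>es'\<close> independent
over \<open>D \<union> P\<close> (\<open>not_in_cl_of_small\<close>). Every tuple in the closure of \<open>x0\<close>, \<open>ps'\<close> and \<open>es'\<close> is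
independent from \<open>D\<close> over \<open>C\<close> in both senses (\<open>dim_over_free\<close>), so the task is to realize the type
of \<open>as\<close> over \<open>C\<close> in this closure.

Over a countable subset of \<open>C\<close> this is a back-and-forth. A partial isomorphism between countable
closed sets extends to the closures after adding a generic element on each side; this combines QM4
and QM5 (\<open>ciso_extend\<close>). It can be made to respect \<open>P\<close> when the new elements are both in \<open>P\<close> or
both generic over \<open>P\<close>. In the first case this is where modularity enters: the new elements of \<open>P\<close>
are generated by the old ones and the added one (\<open>modular_law\<close>). In the second case no
elements of \<open>P\<close> are new. By density and codensity such isomorphisms have the back-and-forth property,
hence preserve all infinitary formulas of the pair (\<open>pair_iso_sat\<close>). Starting from the identity
on a countable closed set that contains \<open>x0\<close>, and sending \<open>ps\<close> to \<open>ps'\<close> and \<open>es\<close> to \<open>es'\<close>, one gets an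
image of \<open>as\<close>.

For uncountable \<open>C\<close> no such isomorphism over all of \<open>C\<close> is constructed. Instead, the images found over
the countable subsets of \<open>C\<close> all lie in the closure of \<open>x0\<close>, \<open>ps'\<close> and \<open>es'\<close>, so there are only
countably many of them. The countable subsets of \<open>C\<close> being countably directed, one image must
serve all of them (\<open>tp_P_eq_countably_directed\<close>), and it has the right type over \<open>C\<close> since a
formula has only countably many parameters.

The axioms are given for the structure that generates the class, and they have to be made available
in \<open>M\<close>. What is inherited by isomorphic copies, closed substructures and unions of chains is
that every finite set lies in a closed set isomorphic to a closed subset of the generating structure
(\<open>generated_class_locally_in\<close>). As that structure has infinite dimension and is homogeneous by QM4
and QM5, these isomorphisms can be fitted together along a countable set (\<open>countable_chart\<close>), and
partial isomorphisms of \<open>M\<close> can be extended by passing to the generating structure and back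
(\<open>member_ciso_extend\<close>).
\<close>

section \<open>Quantifier-free types and partial isomorphisms\<close>

lemma tm_val_rename: "tm_val S e (map_tm id h t) = tm_val S (e \<circ> h) t"
  by (induction t) (auto cong: map_cong)

lemma wf_tm_rename: "wf_tm L (map_tm id h t) \<longleftrightarrow> wf_tm L t"
  by (induction t) auto

lemma tm_vars_rename: "tm_vars (map_tm id h t) = h ` tm_vars t"
  by (induction t) auto

lemma tm_val_cong: "(\<And>v. v \<in> tm_vars t \<Longrightarrow> e v = e' v) \<Longrightarrow> tm_val S e t = tm_val S e' t"
proof (induction t)
  case (Fn f ts)
  then have "map (tm_val S e) ts = map (tm_val S e') ts" by auto
  then show ?case by (simp only: tm_val.simps sat.simps)
qed simp

lemma qf_rename:
  assumes "quantifier_free \<phi>"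
  shows "sat S e (map_fm id id h \<phi>) = sat S (e \<circ> h) \<phi>"
    "wf_fm L (map_fm id id h \<phi>) = wf_fm L \<phi>"
    "quantifier_free (map_fm id id h \<phi>)"
    "fv (map_fm id id h \<phi>) = h ` fv \<phi>"
  using assms
  by (induction \<phi>) (auto simp: tm_val_rename wf_tm_rename tm_vars_rename comp_def)

lemma qf_sat_cong:
  assumes "quantifier_free \<phi>" "\<And>v. v \<in> fv \<phi> \<Longrightarrow> e v = e' v"
  shows "sat S e \<phi> = sat S e' \<phi>"
  using assms
proof (induction \<phi>)
  case (Eq s t)
  then show ?case using tm_val_cong[of s e e' S] tm_val_cong[of t e e' S] by auto
next
  case (Rel r ts)
  then have "map (tm_val S e) ts = map (tm_val S e') ts"
    by (auto intro!: tm_val_cong)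
  then show ?case by (simp only: tm_val.simps sat.simps)
qed auto

lemma finite_tm_vars: "finite (tm_vars t)"
  by (induction t) auto

lemma qf_finite_fv: "quantifier_free \<phi> \<Longrightarrow> finite (fv \<phi>)"
  by (induction \<phi>) (auto simp: finite_tm_vars)

lemma qftp_eq_iff:
  "qftp L S I \<alpha> = qftp L T I \<beta> \<longleftrightarrow>
    (\<forall>\<phi>. wf_fm L \<phi> \<longrightarrow> quantifier_free \<phi> \<longrightarrow> fv \<phi> \<subseteq> I \<longrightarrow> (sat S \<alpha> \<phi> \<longleftrightarrow> sat T \<beta> \<phi>))"
  unfolding qftp_def by blast

text \<open>A partial isomorphism is kept as a set of pairs, and its pairs serve as the variables of the formulas
that compare the two sides. This makes the notion symmetric, gives it finite character, and contains
the comparison of any two families indexed by a common set: a family of pairs \<open>(\<alpha> i, \<beta> i)\<close> induces the relation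
of its values. Since equality is among the
quantifier-free formulas, such a relation is automatically functional and injective.\<close>

definition piso ::
    "('f, 'r) lang \<Rightarrow> ('a, 'f, 'r, 'z) str_scheme \<Rightarrow> ('b, 'f, 'r, 'y) str_scheme \<Rightarrow> ('a \<times> 'b) set \<Rightarrow> bool" where
  "piso L S T K \<longleftrightarrow> (\<forall>\<phi> :: ('f, 'r, 'a \<times> 'b) fm. wf_fm L \<phi> \<longrightarrow> quantifier_free \<phi> \<longrightarrow> fv \<phi> \<subseteq> K \<longrightarrow>
      (sat S fst \<phi> \<longleftrightarrow> sat T snd \<phi>))"

lemma piso_sat:
  fixes \<phi> :: "('f, 'r, 'v) fm"
  assumes "piso L S T K" "wf_fm L \<phi>" "quantifier_free \<phi>" "\<And>v. v \<in> fv \<phi> \<Longrightarrow> (\<alpha> v, \<beta> v) \<in> K"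
  shows "sat S \<alpha> \<phi> \<longleftrightarrow> sat T \<beta> \<phi>"
proof -
  define h where "h v = (\<alpha> v, \<beta> v)" for v
  have h: "fst \<circ> h = \<alpha>" "snd \<circ> h = \<beta>" by (auto simp: h_def)
  have "fv (map_fm id id h \<phi>) \<subseteq> K" using assms(4) by (auto simp: qf_rename[OF assms(3)] h_def)
  with assms(1-3) have "sat S fst (map_fm id id h \<phi>) \<longleftrightarrow> sat T snd (map_fm id id h \<phi>)"
    unfolding piso_def by (simp add: qf_rename(2,3))
  then show ?thesis using assms(3) by (simp add: qf_rename h)
qed

lemma piso_qftp:
  assumes "piso L S T K" "\<And>i. i \<in> I \<Longrightarrow> (\<alpha> i, \<beta> i) \<in> K"
  shows "qftp L S I \<alpha> = qftp L T I \<beta>"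
  unfolding qftp_eq_iff using piso_sat[OF assms(1)] assms(2) by (metis subsetD)

text \<open>Repetitions do no harm in passing from families to relations: indices carrying the same pair are
interchangeable, so any choice of an index for each pair renames a formula in pairs to a formula
in indices.\<close>

lemma qftp_piso:
  assumes "qftp L S I \<alpha> = qftp L T I \<beta>" "K \<subseteq> (\<lambda>i. (\<alpha> i, \<beta> i)) ` I"
  shows "piso L S T K"
  unfolding piso_def
proof (intro allI impI)
  fix \<psi>
  assume wf: "wf_fm L \<psi>" and qf: "quantifier_free \<psi>" and fv: "fv \<psi> \<subseteq> K"
  define h where "h p = (SOME i. i \<in> I \<and> (\<alpha> i, \<beta> i) = p)" for p
  have h: "h p \<in> I \<and> (\<alpha> (h p), \<beta> (h p)) = p" if p: "p \<in> K" for p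
  proof -
    obtain i where "i \<in> I" "p = (\<alpha> i, \<beta> i)" using p assms(2) by blast
    then have "\<exists>i. i \<in> I \<and> (\<alpha> i, \<beta> i) = p" by blast
    then show ?thesis unfolding h_def by (rule someI_ex)
  qed
  have h': "fst v = (\<alpha> \<circ> h) v" "snd v = (\<beta> \<circ> h) v" "h v \<in> I" if "v \<in> fv \<psi>" for v
  proof -
    have "v \<in> K" using that fv by blast
    note * = h[OF this]
    show "fst v = (\<alpha> \<circ> h) v" using arg_cong[OF conjunct2[OF *], of fst] by simp
    show "snd v = (\<beta> \<circ> h) v" using arg_cong[OF conjunct2[OF *], of snd] by simp
    show "h v \<in> I" using * by (rule conjunct1)
  qed
  have "sat S fst \<psi> = sat S (\<alpha> \<circ> h) \<psi>" by (rule qf_sat_cong[OF qf h'(1)])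
  moreover have "sat T snd \<psi> = sat T (\<beta> \<circ> h) \<psi>" by (rule qf_sat_cong[OF qf h'(2)])
  moreover have "fv (map_fm id id h \<psi>) \<subseteq> I"
    unfolding qf_rename(4)[OF qf] by (rule image_subsetI) (rule h'(3))
  then have "sat S \<alpha> (map_fm id id h \<psi>) = sat T \<beta> (map_fm id id h \<psi>)"
    using assms(1) wf qf unfolding qftp_eq_iff by (simp add: qf_rename(2,3))
  ultimately show "sat S fst \<psi> = sat T snd \<psi>"
    by (simp add: qf_rename(1)[OF qf])
qed

lemma piso_mono: "piso L S T K \<Longrightarrow> K' \<subseteq> K \<Longrightarrow> piso L S T K'"
  unfolding piso_def by (meson subset_trans)

lemma piso_finite_character:
  assumes "\<And>R. finite R \<Longrightarrow> R \<subseteq> K \<Longrightarrow> piso L S T R"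
  shows "piso L S T K"
  unfolding piso_def
proof (intro allI impI)
  fix \<psi>
  assume wf: "wf_fm L \<psi>" and qf: "quantifier_free \<psi>" and fv: "fv \<psi> \<subseteq> K"
  have "piso L S T (fv \<psi>)" using assms[OF qf_finite_fv[OF qf] fv] .
  then show "sat S fst \<psi> = sat T snd \<psi>"
    using wf qf by (intro piso_sat) simp_all
qed

lemma piso_converse:
  assumes "piso L S T K" shows "piso L T S (K\<inverse>)"
proof (rule qftp_piso)
  show "qftp L T K snd = qftp L S K fst" by (rule piso_qftp[OF assms, symmetric]) simp
  show "K\<inverse> \<subseteq> (\<lambda>i. (snd i, fst i)) ` K" by force
qed

lemma piso_comp:
  assumes F: "piso L S T F" and G: "piso L T U G" shows "piso L S U (F O G)"
proof -
  define h where "h p = (SOME y. (fst p, y) \<in> F \<and> (y, snd p) \<in> G)" for p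
  have h: "(fst p, h p) \<in> F \<and> (h p, snd p) \<in> G" if "p \<in> F O G" for p
  proof -
    from that obtain x y z where "p = (x, z)" "(x, y) \<in> F" "(y, z) \<in> G" by (rule relcompE)
    then have "\<exists>y. (fst p, y) \<in> F \<and> (y, snd p) \<in> G" by auto
    then show ?thesis unfolding h_def by (rule someI_ex)
  qed
  have "qftp L S (F O G) fst = qftp L T (F O G) h" by (rule piso_qftp[OF F]) (erule h[THEN conjunct1])
  also have "\<dots> = qftp L U (F O G) snd" by (rule piso_qftp[OF G]) (erule h[THEN conjunct2])
  finally have "qftp L S (F O G) fst = qftp L U (F O G) snd" .
  then show ?thesis
  proof (rule qftp_piso)
    show "F O G \<subseteq> (\<lambda>i. (fst i, snd i)) ` (F O G)" unfolding prod.collapse by (simp only: image_ident subset_refl)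
  qed
qed

lemma piso_eq_iff:
  assumes "piso L S T K" "(x, y) \<in> K" "(x', y') \<in> K"
  shows "x = x' \<longleftrightarrow> y = y'"
  using piso_sat[OF assms(1), where \<phi>="Eq (Var True) (Var False)"
      and \<alpha>="case_bool x x'" and \<beta>="case_bool y y'"] assms(2,3)
  by (auto split: bool.splits)

text \<open>Function symbols are respected as soon as the value in question is itself in the domain, the
equation between the value and the term being quantifier-free.\<close>

lemma piso_fint_iff:
  assumes K: "piso L S T K" and f: "f \<in> fsyms L" "length xs = farity L f"
    and xs: "list_all2 (\<lambda>x y. (x, y) \<in> K) xs ys" and ab: "(a, b) \<in> K"
  shows "a = fint S f xs \<longleftrightarrow> b = fint T f ys"
proof -
  define n where "n = length xs"
  define \<alpha> where "\<alpha> i = (if i < n then xs ! i else a)" for i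
  define \<beta> where "\<beta> i = (if i < n then ys ! i else b)" for i
  have len: "length ys = n" using xs by (simp add: n_def list_all2_lengthD)
  have map: "map \<alpha> [0..<n] = xs" "map \<beta> [0..<n] = ys"
    using len by (auto simp: \<alpha>_def \<beta>_def n_def intro: nth_equalityI)
  have "(\<alpha> i, \<beta> i) \<in> K" for i
    using xs ab by (auto simp: \<alpha>_def \<beta>_def n_def list_all2_conv_all_nth)
  then have "sat S \<alpha> (Eq (Var n) (Fn f (map Var [0..<n]))) \<longleftrightarrow>
      sat T \<beta> (Eq (Var n) (Fn f (map Var [0..<n])))"
    using f by (intro piso_sat[OF K]) (auto simp: n_def)
  then show ?thesis by (simp add: comp_def map, simp add: \<alpha>_def \<beta>_def)
qed

lemma tm_val_embedding:
  assumes "\<And>f xs. f \<in> fsyms L \<Longrightarrow> length xs = farity L f \<Longrightarrow> set xs \<subseteq> A \<Longrightarrow>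
      fint S f xs \<in> A \<and> \<theta> (fint S f xs) = fint T f (map \<theta> xs)"
    and "wf_tm L t" "\<And>v. v \<in> tm_vars t \<Longrightarrow> e v \<in> A"
  shows "tm_val S e t \<in> A \<and> \<theta> (tm_val S e t) = tm_val T (\<lambda>v. \<theta> (e v)) t"
  using assms(2,3)
proof (induction t)
  case (Fn f ts)
  then have *: "tm_val S e t \<in> A \<and> \<theta> (tm_val S e t) = tm_val T (\<lambda>v. \<theta> (e v)) t" if "t \<in> set ts" for t
    using that by auto
  then have "map \<theta> (map (tm_val S e) ts) = map (tm_val T (\<lambda>v. \<theta> (e v))) ts" by auto
  moreover have "set (map (tm_val S e) ts) \<subseteq> A" using * by auto
  ultimately show ?case
    using assms(1)[of f "map (tm_val S e) ts"] Fn.prems(1)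
    by (simp only: tm_val.simps wf_tm.simps length_map)
qed auto

lemma piso_embedding:
  assumes fn: "\<And>f xs. f \<in> fsyms L \<Longrightarrow> length xs = farity L f \<Longrightarrow> set xs \<subseteq> A \<Longrightarrow>
      fint S f xs \<in> A \<and> \<theta> (fint S f xs) = fint T f (map \<theta> xs)"
    and rel: "\<And>r xs. r \<in> rsyms L \<Longrightarrow> length xs = rarity L r \<Longrightarrow> set xs \<subseteq> A \<Longrightarrow>
      rint S r xs \<longleftrightarrow> rint T r (map \<theta> xs)"
    and inj: "inj_on \<theta> A"
  shows "piso L S T ((\<lambda>x. (x, \<theta> x)) ` A)"
proof (rule qftp_piso[OF _ subset_refl])
  have tm: "tm_val S (\<lambda>x. x) t \<in> A \<and> \<theta> (tm_val S (\<lambda>x. x) t) = tm_val T \<theta> t"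
    if "wf_tm L t" "tm_vars t \<subseteq> A" for t
    using tm_val_embedding[of L A S \<theta> T t "\<lambda>x. x"] fn that by blast
  have "sat S (\<lambda>x. x) \<phi> \<longleftrightarrow> sat T \<theta> \<phi>" if "wf_fm L \<phi>" "quantifier_free \<phi>" "fv \<phi> \<subseteq> A" for \<phi>
    using that
  proof (induction \<phi>)
    case (Eq s t)
    then show ?case using tm[of s] tm[of t] inj_on_eq_iff[OF inj] by (metis sat.simps(1) wf_fm.simps(1) fv.simps(1) Un_subset_iff)
  next
    case (Rel r ts)
    then have *: "tm_val S (\<lambda>x. x) t \<in> A \<and> \<theta> (tm_val S (\<lambda>x. x) t) = tm_val T \<theta> t" if "t \<in> set ts" for t
      using tm that by (auto simp: UN_subset_iff)
    then have "map \<theta> (map (tm_val S (\<lambda>x. x)) ts) = map (tm_val T \<theta>) ts" by auto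
    moreover have "set (map (tm_val S (\<lambda>x. x)) ts) \<subseteq> A" using * by auto
    ultimately show ?case using rel[of r "map (tm_val S (\<lambda>x. x)) ts"] Rel.prems(1)
      by (simp only: sat.simps wf_fm.simps length_map)
  qed auto
  then show "qftp L S A (\<lambda>x. x) = qftp L T A \<theta>"
    unfolding qftp_eq_iff by simp
qed

section \<open>Independence in pregeometries\<close>

text \<open>Independence of an enumerated tuple over \<open>B\<close>, read one entry at a time. The partial isomorphisms
below are extended by one element at a time, and each step needs exactly one of these conditions.\<close>

primrec seq_indep :: "('a set \<Rightarrow> 'a set) \<Rightarrow> 'a set \<Rightarrow> 'a list \<Rightarrow> bool" where
  "seq_indep c B [] \<longleftrightarrow> True"
| "seq_indep c B (x # xs) \<longleftrightarrow> x \<notin> c B \<and> seq_indep c (insert x B) xs"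

lemma seq_indep_append:
  "seq_indep c B (xs @ ys) \<longleftrightarrow> seq_indep c B xs \<and> seq_indep c (B \<union> set xs) ys"
  by (induction xs arbitrary: B) auto

locale pregeom =
  fixes U :: "'a set" and c :: "'a set \<Rightarrow> 'a set"
  assumes pg: "pregeometry U c"
begin

lemma cl_extensive: "A \<subseteq> U \<Longrightarrow> A \<subseteq> c A"
  and cl_subset: "A \<subseteq> U \<Longrightarrow> c A \<subseteq> U"
  and cl_idem: "A \<subseteq> U \<Longrightarrow> c (c A) = c A"
  using pg unfolding pregeometry_def by meson+

lemma cl_mono: "A \<subseteq> B \<Longrightarrow> B \<subseteq> U \<Longrightarrow> c A \<subseteq> c B"
  using pg unfolding pregeometry_def by meson

lemma cl_finite:
  assumes "A \<subseteq> U" "x \<in> c A" obtains F where "finite F" "F \<subseteq> A" "x \<in> c F"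
proof -
  have "\<forall>A \<subseteq> U. \<forall>x \<in> c A. \<exists>F \<subseteq> A. finite F \<and> x \<in> c F"
    using pg unfolding pregeometry_def by meson
  then have "\<exists>F \<subseteq> A. finite F \<and> x \<in> c F" using assms by simp
  then show thesis using that by metis
qed

lemma exchange:
  "A \<subseteq> U \<Longrightarrow> b \<in> U \<Longrightarrow> a \<in> c (insert b A) \<Longrightarrow> a \<notin> c A \<Longrightarrow> b \<in> c (insert a A)"
  using pg cl_subset[of "insert b A"] unfolding pregeometry_def by (meson insert_subset subsetD)

lemma cl_minimal: "A \<subseteq> c B \<Longrightarrow> B \<subseteq> U \<Longrightarrow> c A \<subseteq> c B"
  by (metis cl_idem cl_mono cl_subset)

lemma cl_monoD: "x \<in> c A \<Longrightarrow> A \<subseteq> B \<Longrightarrow> B \<subseteq> U \<Longrightarrow> x \<in> c B"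
  using cl_mono[of A B] by (rule subsetD)

lemma cl_minimalD: "x \<in> c A \<Longrightarrow> A \<subseteq> c B \<Longrightarrow> B \<subseteq> U \<Longrightarrow> x \<in> c B"
  using cl_minimal[of A B] by (rule subsetD)

lemma cl_extensiveD: "x \<in> A \<Longrightarrow> A \<subseteq> U \<Longrightarrow> x \<in> c A"
  using cl_extensive[of A] by (rule subsetD)

lemma cl_finite_cover:
  assumes "finite A" "B \<subseteq> U" "A \<subseteq> c B" obtains F where "finite F" "F \<subseteq> B" "A \<subseteq> c F"
proof -
  have "\<exists>F. finite F \<and> F \<subseteq> B \<and> A \<subseteq> c F"
    using assms(1,3)
  proof (induction A)
    case empty
    then show ?case by (intro exI[of _ "{}"]) simp
  next
    case (insert a A)
    then obtain F where F: "finite F" "F \<subseteq> B" "A \<subseteq> c F" by auto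
    obtain G where G: "finite G" "G \<subseteq> B" "a \<in> c G"
      using cl_finite[OF assms(2), of a] insert.prems by auto
    have "F \<union> G \<subseteq> U" using F G assms(2) by auto
    then have "c F \<subseteq> c (F \<union> G)" "c G \<subseteq> c (F \<union> G)"
      by (simp_all add: cl_mono)
    then show ?case using F G by (intro exI[of _ "F \<union> G"]) auto
  qed
  then show thesis using that by metis
qed

lemma seq_indep_antimono:
  assumes "seq_indep c B xs" "A \<subseteq> c B" "B \<subseteq> U" "set xs \<subseteq> U"
  shows "seq_indep c A xs"
  using assms
proof (induction xs arbitrary: A B)
  case (Cons x xs)
  have "insert x A \<subseteq> c (insert x B)"
    using Cons.prems cl_mono[of B "insert x B"] cl_extensive[of "insert x B"] by auto
  then have "seq_indep c (insert x A) xs" using Cons.IH[of "insert x B" "insert x A"] Cons.prems by auto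
  moreover have "x \<notin> c A" using Cons.prems cl_minimal[of A B] by auto
  ultimately show ?case by simp
qed simp

text \<open>Symmetry of independence: if \<open>xs\<close> is independent over \<open>B\<close> together with \<open>d\<close>, and \<open>d\<close> is independent
over \<open>B\<close>, then \<open>d\<close> can be moved to the end by exchanging it with one entry after another.\<close>

lemma seq_indep_swap:
  assumes "seq_indep c (insert d B) xs" "d \<notin> c B" "d \<in> U" "B \<subseteq> U" "set xs \<subseteq> U"
  shows "d \<notin> c (B \<union> set xs)"
  using assms
proof (induction xs arbitrary: B)
  case (Cons x xs)
  have "d \<notin> c (insert x B)" using exchange[of B x d] Cons.prems by auto
  moreover have "seq_indep c (insert d (insert x B)) xs"
    using Cons.prems by (simp add: insert_commute)
  ultimately have "d \<notin> c (insert x B \<union> set xs)" using Cons.IH[of "insert x B"] Cons.prems by auto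
  then show ?case by simp
qed simp

lemma seq_indep_exists:
  assumes "finite A" "A \<subseteq> U" "B \<subseteq> U"
  obtains xs where "set xs \<subseteq> A" "seq_indep c B xs" "A \<subseteq> c (B \<union> set xs)"
  using assms(1,2)
proof (induction A arbitrary: thesis)
  case empty
  show ?case by (rule empty(1)[of "[]"]) auto
next
  case (insert a A)
  obtain xs where xs: "set xs \<subseteq> A" "seq_indep c B xs" "A \<subseteq> c (B \<union> set xs)" using insert by blast
  show ?case
  proof (cases "a \<in> c (B \<union> set xs)")
    case True
    then show ?thesis using xs insert(4)[of xs] by blast
  next
    case False
    have sub: "B \<union> set (xs @ [a]) \<subseteq> U" using xs insert.prems(2) assms(3) by auto
    have "c (B \<union> set xs) \<subseteq> c (B \<union> set (xs @ [a]))" by (rule cl_mono[OF _ sub]) auto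
    moreover have "a \<in> c (B \<union> set (xs @ [a]))" by (rule cl_extensiveD[OF _ sub]) simp
    ultimately have "insert a A \<subseteq> c (B \<union> set (xs @ [a]))" using xs by auto
    then show ?thesis using insert(4)[of "xs @ [a]"] xs False
      by (auto simp: seq_indep_append)
  qed
qed

text \<open>The element \<open>x\<close> depends on \<open>J\<close> over \<open>Z\<close> but not on \<open>Z\<close> alone, so there is a first member of \<open>J\<close>
whose addition captures \<open>x\<close>, and exchange trades \<open>x\<close> for it.\<close>

lemma steinitz_step:
  assumes "finite J" "J \<subseteq> U" "Z \<subseteq> U" "x \<in> c (Z \<union> J)" "x \<notin> c Z"
  obtains j where "j \<in> J" "j \<in> c (insert x Z \<union> (J - {j}))"
proof -
  \<comment> \<open>By induction on \<open>J\<close>: the exchanged element is the one whose addition first puts \<open>x\<close> into the closure.\<close>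
  have "\<exists>j\<in>J. j \<in> c (insert x Z \<union> (J - {j}))"
    using assms
  proof (induction J)
    case (insert i I)
    have xU: "x \<in> U" using insert.prems cl_subset[of "Z \<union> insert i I"] by auto
    show ?case
    proof (cases "x \<in> c (Z \<union> I)")
      case True
      then obtain j where j: "j \<in> I" "j \<in> c (insert x Z \<union> (I - {j}))" using insert by auto
      have "j \<in> c (insert x Z \<union> (insert i I - {j}))"
        by (rule cl_monoD[OF j(2)]) (use insert.prems xU in auto)
      then show ?thesis using j by auto
    next
      case False
      have "i \<in> c (insert x (Z \<union> I))"
        by (rule exchange) (use insert.prems False in auto)
      then show ?thesis using insert.hyps by simp
    qed
  qed simp
  then show thesis using that by metis
qed

lemma steinitz:
  assumes "seq_indep c Z xs" "set xs \<subseteq> c (Z \<union> J)" "finite J" "Z \<subseteq> U" "J \<subseteq> U"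
  shows "length xs \<le> card J \<and> (length xs = card J \<longrightarrow> J \<subseteq> c (Z \<union> set xs))"
  using assms
proof (induction xs arbitrary: Z J)
  case (Cons x xs)
  have xsU: "set (x # xs) \<subseteq> U" using Cons.prems(2) cl_subset[of "Z \<union> J"] Cons.prems(4,5)
    by (meson Un_least subset_trans)
  have "x \<in> c (Z \<union> J)" "x \<notin> c Z" using Cons.prems by simp_all
  then obtain j where j: "j \<in> J" "j \<in> c (insert x Z \<union> (J - {j}))"
    using steinitz_step[of J Z x] Cons.prems(3-5) by metis
  have sub: "insert x Z \<union> (J - {j}) \<subseteq> U" using xsU Cons.prems(4,5) by auto
  have "z \<in> c (insert x Z \<union> (J - {j}))" if "z \<in> Z \<union> J" for z
  proof (cases "z = j")
    case False
    then show ?thesis using that by (intro cl_extensiveD[OF _ sub]) auto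
  next
    case True
    show ?thesis unfolding True by (rule j(2))
  qed
  then have "c (Z \<union> J) \<subseteq> c (insert x Z \<union> (J - {j}))" by (intro cl_minimal subsetI sub)
  moreover have "set xs \<subseteq> c (Z \<union> J)" using Cons.prems(2) by simp
  ultimately have xs: "set xs \<subseteq> c (insert x Z \<union> (J - {j}))" by (rule subset_trans[rotated])
  have sub1: "insert x Z \<subseteq> U" "J - {j} \<subseteq> U" "finite (J - {j})" "seq_indep c (insert x Z) xs"
    using sub Cons.prems(1,3) by auto
  have IH: "length xs \<le> card (J - {j})"
    "length xs = card (J - {j}) \<Longrightarrow> J - {j} \<subseteq> c (insert x Z \<union> set xs)"
    using Cons.IH[OF sub1(4) xs sub1(3,1,2)] by blast+
  have card: "card J = Suc (card (J - {j}))" by (rule card.remove[OF Cons.prems(3) j(1)])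
  have "J \<subseteq> c (Z \<union> set (x # xs))" if eq: "length xs = card (J - {j})"
  proof -
    have sub': "insert x Z \<union> set xs \<subseteq> U" using Cons.prems(4) xsU by simp
    have J: "J - {j} \<subseteq> c (insert x Z \<union> set xs)" by (rule IH(2)[OF eq])
    have "insert x Z \<subseteq> c (insert x Z \<union> set xs)"
      using cl_extensive[OF sub'] by (rule subset_trans[rotated]) auto
    then have "j \<in> c (insert x Z \<union> set xs)"
      by (intro cl_minimalD[OF j(2) _ sub'] Un_least J)
    then have "J \<subseteq> c (insert x Z \<union> set xs)" using J by blast
    then show ?thesis by simp
  qed
  then show ?case using IH(1) unfolding card list.size(4) by (simp only: add_Suc_right add_0_right Suc_le_mono nat.inject simp_thms) blast
next
  case Nil
  have "J = {}" if "card J = 0" using that Nil(3) by (simp only: card_0_eq)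
  then show ?case by (metis empty_subsetI le0 list.size(3))
qed

text \<open>A tuple \<open>es\<close> independent over \<open>D\<close> makes everything in the closure of \<open>C\<close> and \<open>es\<close> free from \<open>D\<close>
over \<open>C\<close>. A dependence on \<open>D\<close> uses finitely many elements \<open>d\<close>, which are removed one by one: if \<open>d\<close>
were needed, exchange would put \<open>d\<close> into the closure of the remaining parameters and \<open>es\<close>,
against the symmetry of independence.\<close>

lemma seq_indep_free:
  assumes "seq_indep c D es" "set es \<subseteq> U" "C \<subseteq> D" "D \<subseteq> U"
    and X: "X \<subseteq> c (C \<union> set es)" "y \<in> c (C \<union> set es)" and y: "y \<in> c (D \<union> X)"
  shows "y \<in> c (C \<union> X)"
proof -
  have "c (C \<union> set es) \<subseteq> U" using cl_subset assms by simp
  then have XU: "X \<subseteq> U" and yU: "y \<in> U" using X by auto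
  have step: "y \<in> c (C \<union> X)" if "finite D0" "D0 \<subseteq> D" "y \<in> c (C \<union> D0 \<union> X)" for D0
    using that
  proof (induction D0)
    case (insert d D0)
    define C1 where "C1 = C \<union> D0"
    have C1: "C1 \<subseteq> D" "C1 \<subseteq> U" "C \<subseteq> C1" "d \<in> D" "d \<in> U" using insert.prems assms by (auto simp: C1_def)
    have sub: "C1 \<union> X \<subseteq> U" "C1 \<union> set es \<subseteq> U" using C1 XU assms(2) by auto
    have y: "y \<in> c (insert d (C1 \<union> X))" using insert.prems by (simp add: C1_def)
    have "y \<in> c (C1 \<union> X)"
    proof (rule ccontr)
      assume n: "y \<notin> c (C1 \<union> X)"
      have d: "d \<in> c (insert y (C1 \<union> X))" by (rule exchange[OF sub(1) C1(5) y n])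
      have "c (C \<union> set es) \<subseteq> c (C1 \<union> set es)"
        by (rule cl_mono[OF _ sub(2)]) (use C1 in auto)
      moreover have "C1 \<subseteq> c (C1 \<union> set es)"
        using cl_extensive[OF sub(2)] by (rule subset_trans[rotated]) simp
      ultimately have "insert y (C1 \<union> X) \<subseteq> c (C1 \<union> set es)"
        using X by (meson Un_least insert_subsetI subsetD subset_trans)
      then have d': "d \<in> c (C1 \<union> set es)" by (rule cl_minimalD[OF d _ sub(2)])
      have "d \<notin> c C1"
      proof
        assume "d \<in> c C1"
        then have "d \<in> c (C1 \<union> X)" by (rule cl_monoD[OF _ _ sub(1)]) simp
        then have "insert d (C1 \<union> X) \<subseteq> c (C1 \<union> X)" using cl_extensive[OF sub(1)] by simp
        then show False using cl_minimalD[OF y _ sub(1)] n by simp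
      qed
      moreover have "seq_indep c (insert d C1) es"
      proof (rule seq_indep_antimono[OF assms(1) _ assms(4,2)])
        have "insert d C1 \<subseteq> D" using C1 by simp
        then show "insert d C1 \<subseteq> c D" using cl_extensive[OF assms(4)] by (rule subset_trans)
      qed
      ultimately have "d \<notin> c (C1 \<union> set es)"
        using seq_indep_swap C1(2,5) assms(2) by simp
      then show False using d' by simp
    qed
    then show ?case using insert by (simp add: C1_def)
  qed simp
  obtain F where F: "finite F" "F \<subseteq> D \<union> X" "y \<in> c F"
    using cl_finite[of "D \<union> X" y] y assms(4) XU by auto
  have "y \<in> c (C \<union> (F \<inter> D) \<union> X)" by (rule cl_monoD[OF F(3)]) (use F assms(3,4) XU in auto)
  then show ?thesis using step[of "F \<inter> D"] F by simp
qed

text \<open>Freeness shows more than equal dimensions: over \<open>C\<close> and over \<open>D\<close> the subsets of \<open>Y\<close> have the same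
closure relations, so the same sets are bases and even the chosen bases coincide.\<close>

lemma dim_over_free:
  assumes "seq_indep c D es" "set es \<subseteq> U" "C \<subseteq> D" "D \<subseteq> U" "Y \<subseteq> c (C \<union> set es)"
  shows "dim_over c Y C = dim_over c Y D"
proof -
  have "c (C \<union> set es) \<subseteq> U" using cl_subset assms by simp
  then have YU: "Y \<subseteq> U" using assms by auto
  have eq: "y \<in> c (X \<union> C) \<longleftrightarrow> y \<in> c (X \<union> D)" if "X \<subseteq> Y" "y \<in> Y" for X y
  proof
    show "y \<in> c (X \<union> C) \<Longrightarrow> y \<in> c (X \<union> D)"
      by (erule cl_monoD) (use assms YU that in auto)
    show "y \<in> c (X \<union> D) \<Longrightarrow> y \<in> c (X \<union> C)"
      using seq_indep_free[OF assms(1-4), of X y] assms(5) that by (auto simp: Un_commute)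
  qed
  have "pg_basis (localize c C) Y X \<longleftrightarrow> pg_basis (localize c D) Y X" for X
  proof (cases "X \<subseteq> Y")
    case True
    then have "pg_indep (localize c C) X \<longleftrightarrow> pg_indep (localize c D) X"
      unfolding pg_indep_def localize_def using eq by (meson Diff_subset subset_trans subsetD)
    moreover have "Y \<subseteq> c (X \<union> C) \<longleftrightarrow> Y \<subseteq> c (X \<union> D)" using eq[OF True] by blast
    ultimately show ?thesis unfolding pg_basis_def localize_def by simp
  qed (simp add: pg_basis_def)
  then have "pg_basis (localize c C) Y = pg_basis (localize c D) Y" by (rule ext)
  then show ?thesis unfolding dim_over_def pg_dim_def by simp
qed

lemma pg_indep_seq:
  assumes "finite X" "pg_indep (localize c Z) X" "X \<subseteq> U" "Z \<subseteq> U"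
  obtains xs where "set xs = X" "distinct xs" "seq_indep c Z xs"
  using assms
proof (induction X arbitrary: Z thesis)
  case empty
  show ?case by (rule empty(1)[of "[]"]) auto
next
  case (insert x X)
  have "pg_indep (localize c (insert x Z)) X"
    unfolding pg_indep_def localize_def
  proof
    fix y assume y: "y \<in> X"
    have "y \<notin> c (insert x X - {y} \<union> Z)"
      using insert.prems y unfolding pg_indep_def localize_def by auto
    moreover have "insert x X - {y} \<union> Z = X - {y} \<union> insert x Z" using y insert by auto
    ultimately show "y \<notin> c (X - {y} \<union> insert x Z)" by simp
  qed
  then obtain xs where xs: "set xs = X" "distinct xs" "seq_indep c (insert x Z) xs"
    using insert.IH[of "insert x Z"] insert.prems by auto
  have "x \<notin> c (X \<union> Z)"
    using insert.prems(2) insert.hyps unfolding pg_indep_def localize_def by auto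
  then have "x \<notin> c Z" using cl_mono[of Z "X \<union> Z"] insert.prems by auto
  then show ?case using insert.prems(1)[of "x # xs"] insert.hyps xs by auto
qed

lemma finite_pg_indep:
  assumes "pg_indep (localize c Z) X" "X \<subseteq> c (Z \<union> F)" "finite F" "F \<subseteq> U" "Z \<subseteq> U"
  shows "finite X"
proof (rule ccontr)
  assume "infinite X"
  then obtain Y where Y: "finite Y" "card Y = Suc (card F)" "Y \<subseteq> X"
    using infinite_arbitrarily_large by blast
  have XU: "X \<subseteq> U" using assms cl_subset[of "Z \<union> F"] by auto
  have "pg_indep (localize c Z) Y"
    unfolding pg_indep_def localize_def
  proof
    fix y assume "y \<in> Y"
    then have "y \<notin> c (X - {y} \<union> Z)" using assms(1) Y unfolding pg_indep_def localize_def by auto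
    moreover have "c (Y - {y} \<union> Z) \<subseteq> c (X - {y} \<union> Z)"
      by (rule cl_mono) (use Y XU assms in auto)
    ultimately show "y \<notin> c (Y - {y} \<union> Z)" by blast
  qed
  then obtain ys where ys: "set ys = Y" "distinct ys" "seq_indep c Z ys"
    using pg_indep_seq[of Y Z] Y XU assms by auto
  have "length ys \<le> card F"
    using steinitz[OF ys(3), of F] ys(1) Y assms by auto
  then show False using ys Y by (metis distinct_card not_less_eq_eq order_refl)
qed

lemma pg_basis_exists:
  assumes "Y \<subseteq> U" "Z \<subseteq> U"
  shows "\<exists>X. pg_basis (localize c Z) Y X"
proof -
  define \<A> where "\<A> = {X. X \<subseteq> Y \<and> pg_indep (localize c Z) X}"
  have "\<exists>X\<in>\<A>. \<forall>X'\<in>\<A>. X \<subseteq> X' \<longrightarrow> X' = X"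
  proof (rule subset_Zorn_nonempty)
    have "{} \<in> \<A>" by (simp add: \<A>_def pg_indep_def)
    then show "\<A> \<noteq> {}" by blast
    fix \<C> assume ne: "\<C> \<noteq> {}" and ch: "subset.chain \<A> \<C>"
    have sub: "\<C> \<subseteq> \<A>" and cmp: "\<And>A B. A \<in> \<C> \<Longrightarrow> B \<in> \<C> \<Longrightarrow> A \<subseteq> B \<or> B \<subseteq> A"
      using ch by (auto simp: subset_chain_def)
    have "x \<notin> c (\<Union>\<C> - {x} \<union> Z)" if x: "x \<in> \<Union>\<C>" for x
    proof
      assume "x \<in> c (\<Union>\<C> - {x} \<union> Z)"
      moreover have "\<Union>\<C> - {x} \<union> Z \<subseteq> U" using sub assms by (auto simp: \<A>_def)
      ultimately obtain F where F: "finite F" "F \<subseteq> \<Union>\<C> - {x} \<union> Z" "x \<in> c F"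
        using cl_finite by metis
      have "finite (insert x (F - Z))" "insert x (F - Z) \<subseteq> \<Union>\<C>" using F x by auto
      then obtain A where A: "A \<in> \<C>" "insert x (F - Z) \<subseteq> A"
        using finite_subset_Union_chain ne ch by metis
      have AY: "A \<subseteq> Y" "pg_indep (localize c Z) A" using A sub by (auto simp: \<A>_def)
      have "x \<in> c (A - {x} \<union> Z)"
        by (rule cl_monoD[OF F(3)]) (use F(2) A(2) AY assms in auto)
      moreover have "x \<notin> c (A - {x} \<union> Z)"
        using A(2) AY(2) unfolding pg_indep_def localize_def by simp
      ultimately show False by simp
    qed
    then show "\<Union>\<C> \<in> \<A>" using sub unfolding \<A>_def pg_indep_def localize_def by blast
  qed
  then obtain X where X: "X \<subseteq> Y" "pg_indep (localize c Z) X"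
    and max: "\<And>X'. X' \<subseteq> Y \<Longrightarrow> pg_indep (localize c Z) X' \<Longrightarrow> X \<subseteq> X' \<Longrightarrow> X' = X"
    by (auto simp: \<A>_def)
  have "y \<in> c (X \<union> Z)" if y: "y \<in> Y" for y
  proof (rule ccontr)
    assume n: "y \<notin> c (X \<union> Z)"
    have XU: "X \<union> Z \<subseteq> U" "y \<in> U" using X y assms by auto
    have yX: "y \<notin> X" using n cl_extensiveD[OF _ XU(1), of y] by auto
    have "pg_indep (localize c Z) (insert y X)"
      unfolding pg_indep_def localize_def
    proof
      fix x assume "x \<in> insert y X"
      then consider "x = y" | "x \<in> X" "x \<noteq> y" by blast
      then show "x \<notin> c (insert y X - {x} \<union> Z)"
      proof cases
        case 1
        then show ?thesis using n yX by simp
      next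
        case 2
        show ?thesis
        proof
          assume "x \<in> c (insert y X - {x} \<union> Z)"
          moreover have "insert y X - {x} \<union> Z = insert y (X - {x} \<union> Z)" using 2 by auto
          moreover have "x \<notin> c (X - {x} \<union> Z)"
            using X(2) 2(1) unfolding pg_indep_def localize_def by simp
          ultimately have "y \<in> c (insert x (X - {x} \<union> Z))"
            using exchange[of "X - {x} \<union> Z" y x] XU by (simp add: subset_iff)
          moreover have "insert x (X - {x} \<union> Z) = X \<union> Z" using 2 by auto
          ultimately show False using n by simp
        qed
      qed
    qed
    then show False using max[of "insert y X"] X y yX by auto
  qed
  then show ?thesis using X unfolding pg_basis_def localize_def by blast
qed

lemma pg_dim_basis:
  assumes "Y \<subseteq> U" "Z \<subseteq> U"
  obtains X where "pg_basis (localize c Z) Y X" "dim_over c Y Z = |X|"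
  using someI_ex[OF pg_basis_exists[OF assms]] unfolding dim_over_def pg_dim_def by blast

end

text \<open>The sets of \<open>n + 1\<close> elements arise from those of \<open>n\<close> elements by inserting one of \<open>|D|\<close> many.\<close>

lemma card_of_finite_subsets:
  assumes "infinite D"
  shows "|{F. F \<subseteq> D \<and> finite F}| \<le>o |D|"
proof -
  have n: "|{F. F \<subseteq> D \<and> finite F \<and> card F = n}| \<le>o |D|" for n
  proof (induction n)
    case 0
    have "{F. F \<subseteq> D \<and> finite F \<and> card F = 0} = {{}}" by auto
    then show ?case using assms by (simp add: card_of_singl_ordLeq infinite_imp_nonempty)
  next
    case (Suc n)
    let ?A = "{F. F \<subseteq> D \<and> finite F \<and> card F = n}"
    have "{F. F \<subseteq> D \<and> finite F \<and> card F = Suc n} \<subseteq> (\<Union>d\<in>D. insert d ` ?A)"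
    proof
      fix F assume "F \<in> {F. F \<subseteq> D \<and> finite F \<and> card F = Suc n}"
      then have F: "F \<subseteq> D" "finite F" "card F = Suc n" by auto
      then obtain d where "d \<in> F" by fastforce
      then have "F = insert d (F - {d})" "F - {d} \<in> ?A" "d \<in> D" using F by auto
      then show "F \<in> (\<Union>d\<in>D. insert d ` ?A)" by blast
    qed
    then have "|{F. F \<subseteq> D \<and> finite F \<and> card F = Suc n}| \<le>o |\<Union>d\<in>D. insert d ` ?A|"
      by (rule card_of_mono1)
    also have "|\<Union>d\<in>D. insert d ` ?A| \<le>o |D|"
      by (rule card_of_UNION_ordLeq_infinite[OF assms])
        (use card_of_image ordLeq_transitive Suc card_of_refl ordIso_imp_ordLeq in blast)+
    finally show ?case .
  qed
  have "{F. F \<subseteq> D \<and> finite F} = (\<Union>n::nat. {F. F \<subseteq> D \<and> finite F \<and> card F = n})" by auto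
  then show ?thesis
    using card_of_UNION_ordLeq_infinite[OF assms, of "UNIV :: nat set"
        "\<lambda>n. {F. F \<subseteq> D \<and> finite F \<and> card F = n}"] n assms infinite_iff_card_of_nat by auto
qed

text \<open>A small set does not span a set of dimension at least \<open>\<kappa>\<close>: each element of a basis lies in the
closure of a finite part of \<open>D\<close>, each finite part captures only finitely many basis elements, and
there are at most \<open>|D|\<close> many finite parts, or finitely many if \<open>D\<close> is finite.\<close>

lemma (in pregeom) not_in_cl_of_small:
  fixes \<kappa> :: "'k rel"
  assumes "Card_order \<kappa>" "natLeq <o \<kappa>" "\<kappa> \<le>o dim_over c Y Z" "|D| <o \<kappa>"
    and "Y \<subseteq> U" "Z \<subseteq> U" "D \<subseteq> U"
  obtains y where "y \<in> Y" "y \<notin> c (D \<union> Z)"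
proof (rule ccontr)
  assume "\<not> thesis"
  then have Y: "Y \<subseteq> c (D \<union> Z)" using that by blast
  obtain X where X: "pg_basis (localize c Z) Y X" "dim_over c Y Z = |X|"
    using pg_dim_basis[OF assms(5,6)] .
  have fin: "finite (X \<inter> c (F \<union> Z))" if "F \<subseteq> D" "finite F" for F
  proof (rule finite_pg_indep[of Z])
    show "pg_indep (localize c Z) (X \<inter> c (F \<union> Z))"
      unfolding pg_indep_def localize_def
    proof
      fix x assume x: "x \<in> X \<inter> c (F \<union> Z)"
      have "c (X \<inter> c (F \<union> Z) - {x} \<union> Z) \<subseteq> c (X - {x} \<union> Z)"
        by (rule cl_mono) (use X assms in \<open>auto simp: pg_basis_def\<close>)
      then show "x \<notin> c (X \<inter> c (F \<union> Z) - {x} \<union> Z)"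
        using x X unfolding pg_basis_def pg_indep_def localize_def by blast
    qed
    show "X \<inter> c (F \<union> Z) \<subseteq> c (Z \<union> F)" by (simp add: Un_commute)
  qed (use that assms in auto)
  have cover: "X \<subseteq> (\<Union>F\<in>{F. F \<subseteq> D \<and> finite F}. X \<inter> c (F \<union> Z))"
  proof
    fix x assume x: "x \<in> X"
    then have "x \<in> c (D \<union> Z)" using X Y by (auto simp: pg_basis_def)
    then obtain F where F: "finite F" "F \<subseteq> D \<union> Z" "x \<in> c F"
      using cl_finite[of "D \<union> Z" x] assms by blast
    have "c F \<subseteq> c (F \<inter> D \<union> Z)" by (rule cl_mono) (use F assms in auto)
    then show "x \<in> (\<Union>F\<in>{F. F \<subseteq> D \<and> finite F}. X \<inter> c (F \<union> Z))"
      using x F by (intro UN_I[of "F \<inter> D"]) auto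
  qed
  have "\<kappa> \<le>o |X|" using assms(3) X by simp
  moreover have "|X| <o \<kappa>"
  proof (cases "finite D")
    case True
    then have "finite X" by (intro finite_subset[OF cover] finite_UN_I) (auto intro: fin)
    then have "|X| <o natLeq" by (simp add: finite_iff_ordLess_natLeq)
    then show ?thesis using assms(2) ordLess_transitive by blast
  next
    case False
    have "|\<Union>F\<in>{F. F \<subseteq> D \<and> finite F}. X \<inter> c (F \<union> Z)| \<le>o |D|"
    proof (rule card_of_UNION_ordLeq_infinite[OF False card_of_finite_subsets[OF False]])
      show "\<forall>F\<in>{F. F \<subseteq> D \<and> finite F}. |X \<inter> c (F \<union> Z)| \<le>o |D|"
        by (intro ballI ordLess_imp_ordLeq finite_ordLess_infinite) (simp_all add: card_of_well_order_on fin False Field_card_of)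
    qed
    then have "|X| \<le>o |D|" using card_of_mono1[OF cover] ordLeq_transitive by blast
    then show ?thesis using assms(4) ordLeq_ordLess_trans by blast
  qed
  ultimately show False using not_ordLess_ordLeq by blast
qed

section \<open>Extending partial isomorphisms between closed sets\<close>

text \<open>Partial isomorphisms between closed sets that carry closures to closures. Closure is only tested on
finite sets of pairs; this is enough because closure operators are finitary, and it makes
composition, inversion and unions of chains work before anything is known about the operators.\<close>

definition ciso ::
    "('f, 'r) lang \<Rightarrow> ('a, 'f, 'r) pstr \<Rightarrow> ('a, 'f, 'r) pstr \<Rightarrow> ('a \<times> 'a) set \<Rightarrow> bool" where
  "ciso L S T F \<longleftrightarrow> piso L S T F \<and> F \<subseteq> univ S \<times> univ T \<and>
     (\<forall>R \<subseteq> F. finite R \<longrightarrow>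
        F `` cl S (Domain R) = cl T (Range R) \<and> F\<inverse> `` cl T (Range R) = cl S (Domain R))"

lemma finite_subset_Domain:
  assumes "finite A" "A \<subseteq> Domain F" obtains R where "R \<subseteq> F" "finite R" "Domain R = A"
  using finite_subset_image[OF assms(1), of fst F] assms(2) by (metis Domain_fst)

lemma ciso_piso: "ciso L S T F \<Longrightarrow> piso L S T F"
  and ciso_subset: "ciso L S T F \<Longrightarrow> F \<subseteq> univ S \<times> univ T"
  by (simp_all add: ciso_def)

lemma ciso_cl:
  assumes "ciso L S T F" "R \<subseteq> F" "finite R"
  shows "F `` cl S (Domain R) = cl T (Range R)" "F\<inverse> `` cl T (Range R) = cl S (Domain R)"
  using assms unfolding ciso_def by simp_all

lemma ciso_converse: assumes "ciso L S T F" shows "ciso L T S (F\<inverse>)"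
  unfolding ciso_def
proof (intro conjI allI impI)
  show "piso L T S (F\<inverse>)" using ciso_piso[OF assms] by (rule piso_converse)
  show "F\<inverse> \<subseteq> univ T \<times> univ S" using ciso_subset[OF assms] by blast
  fix R assume R: "R \<subseteq> F\<inverse>" "finite R"
  then have "R\<inverse> \<subseteq> F" "finite (R\<inverse>)" by auto
  from ciso_cl[OF assms this]
  show "F\<inverse> `` cl T (Domain R) = cl S (Range R)" "(F\<inverse>)\<inverse> `` cl S (Range R) = cl T (Domain R)"
    by simp_all
qed

lemma ciso_mem_iff:
  assumes "ciso L S T F" "(x, y) \<in> F" "R \<subseteq> F" "finite R"
  shows "x \<in> cl S (Domain R) \<longleftrightarrow> y \<in> cl T (Range R)"
  using ciso_cl[OF assms(1,3,4)] assms(2) by (metis ImageI converseI)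

lemma ciso_comp:
  assumes F: "ciso L S T F" and G: "ciso L T U G" shows "ciso L S U (F O G)"
  unfolding ciso_def
proof (intro conjI allI impI)
  show "piso L S U (F O G)" using ciso_piso[OF F] ciso_piso[OF G] by (rule piso_comp)
  show "F O G \<subseteq> univ S \<times> univ U" using ciso_subset[OF F] ciso_subset[OF G] by blast
  fix R assume R: "R \<subseteq> F O G" "finite R"
  have "\<forall>p\<in>R. \<exists>y. (fst p, y) \<in> F \<and> (y, snd p) \<in> G"
  proof
    fix p assume "p \<in> R"
    then have "p \<in> F O G" using R(1) by (rule subsetD[rotated])
    then obtain x y z where "p = (x, z)" "(x, y) \<in> F" "(y, z) \<in> G" by (rule relcompE)
    then show "\<exists>y. (fst p, y) \<in> F \<and> (y, snd p) \<in> G" by auto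
  qed
  then obtain h where h: "\<And>p. p \<in> R \<Longrightarrow> (fst p, h p) \<in> F" "\<And>p. p \<in> R \<Longrightarrow> (h p, snd p) \<in> G"
    by metis
  \<comment> \<open>The middle points chosen by \<open>h\<close> split \<open>R\<close> into a finite part of each factor.\<close>
  define R1 R2 where "R1 = (\<lambda>p. (fst p, h p)) ` R" and "R2 = (\<lambda>p. (h p, snd p)) ` R"
  have R12: "R1 \<subseteq> F" "finite R1" "R2 \<subseteq> G" "finite R2"
    using h R(2) unfolding R1_def R2_def by blast+
  have dom: "Domain R1 = Domain R" "Range R1 = Domain R2" "Range R2 = Range R"
    unfolding R1_def R2_def Domain_fst Range_snd by (simp_all add: image_image)
  note f = ciso_cl[OF F R12(1,2)] and g = ciso_cl[OF G R12(3,4)]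
  show "(F O G) `` cl S (Domain R) = cl U (Range R)"
    using f(1) g(1) by (simp only: relcomp_Image dom)
  show "(F O G)\<inverse> `` cl U (Range R) = cl S (Domain R)"
    using f(2) g(2) by (simp only: relcomp_Image converse_relcomp dom)
qed

lemma ciso_cl_Domain:
  assumes "ciso L S T F" "pregeometry (univ S) (cl S)"
  shows "cl S (Domain F) = Domain F"
proof -
  interpret S: pregeom "univ S" "cl S" by unfold_locales (rule assms(2))
  have sub: "Domain F \<subseteq> univ S" using ciso_subset[OF assms(1)] by auto
  have "x \<in> Domain F" if x: "x \<in> cl S (Domain F)" for x
  proof -
    obtain A where A: "finite A" "A \<subseteq> Domain F" "x \<in> cl S A" using S.cl_finite[OF sub x] .
    obtain R where R: "R \<subseteq> F" "finite R" "Domain R = A" using finite_subset_Domain[OF A(1,2)] .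
    have "x \<in> F\<inverse> `` cl T (Range R)" using ciso_cl(2)[OF assms(1) R(1,2)] A(3) R(3) by simp
    then show ?thesis by auto
  qed
  then show ?thesis using S.cl_extensive[OF sub] by blast
qed

lemma ciso_cl_Range:
  assumes "ciso L S T F" "pregeometry (univ T) (cl T)"
  shows "cl T (Range F) = Range F"
  using ciso_cl_Domain[OF ciso_converse[OF assms(1)] assms(2)] by simp

lemma finite_subset_incseq_UN:
  fixes Fs :: "nat \<Rightarrow> 'a set"
  assumes "finite R" "R \<subseteq> (\<Union>n. Fs n)" "\<And>n. Fs n \<subseteq> Fs (Suc n)"
  obtains n where "R \<subseteq> Fs n"
proof -
  have mono: "Fs m \<subseteq> Fs n" if "m \<le> n" for m n
    using assms(3) that by (rule lift_Suc_mono_le)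
  have "\<exists>n. R \<subseteq> Fs n" using assms(1,2)
  proof (induction R)
    case (insert x R)
    then obtain n m where "R \<subseteq> Fs n" "x \<in> Fs m" by auto
    then have "insert x R \<subseteq> Fs (max m n)" using mono[of n "max m n"] mono[of m "max m n"] by auto
    then show ?case by blast
  qed simp
  then show thesis using that by metis
qed

lemma piso_UN:
  fixes Fs :: "nat \<Rightarrow> ('a \<times> 'b) set"
  assumes "\<And>n. piso L S T (Fs n)" "\<And>n. Fs n \<subseteq> Fs (Suc n)"
  shows "piso L S T (\<Union>n. Fs n)"
proof (rule piso_finite_character)
  fix R assume R: "finite R" "R \<subseteq> (\<Union>n. Fs n)"
  obtain n where "R \<subseteq> Fs n" using finite_subset_incseq_UN[OF R assms(2)] .
  then show "piso L S T R" by (rule piso_mono[OF assms(1)])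
qed

lemma ciso_UN:
  fixes Fs :: "nat \<Rightarrow> ('a \<times> 'a) set"
  assumes "\<And>n. ciso L S T (Fs n)" "\<And>n. Fs n \<subseteq> Fs (Suc n)"
  shows "ciso L S T (\<Union>n. Fs n)"
  unfolding ciso_def
proof (intro conjI allI impI)
  show "piso L S T (\<Union>n. Fs n)" by (rule piso_UN) (rule ciso_piso[OF assms(1)], rule assms(2))
  show "(\<Union>n. Fs n) \<subseteq> univ S \<times> univ T" using ciso_subset[OF assms(1)] by blast
  fix R assume R: "R \<subseteq> (\<Union>n. Fs n)" "finite R"
  obtain n where n: "R \<subseteq> Fs n" using finite_subset_incseq_UN[OF R(2,1) assms(2)] .
  have mono: "Fs n \<subseteq> Fs m" if "n \<le> m" for m using assms(2) that by (rule lift_Suc_mono_le)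
  have eq: "(\<Union>k. Fs k) `` A = (\<Union>k\<in>{n..}. Fs k `` A)" "(\<Union>k. Fs k)\<inverse> `` A = (\<Union>k\<in>{n..}. (Fs k)\<inverse> `` A)" for A
  proof -
    have "(\<Union>k. Fs k) = (\<Union>k\<in>{n..}. Fs k)"
    proof (intro equalityI UN_least)
      fix k
      have "Fs k \<subseteq> Fs (max n k)" using assms(2) by (rule lift_Suc_mono_le) simp
      then show "Fs k \<subseteq> (\<Union>k\<in>{n..}. Fs k)" by (rule order_trans) (rule UN_upper, simp)
    qed blast
    then show "(\<Union>k. Fs k) `` A = (\<Union>k\<in>{n..}. Fs k `` A)" "(\<Union>k. Fs k)\<inverse> `` A = (\<Union>k\<in>{n..}. (Fs k)\<inverse> `` A)"
      by auto
  qed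
  have k: "Fs k `` cl S (Domain R) = cl T (Range R) \<and> (Fs k)\<inverse> `` cl T (Range R) = cl S (Domain R)"
    if "k \<in> {n..}" for k
    using ciso_cl[OF assms(1)[of k] _ R(2)] n mono[of k] that by simp
  show "(\<Union>n. Fs n) `` cl S (Domain R) = cl T (Range R)"
    unfolding eq using k by simp
  show "(\<Union>n. Fs n)\<inverse> `` cl T (Range R) = cl S (Domain R)"
    unfolding eq using k by simp
qed

lemma piso_countable:
  assumes "piso L S T F" "countable (Domain F) \<or> countable (Range F)"
  shows "countable F"
proof -
  have "inj_on fst F" "inj_on snd F"
    using piso_eq_iff[OF assms(1)] by (auto simp: inj_on_def)
  then show ?thesis
    using assms(2) unfolding Domain_fst Range_snd by (auto simp: countable_image_inj_eq)
qed

lemma ciso_Id_on: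
  assumes "pregeometry (univ S) (cl S)" "A \<subseteq> univ S" "cl S A = A"
  shows "ciso L S S (Id_on A)"
  unfolding ciso_def
proof (intro conjI allI impI)
  interpret S: pregeom "univ S" "cl S" by unfold_locales (rule assms(1))
  show "piso L S S (Id_on A)"
    by (rule qftp_piso[of L S A "\<lambda>x. x" S "\<lambda>x. x"]) auto
  show "Id_on A \<subseteq> univ S \<times> univ S" using assms(2) by auto
  fix R assume R: "R \<subseteq> Id_on A" "finite R"
  then have "Domain R = Range R" "Domain R \<subseteq> A" by auto
  moreover have "cl S (Domain R) \<subseteq> A"
    using S.cl_mono[OF \<open>Domain R \<subseteq> A\<close> assms(2)] assms(3) by simp
  ultimately show "Id_on A `` cl S (Domain R) = cl S (Range R)"
    "(Id_on A)\<inverse> `` cl S (Range R) = cl S (Domain R)"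
    by auto
qed

lemma ciso_mem_cl:
  assumes F: "ciso L S T F" and pg: "pregeometry (univ S) (cl S)" "pregeometry (univ T) (cl T)"
    and xy: "(x, y) \<in> F" and G: "G \<subseteq> F" and x: "x \<in> cl S (Domain G)"
  shows "y \<in> cl T (Range G)"
proof -
  interpret S: pregeom "univ S" "cl S" by unfold_locales (rule pg(1))
  interpret T: pregeom "univ T" "cl T" by unfold_locales (rule pg(2))
  have sub: "Domain G \<subseteq> univ S" "Range G \<subseteq> univ T" using ciso_subset[OF F] G by auto
  obtain A where A: "finite A" "A \<subseteq> Domain G" "x \<in> cl S A" using S.cl_finite[OF sub(1) x] .
  obtain R where R: "R \<subseteq> G" "finite R" "Domain R = A" using finite_subset_Domain[OF A(1,2)] .
  have "y \<in> cl T (Range R)"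
    using ciso_mem_iff[OF F xy subset_trans[OF R(1) G] R(2)] A(3) R(3) by simp
  then show ?thesis by (rule T.cl_monoD[OF _ Range_mono[OF R(1)] sub(2)])
qed

lemma ciso_mem_cl_converse:
  assumes F: "ciso L S T F" and pg: "pregeometry (univ S) (cl S)" "pregeometry (univ T) (cl T)"
    and xy: "(x, y) \<in> F" and G: "G \<subseteq> F" and y: "y \<in> cl T (Range G)"
  shows "x \<in> cl S (Domain G)"
  using ciso_mem_cl[OF ciso_converse[OF F] pg(2,1), of y x "G\<inverse>"] xy G y by auto

lemma image_swap_eq_converse: "prod.swap ` F = F\<inverse>"
  by force

text \<open>The bookkeeping of a countable back-and-forth. Stage \<open>n\<close> treats the \<open>n\<close>-th element of each side; the
empty sides are exempt because \<open>from_nat_into\<close> is arbitrary there.\<close>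

lemma back_and_forth:
  fixes A :: "'a set" and B :: "'b set" and R0 :: "('a \<times> 'b) set"
  assumes "countable A" "countable B" "good R0"
    and fwd: "\<And>R a. good R \<Longrightarrow> a \<in> A \<Longrightarrow> \<exists>R'. good R' \<and> R \<subseteq> R' \<and> a \<in> Domain R'"
    and bwd: "\<And>R b. good R \<Longrightarrow> b \<in> B \<Longrightarrow> \<exists>R'. good R' \<and> R \<subseteq> R' \<and> b \<in> Range R'"
  obtains Rs :: "nat \<Rightarrow> ('a \<times> 'b) set" where "Rs 0 = R0" "\<And>n. good (Rs n)" "\<And>n. Rs n \<subseteq> Rs (Suc n)"
    "A \<subseteq> Domain (\<Union>n. Rs n)" "B \<subseteq> Range (\<Union>n. Rs n)"
proof -
  define step where "step n R R' \<longleftrightarrow> R \<subseteq> R' \<and> (A \<noteq> {} \<longrightarrow> from_nat_into A n \<in> Domain R') \<and>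
      (B \<noteq> {} \<longrightarrow> from_nat_into B n \<in> Range R')" for n R R'
  have "\<exists>R'. good R' \<and> step n R R'" if "good R" for n R
  proof -
    have "\<exists>R1. good R1 \<and> R \<subseteq> R1 \<and> (A \<noteq> {} \<longrightarrow> from_nat_into A n \<in> Domain R1)"
      using fwd[OF \<open>good R\<close> from_nat_into[of A n]] \<open>good R\<close> by (cases "A = {}") auto
    then obtain R1 where R1: "good R1" "R \<subseteq> R1" "A \<noteq> {} \<Longrightarrow> from_nat_into A n \<in> Domain R1" by blast
    have "\<exists>R2. good R2 \<and> R1 \<subseteq> R2 \<and> (B \<noteq> {} \<longrightarrow> from_nat_into B n \<in> Range R2)"
      using bwd[OF \<open>good R1\<close> from_nat_into[of B n]] \<open>good R1\<close> by (cases "B = {}") auto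
    then obtain R2 where R2: "good R2" "R1 \<subseteq> R2" "B \<noteq> {} \<Longrightarrow> from_nat_into B n \<in> Range R2" by blast
    have "step n R R2" unfolding step_def using R1(2,3) R2(2,3) Domain_mono[OF R2(2)] by auto
    then show ?thesis using R2(1) by blast
  qed
  then have "\<exists>Rs. \<forall>n. (good (Rs n) \<and> (n = 0 \<longrightarrow> Rs n = R0)) \<and> step n (Rs n) (Rs (Suc n))"
    using assms(3) by (intro dependent_nat_choice) auto
  then obtain Rs where *: "\<And>n. (good (Rs n) \<and> (n = 0 \<longrightarrow> Rs n = R0)) \<and> step n (Rs n) (Rs (Suc n))" by blast
  have Rs: "\<And>n. good (Rs n)" "Rs 0 = R0" "\<And>n. step n (Rs n) (Rs (Suc n))" using * by simp_all
  show thesis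
  proof (rule that[of Rs])
    show "Rs 0 = R0" "\<And>n. good (Rs n)" using Rs(1,2) by simp_all
    show "Rs n \<subseteq> Rs (Suc n)" for n using Rs(3)[of n] by (simp add: step_def)
    show "A \<subseteq> Domain (\<Union>n. Rs n)"
    proof
      fix a assume a: "a \<in> A"
      then obtain n where "a = from_nat_into A n" using assms(1) by (metis from_nat_into_surj)
      then have "a \<in> Domain (Rs (Suc n))" using Rs(3)[of n] a by (auto simp: step_def)
      then show "a \<in> Domain (\<Union>n. Rs n)" by blast
    qed
    show "B \<subseteq> Range (\<Union>n. Rs n)"
    proof
      fix b assume b: "b \<in> B"
      then obtain n where "b = from_nat_into B n" using assms(2) by (metis from_nat_into_surj)
      then have "b \<in> Range (Rs (Suc n))" using Rs(3)[of n] b by (auto simp: step_def)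
      then show "b \<in> Range (\<Union>n. Rs n)" by blast
    qed
  qed
qed

text \<open>The weakly quasiminimal pregeometry structures.\<close>

locale weak_qm = pregeom "univ W" "cl W" for L :: "('f, 'r) lang" and W :: "('a, 'f, 'r) pstr" +
  assumes qm1: "QM1 L W" and qm3: "QM3 W" and qm4: "QM4 L W" and qm5: "QM5 L W"
begin

lemma cl_countable:
  assumes "countable A" "A \<subseteq> univ W" shows "countable (cl W A)"
proof (rule countable_subset)
  show "cl W A \<subseteq> (\<Union>F\<in>{F. finite F \<and> F \<subseteq> A}. cl W F)"
  proof
    fix x assume "x \<in> cl W A"
    then obtain F where "finite F" "F \<subseteq> A" "x \<in> cl W F" using cl_finite[OF assms(2)] by metis
    then show "x \<in> (\<Union>F\<in>{F. finite F \<and> F \<subseteq> A}. cl W F)" by (intro UN_I[of F]) simp_all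
  qed
  show "countable (\<Union>F\<in>{F. finite F \<and> F \<subseteq> A}. cl W F)"
  proof (rule countable_UN[OF countable_Collect_finite_subset[OF assms(1)]])
    fix F assume "F \<in> {F. finite F \<and> F \<subseteq> A}"
    then have "finite F" "F \<subseteq> univ W" using assms(2) by auto
    then show "countable (cl W F)" using qm3 by (simp add: QM3_def)
  qed
qed

text \<open>By QM1 the quantifier-free type of a finite tuple decides which entries lie in the closure of the
others, so relations preserving these types preserve closure.\<close>

lemma piso_cl_iff:
  assumes "piso L W W K" "K \<subseteq> univ W \<times> univ W" "(x, y) \<in> K" "R \<subseteq> K" "finite R"
  shows "x \<in> cl W (Domain R) \<longleftrightarrow> y \<in> cl W (Range R)"
proof -
  obtain rs where rs: "set rs = R" using finite_list[OF assms(5)] by blast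
  have "tp_list L W (x # map fst rs) = tp_list L W (y # map snd rs)"
    unfolding tp_list_def length_Cons length_map
  proof (rule piso_qftp[OF assms(1)])
    fix i assume "i \<in> {..<Suc (length rs)}"
    then show "((x # map fst rs) ! i, (y # map snd rs) ! i) \<in> K"
      using assms(3,4) rs by (cases i) auto
  qed
  moreover have "x \<in> univ W" "y \<in> univ W" "set (map fst rs) \<subseteq> univ W" "set (map snd rs) \<subseteq> univ W"
    using assms(2-4) rs by auto
  moreover have "set (map fst rs) = Domain R" "set (map snd rs) = Range R"
    by (simp_all add: rs Domain_fst Range_snd)
  ultimately show ?thesis using qm1 unfolding QM1_def by metis
qed

lemma closed_piso_ciso:
  assumes "piso L W W K" "K \<subseteq> univ W \<times> univ W"
    and "cl W (Domain K) = Domain K" "cl W (Range K) = Range K"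
  shows "ciso L W W K"
  unfolding ciso_def
proof (intro conjI allI impI assms(1,2))
  fix R assume R: "R \<subseteq> K" "finite R"
  have D: "Domain K \<subseteq> univ W" "Range K \<subseteq> univ W" using assms(2) by auto
  note iff = piso_cl_iff[OF assms(1,2) _ R]
  have 1: "cl W (Domain R) \<subseteq> Domain K" using cl_mono[OF Domain_mono[OF R(1)] D(1)] assms(3) by simp
  have 2: "cl W (Range R) \<subseteq> Range K" using cl_mono[OF Range_mono[OF R(1)] D(2)] assms(4) by simp
  show "K `` cl W (Domain R) = cl W (Range R)" using iff 2 by blast
  show "K\<inverse> `` cl W (Range R) = cl W (Domain R)" using iff 1 by blast
qed

text \<open>QM4 for relations. A countable relation is enumerated by a set of natural numbers, which turns its
two projections into enumerations of closed sets.\<close>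

lemma qm4_piso:
  assumes "ciso L W W F" "countable F" "b \<in> univ W" "b \<notin> Domain F" "b' \<in> univ W" "b' \<notin> Range F"
  shows "piso L W W (insert (b, b') F)"
proof -
  obtain f :: "'a \<times> 'a \<Rightarrow> nat" where f: "inj_on f F" using assms(2) by (rule countableE)
  define e where "e = inv_into F f"
  have e: "e ` f ` F = F" unfolding e_def using f by (simp add: inv_into_image_cancel)
  have dom: "(fst \<circ> e) ` f ` F = Domain F" "(snd \<circ> e) ` f ` F = Range F"
    unfolding image_comp[symmetric] e Domain_fst Range_snd by simp_all
  have closed: "closed_in W (Domain F)" "closed_in W (Range F)"
    using ciso_cl_Domain[OF assms(1) pg] ciso_cl_Range[OF assms(1) pg] ciso_subset[OF assms(1)]
    unfolding closed_in_def by auto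
  have "qftp L W (f ` F) (fst \<circ> e) = qftp L W (f ` F) (snd \<circ> e)"
    using e by (intro piso_qftp[OF ciso_piso[OF assms(1)]]) auto
  moreover have "b \<in> univ W - Domain F" "b' \<in> univ W - Range F" using assms by auto
  ultimately have "tp_app L W (f ` F) (fst \<circ> e) [b] = tp_app L W (f ` F) (snd \<circ> e) [b']"
    using qm4 closed unfolding QM4_def dom[symmetric] by meson
  then have "qftp L W (f ` F <+> {..<1}) (case_sum (fst \<circ> e) (nth [b])) =
      qftp L W (f ` F <+> {..<1}) (case_sum (snd \<circ> e) (nth [b']))"
    unfolding tp_app_def by simp
  then show ?thesis
  proof (rule qftp_piso)
    let ?h = "\<lambda>i. (case_sum (fst \<circ> e) (nth [b]) i, case_sum (snd \<circ> e) (nth [b']) i)"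
    let ?I = "f ` F <+> {..<1}"
    have "(b, b') = ?h (Inr 0)" by simp
    then have "(b, b') \<in> ?h ` ?I" by (rule image_eqI) (simp add: InrI)
    moreover have "p \<in> ?h ` ?I" if "p \<in> F" for p
    proof (rule image_eqI)
      show "p = ?h (Inl (f p))" using that f by (simp add: e_def)
    qed (use that in \<open>simp add: InlI\<close>)
    ultimately show "insert (b, b') F \<subseteq> ?h ` ?I" by blast
  qed
qed

lemma qm5_piso:
  assumes "ciso L W W F" "countable F" "piso L W W (F \<union> G)" "finite G" "G \<subseteq> univ W \<times> univ W"
    and y: "y \<in> cl W (Domain F \<union> Domain G)"
  shows "\<exists>y' \<in> univ W. piso L W W (insert (y, y') (F \<union> G))"
proof -
  obtain f :: "'a \<times> 'a \<Rightarrow> nat" where f: "inj_on f F" using assms(2) by (rule countableE)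
  define e where "e = inv_into F f"
  have e: "e ` f ` F = F" unfolding e_def using f by (simp add: inv_into_image_cancel)
  have dom: "(fst \<circ> e) ` f ` F = Domain F" "(snd \<circ> e) ` f ` F = Range F"
    unfolding image_comp[symmetric] e Domain_fst Range_snd by simp_all
  have closed: "closed_in W (Domain F)" "closed_in W (Range F)"
    using ciso_cl_Domain[OF assms(1) pg] ciso_cl_Range[OF assms(1) pg] ciso_subset[OF assms(1)]
    unfolding closed_in_def by auto
  obtain gs where gs: "set gs = G" using finite_list[OF assms(4)] by blast
  have G: "set (map fst gs) \<subseteq> univ W" "set (map snd gs) \<subseteq> univ W" using gs assms(5) by auto
  have eq: "qftp L W (f ` F) (fst \<circ> e) = qftp L W (f ` F) (snd \<circ> e)"
    using e by (intro piso_qftp[OF ciso_piso[OF assms(1)]]) auto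
  have "tp_app L W (f ` F) (fst \<circ> e) (map fst gs) = tp_app L W (f ` F) (snd \<circ> e) (map snd gs)"
    unfolding tp_app_def length_map
  proof (rule piso_qftp[OF assms(3)])
    fix i assume "i \<in> f ` F <+> {..<length gs}"
    then show "(case_sum (fst \<circ> e) ((!) (map fst gs)) i, case_sum (snd \<circ> e) ((!) (map snd gs)) i) \<in> F \<union> G"
      using e gs by (auto simp: Plus_def)
  qed
  note tp = this
  have "y \<in> cl W ((fst \<circ> e) ` f ` F \<union> set (map fst gs))"
    using y unfolding dom by (simp add: gs Domain_fst)
  moreover have "closed_in W ((fst \<circ> e) ` f ` F)" "closed_in W ((snd \<circ> e) ` f ` F)"
    using closed unfolding dom by simp_all
  ultimately have "\<exists>y' \<in> univ W. tp_app L W (f ` F) (fst \<circ> e) (map fst gs @ [y]) =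
      tp_app L W (f ` F) (snd \<circ> e) (map snd gs @ [y'])"
    using eq tp G by (intro qm5[unfolded QM5_def, rule_format]) simp_all
  then obtain y' where y': "y' \<in> univ W" "tp_app L W (f ` F) (fst \<circ> e) (map fst gs @ [y]) =
      tp_app L W (f ` F) (snd \<circ> e) (map snd gs @ [y'])"
    by blast
  have "piso L W W (insert (y, y') (F \<union> G))"
  proof (rule qftp_piso[OF y'(2)[unfolded tp_app_def length_append length_map list.size]])
    let ?h = "\<lambda>i. (case_sum (fst \<circ> e) (nth (map fst gs @ [y])) i, case_sum (snd \<circ> e) (nth (map snd gs @ [y'])) i)"
    let ?I = "f ` F <+> {..<length gs + (0 + Suc 0)}"
    have "(y, y') = ?h (Inr (length gs))" by (simp add: nth_append)
    then have "(y, y') \<in> ?h ` ?I" by (rule image_eqI) (simp add: InrI)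
    moreover have "p \<in> ?h ` ?I" if "p \<in> F" for p
    proof (rule image_eqI)
      show "p = ?h (Inl (f p))" using that f by (simp add: e_def)
    qed (use that in \<open>simp add: InlI\<close>)
    moreover have "p \<in> ?h ` ?I" if p: "p \<in> G" for p
    proof -
      obtain i where "i < length gs" "p = gs ! i" using p unfolding gs[symmetric] in_set_conv_nth by metis
      then have "p = ?h (Inr i)" "Inr i \<in> ?I" by (simp_all add: nth_append InrI)
      then show ?thesis by (rule image_eqI)
    qed
    ultimately show "insert (y, y') (F \<union> G) \<subseteq> ?h ` ?I" by blast
  qed
  then show ?thesis using y'(1) by blast
qed

text \<open>One step of the back-and-forth behind the next theorem. The finite relation \<open>G\<close> collects what has
been matched beyond \<open>F\<close>; keeping \<open>(b, b')\<close> in it ensures that the element \<open>y\<close> is algebraic over what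
is already matched, which is what QM5 asks for.\<close>

lemma extend_step:
  assumes F: "ciso L W W F" "countable F" and b: "b \<in> univ W" "b' \<in> univ W"
    and G: "finite G" "piso L W W (F \<union> G)" "(b, b') \<in> G"
      "G \<subseteq> cl W (insert b (Domain F)) \<times> cl W (insert b' (Range F))"
    and y: "y \<in> cl W (insert b (Domain F))"
  obtains y' where "y' \<in> cl W (insert b' (Range F))" "piso L W W (F \<union> insert (y, y') G)"
proof -
  have D: "insert b (Domain F) \<subseteq> univ W" "insert b' (Range F) \<subseteq> univ W"
    using ciso_subset[OF F(1)] b by auto
  have GU: "G \<subseteq> univ W \<times> univ W" using G(4) cl_subset[OF D(1)] cl_subset[OF D(2)] by auto
  have "y \<in> cl W (Domain F \<union> Domain G)"
    by (rule cl_monoD[OF y]) (use G(3) GU D in auto)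
  then obtain y' where y': "y' \<in> univ W" "piso L W W (insert (y, y') (F \<union> G))"
    using qm5_piso[OF F G(2,1) GU] by blast
  obtain A where A: "finite A" "A \<subseteq> insert b (Domain F)" "y \<in> cl W A" using cl_finite[OF D(1) y] .
  then have "A \<subseteq> Domain (insert (b, b') F)" by auto
  then obtain R where R: "R \<subseteq> insert (b, b') F" "finite R" "Domain R = A"
    using finite_subset_Domain A(1) by metis
  have "y' \<in> cl W (Range R)"
  proof (subst piso_cl_iff[OF y'(2), symmetric])
    show "insert (y, y') (F \<union> G) \<subseteq> univ W \<times> univ W"
      using ciso_subset[OF F(1)] GU y'(1) y cl_subset[OF D(1)] by auto
    show "R \<subseteq> insert (y, y') (F \<union> G)" using R(1) G(3) by auto
  qed (use A R in simp_all)
  then have "y' \<in> cl W (insert b' (Range F))"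
    by (rule cl_monoD) (use R D in auto)
  then show thesis using that y'(2) by simp
qed

text \<open>QM4 allows \<open>b\<close> to be sent to \<open>b'\<close>, both being generic over closed sets, and a back-and-forth with QM5
through the two countable closures extends the map to everything generated.\<close>

theorem ciso_extend:
  assumes F: "ciso L W W F" "countable F"
    and b: "b \<in> univ W" "b \<notin> Domain F" "b' \<in> univ W" "b' \<notin> Range F"
  obtains F' where "ciso L W W F'" "countable F'" "insert (b, b') F \<subseteq> F'"
    "Domain F' = cl W (insert b (Domain F))" "Range F' = cl W (insert b' (Range F))"
proof -
  let ?Y = "cl W (insert b (Domain F))" and ?Y' = "cl W (insert b' (Range F))"
  have D: "insert b (Domain F) \<subseteq> univ W" "insert b' (Range F) \<subseteq> univ W"
    using ciso_subset[OF F(1)] b by auto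
  have "countable (Domain F)" "countable (Range F)" using F(2) by (simp_all add: Domain_fst Range_snd)
  then have count: "countable ?Y" "countable ?Y'" using D by (simp_all add: cl_countable)
  define good where "good G \<longleftrightarrow> finite G \<and> piso L W W (F \<union> G) \<and> (b, b') \<in> G \<and> G \<subseteq> ?Y \<times> ?Y'" for G
  have start: "good {(b, b')}"
    using qm4_piso[OF F b] cl_extensive[OF D(1)] cl_extensive[OF D(2)] unfolding good_def by simp
  have fwd: "\<exists>R'. good R' \<and> R \<subseteq> R' \<and> y \<in> Domain R'" if R: "good R" and y: "y \<in> ?Y" for R y
  proof -
    obtain y' where y': "y' \<in> ?Y'" "piso L W W (F \<union> insert (y, y') R)"
      using extend_step[OF F b(1,3) _ _ _ _ y, of R] R unfolding good_def by metis
    then have "good (insert (y, y') R)" using R y unfolding good_def by simp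
    then show ?thesis by (intro exI[of _ "insert (y, y') R"]) auto
  qed
  have bwd: "\<exists>R'. good R' \<and> R \<subseteq> R' \<and> y' \<in> Range R'" if R: "good R" and y': "y' \<in> ?Y'" for R y'
  proof -
    have F': "ciso L W W (F\<inverse>)" "countable (F\<inverse>)"
      using F countable_image[of F prod.swap] by (simp_all add: ciso_converse image_swap_eq_converse)
    have "finite (R\<inverse>)" "(b', b) \<in> R\<inverse>" "R\<inverse> \<subseteq> ?Y' \<times> ?Y" using R unfolding good_def by auto
    moreover have "piso L W W (F\<inverse> \<union> R\<inverse>)"
      using R piso_converse[of L W W "F \<union> R"] unfolding good_def by (simp add: converse_Un)
    ultimately obtain y where y: "y \<in> ?Y" "piso L W W (F\<inverse> \<union> insert (y', y) (R\<inverse>))"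
      using extend_step[OF F' b(3,1), of "R\<inverse>" y'] y' by auto
    have "F \<union> insert (y, y') R = (F\<inverse> \<union> insert (y', y) (R\<inverse>))\<inverse>" by auto
    then have "piso L W W (F \<union> insert (y, y') R)" using piso_converse[OF y(2)] by simp
    then have "good (insert (y, y') R)" using R y(1) y' unfolding good_def by simp
    then show ?thesis by (intro exI[of _ "insert (y, y') R"]) auto
  qed
  obtain Rs where Rs: "Rs 0 = {(b, b')}" "\<And>n. good (Rs n)" "\<And>n. Rs n \<subseteq> Rs (Suc n)"
    "?Y \<subseteq> Domain (\<Union>n. Rs n)" "?Y' \<subseteq> Range (\<Union>n. Rs n)"
    using back_and_forth[of ?Y ?Y' good, OF count start fwd bwd] by metis
  define F' where "F' = (\<Union>n. F \<union> Rs n)"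
  have Fsub: "F \<subseteq> ?Y \<times> ?Y'"
    using cl_extensive[OF D(1)] cl_extensive[OF D(2)] by auto
  have F'sub: "F' \<subseteq> ?Y \<times> ?Y'" using Fsub Rs(2) unfolding F'_def good_def by blast
  have dom: "Domain F' = ?Y"
  proof
    show "?Y \<subseteq> Domain F'" using Rs(4) unfolding F'_def by blast
  qed (use F'sub in auto)
  have ran: "Range F' = ?Y'"
  proof
    show "?Y' \<subseteq> Range F'" using Rs(5) unfolding F'_def by blast
  qed (use F'sub in auto)
  have piso: "piso L W W F'"
    unfolding F'_def
  proof (rule piso_UN)
    show "piso L W W (F \<union> Rs n)" for n using Rs(2) unfolding good_def by simp
    show "F \<union> Rs n \<subseteq> F \<union> Rs (Suc n)" for n using Rs(3)[of n] by auto
  qed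
  have "ciso L W W F'"
  proof (rule closed_piso_ciso[OF piso])
    show "F' \<subseteq> univ W \<times> univ W" using F'sub cl_subset[OF D(1)] cl_subset[OF D(2)] by auto
    show "cl W (Domain F') = Domain F'" "cl W (Range F') = Range F'"
      unfolding dom ran using D by (simp_all add: cl_idem)
  qed
  moreover have "countable F'" using F'sub count by (meson countable_SIGMA countable_subset)
  moreover have "insert (b, b') F \<subseteq> F'" using Rs(1) unfolding F'_def by blast
  ultimately show thesis using that dom ran by blast
qed

end

section \<open>The members of a quasiminimal class\<close>

locale qm = weak_qm L W for L :: "('f, 'r) lang" and W :: "('a, 'f, 'r) pstr" +
  assumes qm2: "QM2 W" and str: "is_str L W"
begin

lemma not_in_cl_finite:
  assumes "finite G" "G \<subseteq> univ W"
  obtains b where "b \<in> univ W" "b \<notin> cl W G"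
proof (rule ccontr)
  assume "\<not> thesis"
  then have U: "univ W \<subseteq> cl W G" using that by auto
  have loc: "localize (cl W) {} = cl W" by (simp add: localize_def fun_eq_iff)
  obtain X where X: "pg_basis (localize (cl W) {}) (univ W) X" "dim_over (cl W) (univ W) {} = |X|"
    using pg_dim_basis[of "univ W" "{}"] by auto
  have "finite X"
    by (rule finite_pg_indep[of "{}" X G]) (use X U assms in \<open>auto simp: pg_basis_def\<close>)
  then have "|X| <o natLeq" by (simp add: finite_iff_ordLess_natLeq)
  moreover have "natLeq \<le>o |X|" using qm2 X(2) by (simp add: QM2_def dim_over_def loc)
  ultimately show False using not_ordLess_ordLeq by blast
qed

text \<open>Closed sets are substructures. A value \<open>y\<close> outside the closure \<open>A\<close> of its arguments would by QM4 have
the same type over \<open>A\<close> as every other element outside \<open>A\<close>, so each of these would be that same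
value; but by infinite dimension there is an element outside \<open>A\<close> different from \<open>y\<close>.\<close>

lemma fint_in_cl:
  assumes f: "f \<in> fsyms L" "length xs = farity L f" and xs: "set xs \<subseteq> univ W"
  shows "fint W f xs \<in> cl W (set xs)"
proof (rule ccontr)
  let ?A = "cl W (set xs)" and ?y = "fint W f xs"
  assume n: "?y \<notin> ?A"
  have y: "?y \<in> univ W" using str f xs by (simp add: is_str_def)
  have A: "?A \<subseteq> univ W" "cl W ?A = ?A" using cl_subset[OF xs] cl_idem[OF xs] .
  obtain z where z: "z \<in> univ W" "z \<notin> cl W (insert ?y (set xs))"
    using not_in_cl_finite[of "insert ?y (set xs)"] xs y by auto
  have sub: "insert ?y (set xs) \<subseteq> univ W" using xs y by simp
  have zy: "z \<noteq> ?y" using z cl_extensiveD[OF _ sub, of ?y] by auto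
  have zA: "z \<notin> ?A" using z cl_monoD[OF _ _ sub, of z "set xs"] by auto
  have "countable (Id_on ?A)"
    using cl_countable[OF _ xs] by (simp add: Id_on_def countable_finite)
  then have "piso L W W (insert (?y, z) (Id_on ?A))"
    using ciso_Id_on[OF pg A] y n z zA by (intro qm4_piso) auto
  moreover have "list_all2 (\<lambda>x x'. (x, x') \<in> insert (?y, z) (Id_on ?A)) xs xs"
    using cl_extensive[OF xs] nth_mem by (fastforce simp: list_all2_conv_all_nth)
  ultimately have "?y = fint W f xs \<longleftrightarrow> z = fint W f xs"
    by (rule piso_fint_iff[OF _ f]) simp
  then show False using zy by simp
qed

end

lemma qm_structure_qm: "qm_structure L S \<Longrightarrow> qm L S"
  unfolding qm_structure_def by unfold_locales auto

text \<open>The invariant of the generation of the class from \<open>T\<close>: closure is finitary, and every finite subset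
lies in a closed set isomorphic to a closed subset of \<open>T\<close>. Unlike the axioms QM4 and QM5, which
speak of countable closed sets, this passes directly to unions of chains: a finite set,
but not always a countable one, is contained in a member of the chain.\<close>

definition locally_in :: "('f, 'r) lang \<Rightarrow> ('a, 'f, 'r) pstr \<Rightarrow> ('a, 'f, 'r) pstr \<Rightarrow> bool" where
  "locally_in L T S \<longleftrightarrow> is_pstr L S \<and>
     (\<forall>A \<subseteq> univ S. cl S A = \<Union> (cl S ` {F. finite F \<and> F \<subseteq> A})) \<and>
     (\<forall>F \<subseteq> univ S. finite F \<longrightarrow> (\<exists>R. ciso L S T R \<and> F \<subseteq> Domain R))"

lemma locally_inD:
  assumes "locally_in L T S"
  shows "is_pstr L S" "\<And>A. A \<subseteq> univ S \<Longrightarrow> cl S A = \<Union> (cl S ` {F. finite F \<and> F \<subseteq> A})"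
    "\<And>F. F \<subseteq> univ S \<Longrightarrow> finite F \<Longrightarrow> \<exists>R. ciso L S T R \<and> F \<subseteq> Domain R"
  using assms unfolding locally_in_def by blast+

lemma closed_embedding_ciso:
  assumes "closed_embedding L S T \<theta>"
  shows "ciso L S T ((\<lambda>x. (x, \<theta> x)) ` univ S)"
  unfolding ciso_def
proof (intro conjI allI impI)
  let ?K = "(\<lambda>x. (x, \<theta> x)) ` univ S"
  have emb: "is_pstr L S" "\<theta> ` univ S \<subseteq> univ T" "inj_on \<theta> (univ S)"
    "\<And>A. A \<subseteq> univ S \<Longrightarrow> \<theta> ` cl S A = cl T (\<theta> ` A)"
    using assms unfolding closed_embedding_def by simp_all
  show "piso L S T ?K"
    using assms unfolding closed_embedding_def is_pstr_def is_str_def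
    by (intro piso_embedding) simp_all
  show "?K \<subseteq> univ S \<times> univ T" using emb(2) by auto
  fix R assume R: "R \<subseteq> ?K" "finite R"
  then have dom: "Range R = \<theta> ` Domain R" "Domain R \<subseteq> univ S"
    by (auto simp: image_iff)
  have sub: "cl S (Domain R) \<subseteq> univ S" using emb(1) dom(2) by (simp add: is_pstr_def)
  show "?K `` cl S (Domain R) = cl T (Range R)"
    unfolding dom(1) emb(4)[OF dom(2), symmetric] using sub by auto
  show "?K\<inverse> `` cl T (Range R) = cl S (Domain R)"
    unfolding dom(1) emb(4)[OF dom(2), symmetric] using sub inj_on_eq_iff[OF emb(3)] by auto
qed

lemma locally_in_base:
  assumes "qm L T" shows "locally_in L T T"
  unfolding locally_in_def
proof (intro conjI allI impI)
  interpret T: qm L T by (rule assms)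
  show "is_pstr L T" using T.str T.cl_subset by (simp add: is_pstr_def)
  show "cl T A = \<Union> (cl T ` {F. finite F \<and> F \<subseteq> A})" if A: "A \<subseteq> univ T" for A
  proof
    show "cl T A \<subseteq> \<Union> (cl T ` {F. finite F \<and> F \<subseteq> A})"
    proof
      fix x assume "x \<in> cl T A"
      then obtain F where "finite F" "F \<subseteq> A" "x \<in> cl T F" using T.cl_finite[OF A] by metis
      then show "x \<in> \<Union> (cl T ` {F. finite F \<and> F \<subseteq> A})" by (intro UN_I[of F]) simp_all
    qed
    show "\<Union> (cl T ` {F. finite F \<and> F \<subseteq> A}) \<subseteq> cl T A"
      by (intro UN_least T.cl_mono[OF _ A]) simp
  qed
  show "\<exists>R. ciso L T T R \<and> F \<subseteq> Domain R" if "F \<subseteq> univ T" for F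
  proof (intro exI conjI)
    show "ciso L T T (Id_on (univ T))"
      using T.cl_extensive T.cl_subset by (intro ciso_Id_on[OF T.pg]) (simp_all add: subset_antisym)
  qed (use that in auto)
qed

lemma locally_in_iso:
  assumes S: "locally_in L S0 S" and "isomorphic L S T"
  shows "locally_in L S0 T"
  unfolding locally_in_def
proof (intro conjI allI impI)
  obtain \<theta> where \<theta>: "closed_embedding L S T \<theta>" "\<theta> ` univ S = univ T"
    using assms(2) unfolding isomorphic_def by auto
  have cl: "\<And>A. A \<subseteq> univ S \<Longrightarrow> cl T (\<theta> ` A) = \<theta> ` cl S A"
    using \<theta>(1) unfolding closed_embedding_def by simp
  show "is_pstr L T" using \<theta>(1) by (simp add: closed_embedding_def)
  show "cl T A = \<Union> (cl T ` {F. finite F \<and> F \<subseteq> A})" if "A \<subseteq> univ T" for A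
  proof -
    obtain B where B: "B \<subseteq> univ S" "A = \<theta> ` B" using \<open>A \<subseteq> univ T\<close> \<theta>(2) by (metis subset_image_iff)
    have fin: "{F. finite F \<and> F \<subseteq> A} = image \<theta> ` {F. finite F \<and> F \<subseteq> B}"
    proof (intro equalityI subsetI)
      fix F assume "F \<in> {F. finite F \<and> F \<subseteq> A}"
      then obtain C where "C \<subseteq> B" "finite C" "F = \<theta> ` C"
        using finite_subset_image[of F \<theta> B] B(2) by auto
      then show "F \<in> image \<theta> ` {F. finite F \<and> F \<subseteq> B}" by blast
    qed (use B(2) in auto)
    have "cl T A = \<theta> ` \<Union> (cl S ` {F. finite F \<and> F \<subseteq> B})"
      using cl[OF B(1)] locally_inD(2)[OF S B(1)] B(2) by simp
    also have "\<dots> = (\<Union>F\<in>{F. finite F \<and> F \<subseteq> B}. \<theta> ` cl S F)" by (rule image_UN)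
    also have "\<dots> = (\<Union>F\<in>{F. finite F \<and> F \<subseteq> B}. cl T (\<theta> ` F))"
      by (rule SUP_cong) (use cl B(1) in auto)
    finally show ?thesis unfolding fin by simp
  qed
  show "\<exists>R. ciso L T S0 R \<and> F \<subseteq> Domain R" if "F \<subseteq> univ T" "finite F" for F
  proof -
    obtain B where B: "B \<subseteq> univ S" "finite B" "F = \<theta> ` B"
      using \<open>F \<subseteq> univ T\<close> \<open>finite F\<close> \<theta>(2) by (metis finite_subset_image)
    obtain R where R: "ciso L S S0 R" "B \<subseteq> Domain R" using locally_inD(3)[OF S B(1,2)] by blast
    have "ciso L T S0 (((\<lambda>x. (x, \<theta> x)) ` univ S)\<inverse> O R)"
      by (rule ciso_comp[OF ciso_converse[OF closed_embedding_ciso[OF \<theta>(1)]] R(1)])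
    moreover have "F \<subseteq> Domain (((\<lambda>x. (x, \<theta> x)) ` univ S)\<inverse> O R)"
    proof
      fix y assume "y \<in> F"
      then obtain x where x: "x \<in> B" "y = \<theta> x" using B(3) by auto
      then obtain z where "(x, z) \<in> R" using R(2) by auto
      moreover have "(y, x) \<in> ((\<lambda>x. (x, \<theta> x)) ` univ S)\<inverse>" using x B(1) by auto
      ultimately show "y \<in> Domain (((\<lambda>x. (x, \<theta> x)) ` univ S)\<inverse> O R)" by blast
    qed
    ultimately show ?thesis by blast
  qed
qed

lemma closed_sub_ciso:
  assumes "closed_sub L T S" shows "ciso L T S (Id_on (univ T))"
proof -
  have "(\<lambda>x. (x, id x)) ` univ T = Id_on (univ T)" by auto
  then show ?thesis using assms closed_embedding_ciso[of L T S id] by (simp add: closed_sub_def)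
qed

lemma Domain_Id_on_comp: "Domain (Id_on A O R) = A \<inter> Domain R"
  by blast

lemma closed_sub_cl: "closed_sub L T S \<Longrightarrow> A \<subseteq> univ T \<Longrightarrow> cl T A = cl S A"
  by (simp add: closed_sub_def closed_embedding_def)

lemma locally_in_sub:
  assumes S: "locally_in L S0 S" and sub: "closed_sub L T S"
  shows "locally_in L S0 T"
  unfolding locally_in_def
proof (intro conjI allI impI)
  have TS: "univ T \<subseteq> univ S" using sub by (simp add: closed_sub_def)
  show "is_pstr L T" using sub by (simp add: closed_sub_def closed_embedding_def)
  show "cl T A = \<Union> (cl T ` {F. finite F \<and> F \<subseteq> A})" if A: "A \<subseteq> univ T" for A
  proof -
    have "cl T A = \<Union> (cl S ` {F. finite F \<and> F \<subseteq> A})"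
      using closed_sub_cl[OF sub A] locally_inD(2)[OF S subset_trans[OF A TS]] by simp
    also have "\<dots> = \<Union> (cl T ` {F. finite F \<and> F \<subseteq> A})"
      by (rule SUP_cong) (use closed_sub_cl[OF sub] A in auto)
    finally show ?thesis .
  qed
  show "\<exists>R. ciso L T S0 R \<and> F \<subseteq> Domain R" if F: "F \<subseteq> univ T" "finite F" for F
  proof -
    obtain R where R: "ciso L S S0 R" "F \<subseteq> Domain R"
      using locally_inD(3)[OF S subset_trans[OF F(1) TS] F(2)] by blast
    have "F \<subseteq> Domain (Id_on (univ T) O R)" using R(2) F(1) by (simp add: Domain_Id_on_comp)
    then show ?thesis using ciso_comp[OF closed_sub_ciso[OF sub] R(1)] by blast
  qed
qed

lemma chain_union_finite_subset:
  assumes "is_chain_union L K U" "finite F" "F \<subseteq> univ U"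
  obtains S where "S \<in> K" "F \<subseteq> univ S"
proof -
  have K: "K \<noteq> {}" "univ U = (\<Union>S\<in>K. univ S)" using assms(1) by (simp_all add: is_chain_union_def)
  have cmp: "univ S \<subseteq> univ T \<or> univ T \<subseteq> univ S" if "S \<in> K" "T \<in> K" for S T
    using assms(1) that unfolding is_chain_union_def closed_sub_def by metis
  have "\<exists>S\<in>K. F \<subseteq> univ S" using assms(2,3)
  proof (induction F)
    case empty
    then show ?case using K(1) by auto
  next
    case (insert x F)
    then obtain S T where ST: "S \<in> K" "F \<subseteq> univ S" "T \<in> K" "x \<in> univ T" using K(2) by auto
    from cmp[OF ST(1,3)] show ?case
    proof
      assume "univ S \<subseteq> univ T"
      then show ?thesis using ST by (intro bexI[of _ T]) auto
    next
      assume "univ T \<subseteq> univ S"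
      then show ?thesis using ST by (intro bexI[of _ S]) auto
    qed
  qed
  then show thesis using that by metis
qed

lemma locally_in_chain:
  assumes K: "\<And>S. S \<in> K \<Longrightarrow> locally_in L S0 S" and U: "is_chain_union L K U"
  shows "locally_in L S0 U"
  unfolding locally_in_def
proof (intro conjI allI impI)
  have sub: "\<And>S. S \<in> K \<Longrightarrow> closed_sub L S U" and ne: "K \<noteq> {}"
    and cl: "\<And>A. A \<subseteq> univ U \<Longrightarrow> cl U A = \<Union> {cl S F | S F. S \<in> K \<and> finite F \<and> F \<subseteq> A \<inter> univ S}"
    using U unfolding is_chain_union_def by simp_all
  show "is_pstr L U" using sub ne by (auto simp: closed_sub_def closed_embedding_def)
  show "cl U A = \<Union> (cl U ` {F. finite F \<and> F \<subseteq> A})" if A: "A \<subseteq> univ U" for A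
  proof (intro equalityI subsetI)
    fix x assume "x \<in> cl U A"
    then obtain S F where F: "S \<in> K" "finite F" "F \<subseteq> A \<inter> univ S" "x \<in> cl S F"
      unfolding cl[OF A] by blast
    have "x \<in> cl U F" using closed_sub_cl[OF sub[OF F(1)], of F] F(3,4) by simp
    then show "x \<in> \<Union> (cl U ` {F. finite F \<and> F \<subseteq> A})" using F by (intro UN_I[of F]) simp_all
  next
    fix x assume "x \<in> \<Union> (cl U ` {F. finite F \<and> F \<subseteq> A})"
    then obtain F where F: "finite F" "F \<subseteq> A" "x \<in> cl U F" by blast
    obtain S where S: "S \<in> K" "F \<subseteq> univ S"
      using chain_union_finite_subset[OF U F(1)] F(2) A by auto
    have "x \<in> cl S F" using closed_sub_cl[OF sub[OF S(1)] S(2)] F(3) by simp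
    then show "x \<in> cl U A" unfolding cl[OF A] using S F(1,2) by blast
  qed
  show "\<exists>R. ciso L U S0 R \<and> F \<subseteq> Domain R" if F: "F \<subseteq> univ U" "finite F" for F
  proof -
    obtain S where S: "S \<in> K" "F \<subseteq> univ S" using chain_union_finite_subset[OF U F(2,1)] .
    obtain R where R: "ciso L S S0 R" "F \<subseteq> Domain R"
      using locally_inD(3)[OF K[OF S(1)] S(2) F(2)] by blast
    have "ciso L U S (Id_on (univ S))"
      using ciso_converse[OF closed_sub_ciso[OF sub[OF S(1)]]] by simp
    then have "ciso L U S0 (Id_on (univ S) O R)" using R(1) by (rule ciso_comp)
    moreover have "F \<subseteq> Domain (Id_on (univ S) O R)" using R(2) S(2) by (simp add: Domain_Id_on_comp)
    ultimately show ?thesis by blast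
  qed
qed

lemma generated_class_locally_in:
  assumes "qm L S0" "S \<in> generated_class L S0"
  shows "locally_in L S0 S"
  using assms(2)
proof induction
  case base
  show ?case by (rule locally_in_base[OF assms(1)])
next
  case (iso S T)
  then show ?case using locally_in_iso by blast
next
  case (sub S T)
  then show ?case using locally_in_sub by blast
next
  case (chain K U)
  then show ?case using locally_in_chain by blast
qed

locale class_member = qm L T for L :: "('f, 'r) lang" and T :: "('a, 'f, 'r) pstr" +
  fixes S :: "('a, 'f, 'r) pstr"
  assumes local: "locally_in L T S"
begin

lemma member_cl_subset: "A \<subseteq> univ S \<Longrightarrow> cl S A \<subseteq> univ S"
  using locally_inD(1)[OF local] by (simp add: is_pstr_def)

lemma member_cl_mono:
  assumes "A \<subseteq> B" "B \<subseteq> univ S" shows "cl S A \<subseteq> cl S B"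
  unfolding locally_inD(2)[OF local assms(2)] locally_inD(2)[OF local subset_trans[OF assms]]
  by (rule UN_mono) (use assms(1) in auto)

lemma member_cl_finite:
  assumes "A \<subseteq> univ S" "x \<in> cl S A"
  obtains F where "finite F" "F \<subseteq> A" "x \<in> cl S F"
proof -
  have "x \<in> \<Union> (cl S ` {F. finite F \<and> F \<subseteq> A})" using assms locally_inD(2)[OF local assms(1)] by simp
  then show thesis using that by auto
qed

lemma member_cl_extensive:
  assumes "A \<subseteq> univ S" shows "A \<subseteq> cl S A"
proof
  fix x assume x: "x \<in> A"
  then obtain R where R: "ciso L S T R" "{x} \<subseteq> Domain R"
    using locally_inD(3)[OF local, of "{x}"] assms by auto
  then obtain y where y: "(x, y) \<in> R" by auto
  have "y \<in> univ T" using y ciso_subset[OF R(1)] by auto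
  then have "y \<in> cl T (Range {(x, y)})" using cl_extensive[of "{y}"] by simp
  then have "x \<in> cl S {x}" using ciso_mem_iff[OF R(1) y, of "{(x, y)}"] y by simp
  then show "x \<in> cl S A" using member_cl_mono[of "{x}" A] x assms by auto
qed

text \<open>Each axiom of pregeometries concerns finitely many elements once closure is finitary, hence can be
verified in the generating structure after transport along a closed partial isomorphism.\<close>

lemma member_cl_transitive_finite:
  assumes F: "finite F" "F \<subseteq> univ S" and G: "finite G" "G \<subseteq> cl S F" and x: "x \<in> cl S G"
  shows "x \<in> cl S F"
proof -
  have GU: "G \<subseteq> univ S" using G(2) member_cl_subset[OF F(2)] by (rule subset_trans)
  have xU: "x \<in> univ S" using x member_cl_subset[OF GU] by (rule subsetD[rotated])
  obtain R where R: "ciso L S T R" "insert x (F \<union> G) \<subseteq> Domain R"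
    using locally_inD(3)[OF local, of "insert x (F \<union> G)"] F G(1) GU xU by auto
  obtain RF where RF: "RF \<subseteq> R" "finite RF" "Domain RF = F"
    using finite_subset_Domain[OF F(1), of R] R(2) by auto
  obtain RG where RG: "RG \<subseteq> R" "finite RG" "Domain RG = G"
    using finite_subset_Domain[OF G(1), of R] R(2) by auto
  obtain y where y: "(x, y) \<in> R" using R(2) by auto
  have RFU: "Range RF \<subseteq> univ T" using RF(1) ciso_subset[OF R(1)] by auto
  have "Range RG \<subseteq> cl T (Range RF)"
  proof
    fix v assume "v \<in> Range RG"
    then obtain u where u: "(u, v) \<in> RG" by auto
    have "(u, v) \<in> R" using u RG(1) by auto
    moreover have "u \<in> cl S (Domain RF)" using u RG(3) G(2) RF(3) by auto
    ultimately show "v \<in> cl T (Range RF)" using ciso_mem_iff[OF R(1) _ RF(1,2)] by simp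
  qed
  moreover have "y \<in> cl T (Range RG)"
    using ciso_mem_iff[OF R(1) y RG(1,2)] x RG(3) by simp
  ultimately have "y \<in> cl T (Range RF)" using cl_minimalD[OF _ _ RFU] by simp
  then show ?thesis using ciso_mem_iff[OF R(1) y RF(1,2)] RF(3) by simp
qed

lemma member_cl_idem:
  assumes A: "A \<subseteq> univ S" shows "cl S (cl S A) = cl S A"
proof
  show "cl S A \<subseteq> cl S (cl S A)" by (rule member_cl_extensive[OF member_cl_subset[OF A]])
  show "cl S (cl S A) \<subseteq> cl S A"
  proof
    fix x assume "x \<in> cl S (cl S A)"
    then obtain G where G: "finite G" "G \<subseteq> cl S A" "x \<in> cl S G"
      by (rule member_cl_finite[OF member_cl_subset[OF A]])
    have "\<exists>F. finite F \<and> F \<subseteq> A \<and> G \<subseteq> cl S F" using G(1,2)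
    proof (induction G)
      case empty
      show ?case by (intro exI[of _ "{}"]) simp
    next
      case (insert g G)
      then obtain F where F: "finite F" "F \<subseteq> A" "G \<subseteq> cl S F" by auto
      have "g \<in> cl S A" using insert.prems by simp
      then obtain F' where F': "finite F'" "F' \<subseteq> A" "g \<in> cl S F'" by (rule member_cl_finite[OF A])
      have "F \<union> F' \<subseteq> univ S" using F F' A by auto
      then have "cl S F \<subseteq> cl S (F \<union> F')" "cl S F' \<subseteq> cl S (F \<union> F')" by (simp_all add: member_cl_mono)
      then show ?case using F F' by (intro exI[of _ "F \<union> F'"]) auto
    qed
    then obtain F where F: "finite F" "F \<subseteq> A" "G \<subseteq> cl S F" by auto
    have "x \<in> cl S F"
      by (rule member_cl_transitive_finite[OF F(1) subset_trans[OF F(2) A] G(1) F(3) G(3)])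
    then show "x \<in> cl S A" using member_cl_mono[OF F(2) A] by (rule subsetD[rotated])
  qed
qed

lemma member_exchange:
  assumes A: "A \<subseteq> univ S" "a \<in> univ S" "b \<in> univ S" "a \<in> cl S (insert b A)" "a \<notin> cl S A"
  shows "b \<in> cl S (insert a A)"
proof -
  obtain G where G: "finite G" "G \<subseteq> insert b A" "a \<in> cl S G"
    using member_cl_finite[of "insert b A" a] A(1,3,4) by auto
  define F where "F = G - {b}"
  have F: "finite F" "F \<subseteq> A" "F \<subseteq> univ S" using G A(1) by (auto simp: F_def)
  have aF: "a \<in> cl S (insert b F)"
    using member_cl_mono[of G "insert b F"] G F(3) A(3) by (auto simp: F_def)
  obtain R where R: "ciso L S T R" "insert a (insert b F) \<subseteq> Domain R"
    using locally_inD(3)[OF local, of "insert a (insert b F)"] F A(2,3) by auto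
  obtain RF where RF: "RF \<subseteq> R" "finite RF" "Domain RF = F"
    using finite_subset_Domain[OF F(1), of R] R(2) by auto
  obtain a' b' where ab: "(a, a') \<in> R" "(b, b') \<in> R" using R(2) by auto
  have U: "Range RF \<subseteq> univ T" "a' \<in> univ T" "b' \<in> univ T"
    using RF(1) ab ciso_subset[OF R(1)] by auto
  have "a \<notin> cl S F" using member_cl_mono[OF F(2) A(1)] A(5) by auto
  then have n: "a' \<notin> cl T (Range RF)"
    using ciso_mem_iff[OF R(1) ab(1) RF(1,2)] RF(3) by simp
  have "a' \<in> cl T (insert b' (Range RF))"
    using ciso_mem_iff[OF R(1) ab(1), of "insert (b, b') RF"] RF ab aF by simp
  then have "b' \<in> cl T (insert a' (Range RF))" using exchange[OF U(1,3) _ n] by simp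
  then have "b \<in> cl S (insert a F)"
    using ciso_mem_iff[OF R(1) ab(2), of "insert (a, a') RF"] RF ab by simp
  then show ?thesis using member_cl_mono[of "insert a F" "insert a A"] F(2) A(1,2) by auto
qed

lemma member_pregeometry: "pregeometry (univ S) (cl S)"
  unfolding pregeometry_def
proof (intro conjI allI impI ballI)
  show "\<exists>F\<subseteq>A. finite F \<and> x \<in> cl S F" if "A \<subseteq> univ S" "x \<in> cl S A" for A x
    by (rule member_cl_finite[OF that]) auto
  show "A \<subseteq> cl S A" "cl S A \<subseteq> univ S" "cl S (cl S A) = cl S A" if "A \<subseteq> univ S" for A
    by (rule member_cl_extensive[OF that], rule member_cl_subset[OF that], rule member_cl_idem[OF that])
  show "cl S A \<subseteq> cl S B" if "A \<subseteq> B \<and> B \<subseteq> univ S" for A B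
    using that by (intro member_cl_mono) simp_all
  show "b \<in> cl S (insert a A)"
    if "A \<subseteq> univ S" "a \<in> univ S" "b \<in> univ S" "a \<in> cl S (insert b A) \<and> a \<notin> cl S A" for A a b
    using member_exchange[OF that(1-3)] that(4) by simp
qed

end

section \<open>Partial isomorphisms of a member of the class\<close>

context class_member
begin

sublocale S: pregeom "univ S" "cl S"
  by unfold_locales (rule member_pregeometry)

text \<open>A chart is a closed partial isomorphism of \<open>S\<close> into \<open>T\<close>. A finitely generated chart \<open>R\<close> is extended
to a new element \<open>a\<close> inside \<open>T\<close>: some chart \<open>\<eta>\<close> contains \<open>a\<close> and the domain of \<open>R\<close> but need not
extend \<open>R\<close>. The images of that domain under \<open>\<eta>\<close> and \<open>R\<close> are isomorphic closed subsets of \<open>T\<close>, and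
correcting \<open>\<eta>\<close> by an extension of this isomorphism gives a chart that does extend \<open>R\<close>. Finite
generation leaves room in \<open>T\<close> for the new image.\<close>

lemma chart_extend:
  assumes R: "ciso L S T R" and Q: "Q \<subseteq> R" "finite Q" "Range R \<subseteq> cl T (Range Q)" and a: "a \<in> univ S"
  obtains R' Q' where "ciso L S T R'" "R \<subseteq> R'" "a \<in> Domain R'"
    "Q' \<subseteq> R'" "finite Q'" "Range R' \<subseteq> cl T (Range Q')"
proof (cases "a \<in> Domain R")
  case True
  then show thesis using that[of R Q] R Q by simp
next
  case False
  have QU: "Domain Q \<subseteq> univ S" "Range Q \<subseteq> univ T"
    using subset_trans[OF Q(1) ciso_subset[OF R]] by auto
  obtain \<eta> where \<eta>: "ciso L S T \<eta>" "insert a (Domain Q) \<subseteq> Domain \<eta>"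
    using locally_inD(3)[OF local, of "insert a (Domain Q)"] QU(1) a finite_Domain[OF Q(2)] by auto
  have "Domain R \<subseteq> cl S (Domain Q)"
    using ciso_cl(2)[OF R Q(1,2)] Q(3) by blast
  also have "\<dots> \<subseteq> Domain \<eta>"
    using S.cl_minimal[of "Domain Q" "Domain \<eta>"] S.cl_extensive[of "Domain \<eta>"]
      ciso_cl_Domain[OF \<eta>(1) S.pg] \<eta>(2) ciso_subset[OF \<eta>(1)] by auto
  finally have R\<eta>: "Domain R \<subseteq> Domain \<eta>" .
  obtain b where b: "(a, b) \<in> \<eta>" using \<eta>(2) by auto
  \<comment> \<open>The comparison of the two charts, a partial isomorphism of \<open>T\<close> with itself.\<close>
  define F where "F = \<eta>\<inverse> O R"
  have F: "ciso L T T F" unfolding F_def using ciso_comp[OF ciso_converse[OF \<eta>(1)] R] .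
  have bF: "b \<notin> Domain F"
  proof
    assume "b \<in> Domain F"
    then obtain x y where x: "(x, b) \<in> \<eta>" "(x, y) \<in> R" unfolding F_def by auto
    have "x = a" using piso_eq_iff[OF ciso_piso[OF \<eta>(1)] x(1) b] by simp
    then show False using False x(2) by auto
  qed
  have FR: "Range F \<subseteq> cl T (Range Q)" using Q(3) unfolding F_def by auto
  have "countable (Range F)"
    using cl_countable[OF countable_finite[OF finite_Range[OF Q(2)]] QU(2)] FR by (rule countable_subset[rotated])
  then have Fc: "countable F" using piso_countable[OF ciso_piso[OF F]] by simp
  obtain b' where b': "b' \<in> univ T" "b' \<notin> cl T (Range Q)"
    using not_in_cl_finite[OF finite_Range[OF Q(2)] QU(2)] .
  have "b \<in> univ T" using b ciso_subset[OF \<eta>(1)] by auto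
  moreover have "b' \<notin> Range F" using b'(2) FR by auto
  ultimately obtain F' where F': "ciso L T T F'" "insert (b, b') F \<subseteq> F'"
    "Range F' = cl T (insert b' (Range F))"
    using ciso_extend[OF F Fc _ bF b'(1)] by metis
  show thesis
  proof (rule that[of "\<eta> O F'" "insert (a, b') Q"])
    show "ciso L S T (\<eta> O F')" using ciso_comp[OF \<eta>(1) F'(1)] .
    show R: "R \<subseteq> \<eta> O F'"
    proof (rule subrelI)
      fix x y assume xy: "(x, y) \<in> R"
      then obtain z where z: "(x, z) \<in> \<eta>" using R\<eta> by auto
      then have "(z, y) \<in> F" using xy unfolding F_def by auto
      then show "(x, y) \<in> \<eta> O F'" using z F'(2) by auto
    qed
    show ab: "a \<in> Domain (\<eta> O F')" using b F'(2) by auto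
    show "insert (a, b') Q \<subseteq> \<eta> O F'" using Q(1) R b F'(2) by auto
    show "finite (insert (a, b') Q)" using Q(2) by simp
    have U': "insert b' (Range Q) \<subseteq> univ T" using b'(1) QU(2) by simp
    have "cl T (Range Q) \<subseteq> cl T (insert b' (Range Q))" by (rule cl_mono[OF _ U']) auto
    then have "insert b' (Range F) \<subseteq> cl T (insert b' (Range Q))"
      using FR cl_extensiveD[OF _ U', of b'] by auto
    then have "cl T (insert b' (Range F)) \<subseteq> cl T (insert b' (Range Q))" by (rule cl_minimal[OF _ U'])
    then show "Range (\<eta> O F') \<subseteq> cl T (Range (insert (a, b') Q))" using F'(3) by auto
  qed
qed

text \<open>Although the invariant mentions finite sets only, charts exist on all countable sets: adding one
element at a time keeps the charts finitely generated, and their union is a chart.\<close>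

theorem countable_chart:
  assumes "countable A" "A \<subseteq> univ S"
  obtains R where "ciso L S T R" "A \<subseteq> Domain R"
proof -
  define good where "good R \<longleftrightarrow> ciso L S T R \<and> (\<exists>Q\<subseteq>R. finite Q \<and> Range R \<subseteq> cl T (Range Q))" for R
  \<comment> \<open>Restricting some chart to the closure of the empty set gives a chart generated by no pairs.\<close>
  obtain R1 where R1: "ciso L S T R1" using locally_inD(3)[OF local, of "{}"] by auto
  have "ciso L S T (R1 O Id_on (cl T {}))"
    using ciso_comp[OF R1 ciso_Id_on[OF pg cl_subset cl_idem]] by simp
  moreover have "Range (R1 O Id_on (cl T {})) \<subseteq> cl T (Range {})" by auto
  ultimately have start: "good (R1 O Id_on (cl T {}))" unfolding good_def by blast
  have fwd: "\<exists>R'. good R' \<and> R \<subseteq> R' \<and> a \<in> Domain R'" if R: "good R" and a: "a \<in> A" for R a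
  proof -
    obtain Q where Q: "ciso L S T R" "Q \<subseteq> R" "finite Q" "Range R \<subseteq> cl T (Range Q)"
      using R unfolding good_def by auto
    have "a \<in> univ S" using a assms(2) by auto
    then obtain R' Q' where "ciso L S T R'" "R \<subseteq> R'" "a \<in> Domain R'"
      "Q' \<subseteq> R'" "finite Q'" "Range R' \<subseteq> cl T (Range Q')"
      by (rule chart_extend[OF Q])
    then show ?thesis unfolding good_def by blast
  qed
  obtain Rs where Rs: "\<And>n. good (Rs n)" "\<And>n. Rs n \<subseteq> Rs (Suc n)" "A \<subseteq> Domain (\<Union>n. Rs n)"
    by (rule back_and_forth[of A "{}" good, OF assms(1) countable_empty start fwd]) auto
  have "ciso L S T (\<Union>n. Rs n)"
    by (rule ciso_UN) (use Rs(1,2) in \<open>simp_all add: good_def\<close>)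
  then show thesis using that Rs(3) by blast
qed

lemma member_cl_countable:
  assumes A: "countable A" "A \<subseteq> univ S" shows "countable (cl S A)"
proof -
  obtain R where R: "ciso L S T R" "A \<subseteq> Domain R" using countable_chart[OF A] .
  define G where "G = Id_on A O R"
  have G: "G \<subseteq> R" "Domain G = A" using R(2) by (auto simp: G_def Domain_Id_on_comp)
  have "countable (Range G)"
    using piso_countable[OF piso_mono[OF ciso_piso[OF R(1)] G(1)]] G(2) A(1) by (simp add: Range_snd)
  moreover have "Range G \<subseteq> univ T" using G(1) ciso_subset[OF R(1)] by auto
  ultimately have c: "countable (cl T (Range G))" by (rule cl_countable)
  \<comment> \<open>The part of the chart with values in a countable closed set; injectivity makes it countable.\<close>
  define K where "K = R O Id_on (cl T (Range G))"
  have K: "K \<subseteq> R" "Range K \<subseteq> cl T (Range G)" by (auto simp: K_def)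
  have "countable K"
    using piso_countable[OF piso_mono[OF ciso_piso[OF R(1)] K(1)]] countable_subset[OF K(2) c] by simp
  moreover have "cl S A \<subseteq> Domain K"
  proof
    fix x assume x: "x \<in> cl S A"
    have "cl S A \<subseteq> Domain R"
      using S.cl_mono[OF R(2)] ciso_cl_Domain[OF R(1) S.pg] ciso_subset[OF R(1)] by auto
    then obtain y where y: "(x, y) \<in> R" using x by auto
    have "y \<in> cl T (Range G)" using ciso_mem_cl[OF R(1) S.pg pg y G(1)] x G(2) by simp
    then show "x \<in> Domain K" using y by (auto simp: K_def)
  qed
  ultimately show ?thesis by (metis Domain_fst countable_image countable_subset)
qed

lemma member_fint_in_cl:
  assumes f: "f \<in> fsyms L" "length xs = farity L f" and xs: "set xs \<subseteq> univ S"
  shows "fint S f xs \<in> cl S (set xs)"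
proof -
  have y: "fint S f xs \<in> univ S"
    using locally_inD(1)[OF local] f xs by (simp add: is_pstr_def is_str_def)
  obtain R where R: "ciso L S T R" "insert (fint S f xs) (set xs) \<subseteq> Domain R"
    using locally_inD(3)[OF local, of "insert (fint S f xs) (set xs)"] xs y by auto
  have "\<forall>x\<in>Domain R. \<exists>z. (x, z) \<in> R" by auto
  then obtain g where g: "\<And>x. x \<in> Domain R \<Longrightarrow> (x, g x) \<in> R" by metis
  define G where "G = (\<lambda>x. (x, g x)) ` set xs"
  have G: "G \<subseteq> R" "finite G" "Domain G = set xs" "Range G = set (map g xs)"
    using g R(2) unfolding G_def by (auto simp: image_iff)
  have y': "(fint S f xs, g (fint S f xs)) \<in> R" using g R(2) by simp
  have "list_all2 (\<lambda>x z. (x, z) \<in> R) xs (map g xs)"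
    unfolding list_all2_map2 by (rule list.rel_refl_strong) (use g R(2) in auto)
  then have "g (fint S f xs) = fint T f (map g xs)"
    using piso_fint_iff[OF ciso_piso[OF R(1)] f _ y'] by simp
  moreover have "set (map g xs) \<subseteq> univ T" using G(1,4) ciso_subset[OF R(1)] by auto
  ultimately have "g (fint S f xs) \<in> cl T (Range G)"
    using fint_in_cl[of f "map g xs"] f G(4) by simp
  then show ?thesis using ciso_mem_iff[OF R(1) y' G(1,2)] G(3) by simp
qed

text \<open>A countable partial isomorphism of \<open>S\<close> is transported to \<open>T\<close> by a chart on all the elements
involved, extended there, and pulled back.\<close>

theorem member_ciso_extend:
  assumes F: "ciso L S S F" "countable F"
    and b: "b \<in> univ S" "b \<notin> Domain F" "b' \<in> univ S" "b' \<notin> Range F"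
  obtains F' where "ciso L S S F'" "countable F'" "insert (b, b') F \<subseteq> F'"
    "Domain F' \<subseteq> cl S (insert b (Domain F))" "Range F' \<subseteq> cl S (insert b' (Range F))"
proof -
  have U: "insert b (Domain F) \<subseteq> univ S" "insert b' (Range F) \<subseteq> univ S"
    using ciso_subset[OF F(1)] b by auto
  have "countable (insert b (Domain F) \<union> insert b' (Range F))"
    using F(2) by (simp add: Domain_fst Range_snd)
  then obtain R where R: "ciso L S T R" "insert b (Domain F) \<union> insert b' (Range F) \<subseteq> Domain R"
    using countable_chart U by (metis Un_least)
  obtain c c' where c: "(b, c) \<in> R" "(b', c') \<in> R" using R(2) by auto
  have cU: "c \<in> univ T" "c' \<in> univ T" using c ciso_subset[OF R(1)] by auto
  define F0 where "F0 = R\<inverse> O F O R"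
  have F0: "ciso L T T F0"
    unfolding F0_def by (intro ciso_comp[OF ciso_converse[OF R(1)]] ciso_comp[OF F(1) R(1)])
  note eq = piso_eq_iff[OF ciso_piso[OF R(1)]]
  have "Domain F0 \<subseteq> R `` Domain F" unfolding F0_def by auto
  moreover have "countable (R `` Domain F)"
  proof -
    have sub: "Id_on (Domain F) O R \<subseteq> R" by auto
    have "countable (Domain (Id_on (Domain F) O R))"
      unfolding Domain_Id_on_comp using F(2) by (simp add: Domain_fst)
    then have "countable (Id_on (Domain F) O R)"
      using piso_countable[OF piso_mono[OF ciso_piso[OF R(1)] sub]] by simp
    then have "countable (Range (Id_on (Domain F) O R))" by (simp add: Range_snd)
    moreover have "R `` Domain F = Range (Id_on (Domain F) O R)" by auto
    ultimately show ?thesis by simp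
  qed
  ultimately have "countable (Domain F0)" by (rule countable_subset)
  then have F0c: "countable F0" using piso_countable[OF ciso_piso[OF F0]] by simp
  have "c \<notin> Domain F0"
  proof
    assume "c \<in> Domain F0"
    then obtain x where "(x, c) \<in> R" "x \<in> Domain F" unfolding F0_def by auto
    then show False using eq[OF c(1)] b(2) by auto
  qed
  moreover have "c' \<notin> Range F0"
  proof
    assume "c' \<in> Range F0"
    then obtain x where "(x, c') \<in> R" "x \<in> Range F" unfolding F0_def by auto
    then show False using eq[OF c(2)] b(4) by auto
  qed
  ultimately obtain F1 where F1: "ciso L T T F1" "countable F1" "insert (c, c') F0 \<subseteq> F1"
    "Domain F1 = cl T (insert c (Domain F0))" "Range F1 = cl T (insert c' (Range F0))"
    using ciso_extend[OF F0 F0c cU(1) _ cU(2)] by metis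
  define F' where "F' = R O F1 O R\<inverse>"
  have F': "ciso L S S F'"
    unfolding F'_def by (intro ciso_comp[OF R(1)] ciso_comp[OF F1(1) ciso_converse[OF R(1)]])
  have "Domain F' \<subseteq> cl S (insert b (Domain F))"
  proof
    fix x assume "x \<in> Domain F'"
    then obtain u where u: "(x, u) \<in> R" "u \<in> Domain F1" unfolding F'_def by auto
    define G where "G = Id_on (insert b (Domain F)) O R"
    have G: "G \<subseteq> R" "Domain G = insert b (Domain F)" using R(2) by (auto simp: G_def Domain_Id_on_comp)
    have "insert c (Domain F0) \<subseteq> Range G" using c(1) unfolding G_def F0_def by auto
    moreover have "Range G \<subseteq> univ T" using G(1) ciso_subset[OF R(1)] by auto
    ultimately have "u \<in> cl T (Range G)" using u(2) F1(4) cl_monoD by metis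
    then show "x \<in> cl S (insert b (Domain F))"
      using ciso_mem_cl_converse[OF R(1) S.pg pg u(1) G(1)] G(2) by simp
  qed
  moreover have sub: "insert (b, b') F \<subseteq> F'"
  proof
    fix p assume "p \<in> insert (b, b') F"
    then consider "p = (b, b')" | "p \<in> F" by auto
    then show "p \<in> F'"
    proof cases
      case 1
      then show ?thesis using c F1(3) unfolding F'_def by auto
    next
      case 2
      obtain x y where p: "p = (x, y)" by (cases p)
      have "x \<in> Domain R" "y \<in> Domain R" using 2 p R(2) by auto
      then obtain u v where uv: "(x, u) \<in> R" "(y, v) \<in> R" by auto
      have "(u, v) \<in> F1" using uv 2 p F1(3) unfolding F0_def by auto
      then show ?thesis using uv p unfolding F'_def by auto
    qed
  qed
  moreover have "Range F' \<subseteq> cl S (insert b' (Range F))"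
  proof
    fix y assume "y \<in> Range F'"
    then obtain x where x: "(x, y) \<in> F'" by auto
    then have "x \<in> cl S (Domain (insert (b, b') F))"
      using \<open>Domain F' \<subseteq> cl S (insert b (Domain F))\<close> by auto
    then show "y \<in> cl S (insert b' (Range F))"
      using ciso_mem_cl[OF F' S.pg S.pg x sub] by simp
  qed
  moreover have "countable F'"
  proof -
    have "countable (Domain F)" using F(2) by (simp add: Domain_fst)
    then have "countable (cl S (insert b (Domain F)))" using U(1) by (simp add: member_cl_countable)
    then have "countable (Domain F')"
      using \<open>Domain F' \<subseteq> cl S (insert b (Domain F))\<close> by (rule countable_subset[rotated])
    then show ?thesis using piso_countable[OF ciso_piso[OF F']] by simp
  qed
  ultimately show thesis using that F' by blast
qed

end

section \<open>Back-and-forth for modular pairs\<close>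

text \<open>The modular law for closed sets, obtained from the independence of finite tuples over the
intersection of their closures. Reducing to finite parts, \<open>x\<close> depends on \<open>xs\<close> and \<open>qs\<close> with \<open>xs\<close> in
\<open>X\<close> and \<open>qs\<close> in \<open>Q\<close>. Independence says that \<open>xs\<close> has the same dimension over \<open>x, qs, Z\<close> as over the
intersection \<open>Z\<close>. So a basis \<open>ys\<close> of \<open>xs\<close> over \<open>x, qs, Z\<close> already spans \<open>xs\<close> over \<open>Z\<close>, and by
symmetry \<open>x\<close> is not captured by adding \<open>ys\<close> unless it depends on \<open>qs\<close> and \<open>Z\<close> alone.\<close>

lemma (in pregeom) modular_law:
  assumes modular: "\<And>as bs. set as \<subseteq> U \<Longrightarrow> set bs \<subseteq> U \<Longrightarrow>
      perp_cl c as (c (set as) \<inter> c (set bs)) (set bs)"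
    and X: "X \<subseteq> U" "c X = X" and P: "P \<subseteq> U" "c P = P"
    and Q: "Q \<subseteq> P" and x: "x \<in> P" "x \<in> c (X \<union> Q)"
  shows "x \<in> c (X \<inter> P \<union> Q)"
proof -
  have XQ: "X \<union> Q \<subseteq> U" using X(1) P(1) Q by auto
  obtain F where F: "finite F" "F \<subseteq> X \<union> Q" "x \<in> c F" using cl_finite[OF XQ x(2)] .
  obtain xs where xs: "set xs = F \<inter> X" using finite_list[of "F \<inter> X"] F(1) by auto
  obtain qs where qs: "set qs = F \<inter> Q" using finite_list[of "F \<inter> Q"] F(1) by auto
  \<comment> \<open>This intersection lies in \<open>X \<inter> P\<close>, as \<open>X\<close> and \<open>P\<close> are closed.\<close>
  define Z where "Z = c (set xs) \<inter> c (set (x # qs))"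
  have U: "set xs \<subseteq> U" "set (x # qs) \<subseteq> U" using xs qs X(1) P(1) Q x(1) by auto
  have "c (set xs) \<subseteq> X" using cl_mono[of "set xs" X] xs X by simp
  moreover have "c (set (x # qs)) \<subseteq> P" using cl_mono[of "set (x # qs)" P] qs P Q x(1) by auto
  ultimately have Z: "Z \<subseteq> X \<inter> P" unfolding Z_def by auto
  then have ZU: "Z \<subseteq> U" using X(1) by auto
  have sub: "set (x # qs) \<union> Z \<subseteq> U" using U(2) ZU by simp
  have "dim_over c (set xs) (set (x # qs) \<union> Z) =o dim_over c (set xs) Z"
    using modular[OF U] unfolding perp_cl_def Z_def .
  moreover obtain B1 where B1: "pg_basis (localize c (set (x # qs) \<union> Z)) (set xs) B1"
      "dim_over c (set xs) (set (x # qs) \<union> Z) = |B1|"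
    by (rule pg_dim_basis[OF U(1) sub])
  moreover obtain B2 where B2: "pg_basis (localize c Z) (set xs) B2" "dim_over c (set xs) Z = |B2|"
    by (rule pg_dim_basis[OF U(1) ZU])
  ultimately have "|B1| =o |B2|" by simp
  have B1xs: "B1 \<subseteq> set xs" "pg_indep (localize c (set (x # qs) \<union> Z)) B1"
    and B2xs: "B2 \<subseteq> set xs" "set xs \<subseteq> c (Z \<union> B2)"
    using B1(1) B2(1) unfolding pg_basis_def localize_def by (simp_all add: Un_commute)
  have fin: "finite B1" "finite B2" using B1xs(1) B2xs(1) by (auto intro: finite_subset)
  have card: "card B1 = card B2"
    using \<open>|B1| =o |B2|\<close> unfolding card_of_ordIso[symmetric] by (auto dest: bij_betw_same_card)
  obtain ys where ys: "set ys = B1" "distinct ys" "seq_indep c (set (x # qs) \<union> Z) ys"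
    by (rule pg_indep_seq[OF fin(1) B1xs(2) subset_trans[OF B1xs(1) U(1)] sub])
  have ysU: "set ys \<subseteq> U" using ys(1) B1xs(1) U(1) by simp
  have len: "length ys = card B2" using ys(1,2) card distinct_card by metis
  have "Z \<subseteq> c (set (x # qs) \<union> Z)" using cl_extensive[OF sub] by simp
  then have "seq_indep c Z ys" by (rule seq_indep_antimono[OF ys(3) _ sub ysU])
  moreover have "set ys \<subseteq> c (Z \<union> B2)" using ys(1) B1xs(1) B2xs(2) by simp
  ultimately have "B2 \<subseteq> c (Z \<union> set ys)"
    using steinitz[of Z ys B2] fin(2) ZU B2xs(1) U(1) len by simp
  moreover have ZysU: "Z \<union> set ys \<subseteq> U" using ZU ysU by simp
  ultimately have "Z \<union> B2 \<subseteq> c (Z \<union> set ys)" using cl_extensive[OF ZysU] by simp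
  then have "c (Z \<union> B2) \<subseteq> c (Z \<union> set ys)" by (rule cl_minimal[OF _ ZysU])
  then have xsZ: "set xs \<subseteq> c (Z \<union> set ys)" using B2xs(2) by simp
  have "x \<in> c (set qs \<union> Z)"
  proof (rule ccontr)
    assume n: "x \<notin> c (set qs \<union> Z)"
    have "x \<notin> c (set qs \<union> Z \<union> set ys)"
      by (rule seq_indep_swap[OF _ n]) (use ys(3) U(2) ZU ysU in simp_all)
    moreover have "x \<in> c (set qs \<union> Z \<union> set ys)"
    proof (rule cl_minimalD[OF F(3)])
      show sub': "set qs \<union> Z \<union> set ys \<subseteq> U" using U(2) ZU ysU by simp
      have "c (Z \<union> set ys) \<subseteq> c (set qs \<union> Z \<union> set ys)" by (rule cl_mono[OF _ sub']) auto
      moreover have "set qs \<subseteq> c (set qs \<union> Z \<union> set ys)" using cl_extensive[OF sub'] by simp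
      moreover have "F = set xs \<union> set qs" using F(2) xs qs by auto
      ultimately show "F \<subseteq> c (set qs \<union> Z \<union> set ys)" using xsZ by simp
    qed
    ultimately show False by simp
  qed
  then show ?thesis
    by (rule cl_monoD) (use Z qs X(1) P(1) Q in auto)
qed

lemma tm_val_expand_P: "tm_val (expand_P M P) e t = tm_val M e t"
proof (induction t)
  case (Fn f ts)
  then have "map (tm_val (expand_P M P) e) ts = map (tm_val M e) ts" by simp
  then show ?case by (simp only: tm_val.simps) (simp add: expand_P_def)
qed simp

lemma wf_tm_lang_P: "wf_tm (lang_P L) t \<longleftrightarrow> wf_tm L t"
  by (induction t) (auto simp: lang_P_def)

text \<open>Density and codensity are asked over countable sets, because the partial isomorphisms of the
back-and-forth are countable rather than finite.\<close>

locale dense_pair = class_member L T S for L :: "('f, 'r) lang" and T S :: "('a, 'f, 'r) pstr" +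
  fixes P :: "'a set"
  assumes P_subset: "P \<subseteq> univ S" and P_closed: "cl S P = P"
    and modular: "\<And>as bs. set as \<subseteq> univ S \<Longrightarrow> set bs \<subseteq> univ S \<Longrightarrow>
      perp_cl (cl S) as (cl S (set as) \<inter> cl S (set bs)) (set bs)"
    and dense: "\<And>A. countable A \<Longrightarrow> A \<subseteq> univ S \<Longrightarrow> \<exists>b\<in>P. b \<notin> cl S A"
    and codense: "\<And>A. countable A \<Longrightarrow> A \<subseteq> univ S \<Longrightarrow> \<exists>b\<in>univ S. b \<notin> cl S (A \<union> P)"
begin

definition pair_iso :: "('a \<times> 'a) set \<Rightarrow> bool" where
  "pair_iso K \<longleftrightarrow> ciso L S S K \<and> countable K \<and> (\<forall>(x, y) \<in> K. x \<in> P \<longleftrightarrow> y \<in> P)"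

lemma pair_isoD:
  assumes "pair_iso K"
  shows "ciso L S S K" "countable K" "\<And>x y. (x, y) \<in> K \<Longrightarrow> x \<in> P \<longleftrightarrow> y \<in> P"
    "Domain K \<subseteq> univ S" "Range K \<subseteq> univ S" "cl S (Domain K) = Domain K" "cl S (Range K) = Range K"
proof -
  show 1: "ciso L S S K" "countable K" "\<And>x y. (x, y) \<in> K \<Longrightarrow> x \<in> P \<longleftrightarrow> y \<in> P"
    using assms unfolding pair_iso_def by auto
  show "Domain K \<subseteq> univ S" "Range K \<subseteq> univ S" using ciso_subset[OF 1(1)] by auto
  show "cl S (Domain K) = Domain K" "cl S (Range K) = Range K"
    by (rule ciso_cl_Domain[OF 1(1) S.pg], rule ciso_cl_Range[OF 1(1) S.pg])
qed

lemma pair_iso_converse: assumes "pair_iso K" shows "pair_iso (K\<inverse>)"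
  unfolding pair_iso_def
  using ciso_converse[OF pair_isoD(1)[OF assms]] countable_image[OF pair_isoD(2)[OF assms], of prod.swap]
    pair_isoD(3)[OF assms]
  by (auto simp: image_swap_eq_converse)

text \<open>The extension is determined on the new closure by the structure without \<open>P\<close>, so \<open>P\<close> has to be
controlled there. By modularity the new elements of \<open>P\<close> are in the closure of \<open>b\<close> and the old
elements of \<open>P\<close>; these are mapped into \<open>P\<close>, which is closed.\<close>

lemma pair_iso_extend_P:
  assumes K: "pair_iso K" and b: "b \<in> P" "b \<notin> Domain K" "b' \<in> P" "b' \<notin> Range K"
  obtains K' where "pair_iso K'" "insert (b, b') K \<subseteq> K'"
    "Domain K' \<subseteq> cl S (insert b (Domain K))" "Range K' \<subseteq> cl S (insert b' (Range K))"
proof -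
  note k = pair_isoD[OF K]
  obtain K' where K': "ciso L S S K'" "countable K'" "insert (b, b') K \<subseteq> K'"
    "Domain K' \<subseteq> cl S (insert b (Domain K))" "Range K' \<subseteq> cl S (insert b' (Range K))"
    using member_ciso_extend[OF k(1,2) subsetD[OF P_subset b(1)] b(2) subsetD[OF P_subset b(3)] b(4)] .
  \<comment> \<open>The pairs inside \<open>P\<close>, which by modularity generate all that is new in \<open>P\<close>.\<close>
  define G where "G = insert (b, b') (K \<inter> P \<times> P)"
  have G: "G \<subseteq> K'" using K'(3) by (auto simp: G_def)
  have dom: "Domain G = insert b (Domain K \<inter> P)" "Range G = insert b' (Range K \<inter> P)"
    using k(3) by (auto simp: G_def)
  have sub: "Domain G \<subseteq> P" "Range G \<subseteq> P" using b by (auto simp: G_def)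
  have P: "cl S A \<subseteq> P" if "A \<subseteq> P" for A using S.cl_mono[OF that P_subset] P_closed by simp
  have "x \<in> P \<longleftrightarrow> y \<in> P" if xy: "(x, y) \<in> K'" for x y
  proof
    assume x: "x \<in> P"
    have "x \<in> cl S (Domain K \<union> {b})" using K'(4) xy by auto
    then have "x \<in> cl S (Domain K \<inter> P \<union> {b})"
      using b(1) x by (intro S.modular_law[OF modular k(4,6) P_subset P_closed]) auto
    then have "y \<in> cl S (Range G)"
      using ciso_mem_cl[OF K'(1) S.pg S.pg xy G] dom(1) by simp
    then show "y \<in> P" using P[OF sub(2)] by auto
  next
    assume y: "y \<in> P"
    have "y \<in> cl S (Range K \<union> {b'})" using K'(5) xy by auto
    then have "y \<in> cl S (Range K \<inter> P \<union> {b'})"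
      using b(3) y by (intro S.modular_law[OF modular k(5,7) P_subset P_closed]) auto
    then have "x \<in> cl S (Domain G)"
      using ciso_mem_cl_converse[OF K'(1) S.pg S.pg xy G] dom(2) by simp
    then show "x \<in> P" using P[OF sub(1)] by auto
  qed
  then have "pair_iso K'" using K'(1,2) unfolding pair_iso_def by auto
  then show thesis using that K'(3-5) by simp
qed

text \<open>Adding an element generic over \<open>P\<close> creates no new elements of \<open>P\<close>, by exchange.\<close>

lemma P_trace_generic:
  assumes A: "A \<subseteq> univ S" "cl S A = A" and b: "b \<in> univ S" "b \<notin> cl S (A \<union> P)"
    and x: "x \<in> P" "x \<in> cl S (insert b A)"
  shows "x \<in> A"
proof (rule ccontr)
  assume "x \<notin> A"
  then have "b \<in> cl S (insert x A)" using S.exchange[OF A(1) b(1) x(2)] A(2) by simp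
  then have "b \<in> cl S (A \<union> P)" by (rule S.cl_monoD) (use A(1) P_subset x(1) in auto)
  then show False using b(2) by simp
qed

lemma pair_iso_extend_generic:
  assumes K: "pair_iso K"
    and b: "b \<in> univ S" "b \<notin> cl S (Domain K \<union> P)" "b' \<in> univ S" "b' \<notin> cl S (Range K \<union> P)"
  obtains K' where "pair_iso K'" "insert (b, b') K \<subseteq> K'"
    "Domain K' \<subseteq> cl S (insert b (Domain K))" "Range K' \<subseteq> cl S (insert b' (Range K))"
proof -
  note k = pair_isoD[OF K]
  have "b \<notin> Domain K" "b' \<notin> Range K"
    using b(2,4) S.cl_extensive[of "Domain K \<union> P"] S.cl_extensive[of "Range K \<union> P"] k(4,5) P_subset by auto
  then obtain K' where K': "ciso L S S K'" "countable K'" "insert (b, b') K \<subseteq> K'"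
    "Domain K' \<subseteq> cl S (insert b (Domain K))" "Range K' \<subseteq> cl S (insert b' (Range K))"
    using member_ciso_extend[OF k(1,2) b(1) _ b(3)] by metis
  note eq = piso_eq_iff[OF ciso_piso[OF K'(1)]]
  have "x \<in> P \<longleftrightarrow> y \<in> P" if xy: "(x, y) \<in> K'" for x y
  proof
    assume x: "x \<in> P"
    have "x \<in> cl S (insert b (Domain K))" using K'(4) xy by auto
    then have "x \<in> Domain K" by (rule P_trace_generic[OF k(4,6) b(1,2) x])
    then obtain z where z: "(x, z) \<in> K" by auto
    then have "z = y" using eq[OF xy, of x z] K'(3) by auto
    then show "y \<in> P" using k(3)[OF z] x by simp
  next
    assume y: "y \<in> P"
    have "y \<in> cl S (insert b' (Range K))" using K'(5) xy by auto
    then have "y \<in> Range K" by (rule P_trace_generic[OF k(5,7) b(3,4) y])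
    then obtain z where z: "(z, y) \<in> K" by auto
    then have "z = x" using eq[OF xy, of z y] K'(3) by auto
    then show "x \<in> P" using k(3)[OF z] y by simp
  qed
  then have "pair_iso K'" using K'(1,2) unfolding pair_iso_def by auto
  then show thesis using that K'(3-5) by simp
qed

lemma pair_iso_extend_P_list:
  assumes "pair_iso K" "length ps = length ps'" "set ps \<subseteq> P" "set ps' \<subseteq> P"
    "seq_indep (cl S) (Domain K) ps" "seq_indep (cl S) (Range K) ps'"
  obtains K' where "pair_iso K'" "K \<union> set (zip ps ps') \<subseteq> K'"
    "Domain K' \<subseteq> cl S (Domain K \<union> set ps)" "Range K' \<subseteq> cl S (Range K \<union> set ps')"
  using assms(2,1,3-6)
proof (induction ps ps' arbitrary: K thesis rule: list_induct2)
  case Nil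
  show ?case
    by (rule Nil(1)[OF Nil(2)]) (use pair_isoD[OF Nil(2)] in simp_all)
next
  case (Cons p ps p' ps')
  note k = pair_isoD[OF Cons.prems(2)]
  have p: "p \<in> P" "p \<notin> Domain K" "p' \<in> P" "p' \<notin> Range K"
    using Cons.prems(3-6) k(6,7) by simp_all
  obtain K1 where K1: "pair_iso K1" "insert (p, p') K \<subseteq> K1"
    "Domain K1 \<subseteq> cl S (insert p (Domain K))" "Range K1 \<subseteq> cl S (insert p' (Range K))"
    by (rule pair_iso_extend_P[OF Cons.prems(2) p])
  have U: "insert p (Domain K) \<subseteq> univ S" "insert p' (Range K) \<subseteq> univ S"
    "set ps \<subseteq> univ S" "set ps' \<subseteq> univ S"
    using k(4,5) p Cons.prems(3,4) P_subset by auto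
  have ind: "seq_indep (cl S) (Domain K1) ps" "seq_indep (cl S) (Range K1) ps'"
    using S.seq_indep_antimono[OF _ K1(3) U(1,3)] S.seq_indep_antimono[OF _ K1(4) U(2,4)] Cons.prems(5,6)
    by simp_all
  obtain K' where K': "pair_iso K'" "K1 \<union> set (zip ps ps') \<subseteq> K'"
    "Domain K' \<subseteq> cl S (Domain K1 \<union> set ps)" "Range K' \<subseteq> cl S (Range K1 \<union> set ps')"
    using Cons.IH[OF _ K1(1) _ _ ind] Cons.prems(3,4) by auto
  have step: "cl S (A \<union> set xs) \<subseteq> cl S (B \<union> set (x # xs))"
    if "A \<subseteq> cl S (insert x B)" "insert x B \<subseteq> univ S" "set xs \<subseteq> univ S" for A B x xs
  proof (rule S.cl_minimal)
    show sub: "B \<union> set (x # xs) \<subseteq> univ S" using that by simp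
    have "cl S (insert x B) \<subseteq> cl S (B \<union> set (x # xs))" by (rule S.cl_mono[OF _ sub]) auto
    then show "A \<union> set xs \<subseteq> cl S (B \<union> set (x # xs))"
      using that(1) S.cl_extensive[OF sub] by auto
  qed
  show ?case
  proof (rule Cons.prems(1)[OF K'(1)])
    show "K \<union> set (zip (p # ps) (p' # ps')) \<subseteq> K'" using K1(2) K'(2) by auto
    show "Domain K' \<subseteq> cl S (Domain K \<union> set (p # ps))"
      using K'(3) step[OF K1(3) U(1,3)] by (rule subset_trans)
    show "Range K' \<subseteq> cl S (Range K \<union> set (p' # ps'))"
      using K'(4) step[OF K1(4) U(2,4)] by (rule subset_trans)
  qed
qed

lemma pair_iso_extend_generic_list:
  assumes "pair_iso K" "length es = length es'" "set es \<subseteq> univ S" "set es' \<subseteq> univ S"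
    "seq_indep (cl S) (Domain K \<union> P) es" "seq_indep (cl S) (Range K \<union> P) es'"
  obtains K' where "pair_iso K'" "K \<union> set (zip es es') \<subseteq> K'"
  using assms(2,1,3-6)
proof (induction es es' arbitrary: K thesis rule: list_induct2)
  case Nil
  show ?case by (rule Nil(1)[OF Nil(2)]) simp
next
  case (Cons p ps p' ps')
  note k = pair_isoD[OF Cons.prems(2)]
  have p: "p \<in> univ S" "p \<notin> cl S (Domain K \<union> P)" "p' \<in> univ S" "p' \<notin> cl S (Range K \<union> P)"
    using Cons.prems(3-6) by simp_all
  obtain K1 where K1: "pair_iso K1" "insert (p, p') K \<subseteq> K1"
    "Domain K1 \<subseteq> cl S (insert p (Domain K))" "Range K1 \<subseteq> cl S (insert p' (Range K))"
    by (rule pair_iso_extend_generic[OF Cons.prems(2) p])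
  have ind: "seq_indep (cl S) (A \<union> P) xs"
    if "seq_indep (cl S) (insert x (B \<union> P)) xs" "A \<subseteq> cl S (insert x B)" "insert x B \<subseteq> univ S" "set xs \<subseteq> univ S"
    for A B x xs
  proof (rule S.seq_indep_antimono[OF that(1)])
    show sub: "insert x (B \<union> P) \<subseteq> univ S" using that(3) P_subset by simp
    have "cl S (insert x B) \<subseteq> cl S (insert x (B \<union> P))" by (rule S.cl_mono[OF _ sub]) auto
    then show "A \<union> P \<subseteq> cl S (insert x (B \<union> P))"
      using that(2) S.cl_extensive[OF sub] by auto
  qed (rule that(4))
  have U: "insert p (Domain K) \<subseteq> univ S" "insert p' (Range K) \<subseteq> univ S"
    "set ps \<subseteq> univ S" "set ps' \<subseteq> univ S"
    using k(4,5) p(1,3) Cons.prems(3,4) by simp_all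
  obtain K' where K': "pair_iso K'" "K1 \<union> set (zip ps ps') \<subseteq> K'"
    using Cons.IH[OF _ K1(1) U(3,4) ind[OF _ K1(3) U(1,3)] ind[OF _ K1(4) U(2,4)]] Cons.prems(5,6) by auto
  show ?case
    by (rule Cons.prems(1)[OF K'(1)]) (use K1(2) K'(2) in auto)
qed

lemma pair_iso_extend_in_P:
  assumes K: "pair_iso K" and b: "b \<in> P"
  shows "\<exists>K'. pair_iso K' \<and> K \<subseteq> K' \<and> b \<in> Domain K'"
proof (cases "b \<in> Domain K")
  case False
  note k = pair_isoD[OF K]
  have "countable (Range K)" using k(2) by (simp add: Range_snd)
  then obtain b' where b': "b' \<in> P" "b' \<notin> Range K" using dense[OF _ k(5)] k(7) by auto
  obtain K' where "pair_iso K'" "insert (b, b') K \<subseteq> K'"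
    using pair_iso_extend_P[OF K b False b'] by metis
  then show ?thesis by auto
qed (use K in auto)

text \<open>An element in the closure of the domain and \<open>P\<close> is reached by first adding the finitely many
elements of \<open>P\<close> it needs; any other element is generic.\<close>

lemma pair_iso_forth:
  assumes K: "pair_iso K" and b: "b \<in> univ S"
  shows "\<exists>K'. pair_iso K' \<and> K \<subseteq> K' \<and> b \<in> Domain K'"
proof (cases "b \<in> cl S (Domain K \<union> P)")
  case True
  note k = pair_isoD[OF K]
  obtain F where F: "finite F" "F \<subseteq> Domain K \<union> P" "b \<in> cl S F"
    using S.cl_finite[OF _ True] k(4) P_subset by auto
  have "\<exists>K'. pair_iso K' \<and> K \<subseteq> K' \<and> F \<subseteq> Domain K'" using F(1,2)
  proof (induction F)
    case empty
    then show ?case using K by auto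
  next
    case (insert x F)
    then obtain K1 where K1: "pair_iso K1" "K \<subseteq> K1" "F \<subseteq> Domain K1" by auto
    have "\<exists>K'. pair_iso K' \<and> K1 \<subseteq> K' \<and> x \<in> Domain K'"
    proof (cases "x \<in> P")
      case True
      then show ?thesis by (rule pair_iso_extend_in_P[OF K1(1)])
    next
      case False
      then show ?thesis using insert.prems K1(1,2) by auto
    qed
    then obtain K2 where K2: "pair_iso K2" "K1 \<subseteq> K2" "x \<in> Domain K2" by auto
    then show ?case using K1 Domain_mono[OF K2(2)] by (intro exI[of _ K2]) auto
  qed
  then obtain K' where K': "pair_iso K'" "K \<subseteq> K'" "F \<subseteq> Domain K'" by auto
  have "b \<in> cl S (Domain K')" by (rule S.cl_monoD[OF F(3) K'(3) pair_isoD(4)[OF K'(1)]])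
  then show ?thesis using K' pair_isoD(6)[OF K'(1)] by auto
next
  case False
  note k = pair_isoD[OF K]
  have "countable (Range K)" using k(2) by (simp add: Range_snd)
  then obtain b' where b': "b' \<in> univ S" "b' \<notin> cl S (Range K \<union> P)" using codense[OF _ k(5)] by auto
  obtain K' where "pair_iso K'" "insert (b, b') K \<subseteq> K'"
    using pair_iso_extend_generic[OF K b False b'] by metis
  then show ?thesis by auto
qed

lemma pair_iso_back:
  assumes K: "pair_iso K" and b: "b \<in> univ S"
  shows "\<exists>K'. pair_iso K' \<and> K \<subseteq> K' \<and> b \<in> Range K'"
proof -
  obtain K' where "pair_iso K'" "K\<inverse> \<subseteq> K'" "b \<in> Domain K'"
    using pair_iso_forth[OF pair_iso_converse[OF K] b] by auto
  then show ?thesis using pair_iso_converse[of K'] by (intro exI[of _ "K'\<inverse>"]) auto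
qed

lemma pair_iso_tm_val:
  assumes K: "pair_iso K" and "wf_tm L t" "\<And>v. v \<in> tm_vars t \<Longrightarrow> (e v, e' v) \<in> K"
  shows "(tm_val S e t, tm_val S e' t) \<in> K"
  using assms(2,3)
proof (induction t)
  case (Fn f ts)
  note k = pair_isoD[OF K]
  let ?xs = "map (tm_val S e) ts" and ?ys = "map (tm_val S e') ts"
  have ts: "(tm_val S e t, tm_val S e' t) \<in> K" if "t \<in> set ts" for t
    using Fn that by auto
  have f: "f \<in> fsyms L" "length ?xs = farity L f" using Fn.prems(1) by simp_all
  have all2: "list_all2 (\<lambda>x y. (x, y) \<in> K) ?xs ?ys"
    unfolding list_all2_map1 list_all2_map2 by (rule list.rel_refl_strong) (rule ts)
  have sub: "set ?xs \<subseteq> Domain K" using ts by auto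
  have "fint S f ?xs \<in> cl S (set ?xs)"
    by (rule member_fint_in_cl[OF f subset_trans[OF sub k(4)]])
  then have "fint S f ?xs \<in> Domain K" using S.cl_mono[OF sub k(4)] k(6) by auto
  then obtain w where w: "(fint S f ?xs, w) \<in> K" by auto
  have "w = fint S f ?ys" using piso_fint_iff[OF ciso_piso[OF k(1)] f all2 w] by simp
  then show ?case using w by simp
qed simp

text \<open>The usual back-and-forth argument. Variables may be infinitely many, since a formula with countably
many parameters is compared under a countable partial isomorphism; each quantifier changes only
one value and so needs only one extension.\<close>

theorem pair_iso_sat:
  assumes "pair_iso K" "wf_fm (lang_P L) \<phi>" "\<And>v. v \<in> fv \<phi> \<Longrightarrow> (e v, e' v) \<in> K"
  shows "sat (expand_P S P) e \<phi> \<longleftrightarrow> sat (expand_P S P) e' \<phi>"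
  using assms
proof (induction \<phi> arbitrary: e e' K)
  case (Eq s t)
  have "(tm_val S e s, tm_val S e' s) \<in> K" "(tm_val S e t, tm_val S e' t) \<in> K"
    using Eq by (auto intro!: pair_iso_tm_val simp: wf_tm_lang_P)
  then show ?case
    using piso_eq_iff[OF ciso_piso[OF pair_isoD(1)[OF Eq(1)]]] by (simp add: tm_val_expand_P)
next
  case (Rel r ts)
  have tm: "(tm_val S e t, tm_val S e' t) \<in> K" if "t \<in> set ts" for t
    using Rel that by (intro pair_iso_tm_val[OF Rel(1)]) (auto simp: wf_tm_lang_P)
  show ?case
  proof (cases r)
    case None
    then have "length ts = 1" using Rel.prems(2) by (simp add: lang_P_def)
    then obtain t where t: "ts = [t]" by (auto simp: length_Suc_conv)
    then show ?thesis using pair_isoD(3)[OF Rel(1) tm[of t]] None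
      by (simp add: expand_P_def tm_val_expand_P[unfolded expand_P_def])
  next
    case (Some q)
    have "q \<in> rsyms L" "length ts = rarity L q" "\<forall>t\<in>set ts. wf_tm L t"
      using Rel.prems(2) Some by (auto simp: wf_tm_lang_P) (auto simp: lang_P_def)
    then have "sat S e (Rel q ts) \<longleftrightarrow> sat S e' (Rel q ts)"
      using Rel.prems(3)
      by (intro piso_sat[OF ciso_piso[OF pair_isoD(1)[OF Rel(1)]]]) auto
    moreover have "tm_val (expand_P S P) e = tm_val S e" "tm_val (expand_P S P) e' = tm_val S e'"
      by (simp_all add: fun_eq_iff tm_val_expand_P)
    ultimately show ?thesis using Some by simp (simp add: expand_P_def)
  qed
next
  case (Neg \<phi>)
  then show ?case by simp
next
  case (And \<phi> \<psi>)
  have "sat (expand_P S P) e \<phi> \<longleftrightarrow> sat (expand_P S P) e' \<phi>"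
    "sat (expand_P S P) e \<psi> \<longleftrightarrow> sat (expand_P S P) e' \<psi>"
    using And.prems And.IH(1)[OF And.prems(1), of e e'] And.IH(2)[OF And.prems(1), of e e'] by simp_all
  then show ?case by simp
next
  case (BigAnd \<Phi>)
  have "sat (expand_P S P) e (\<Phi> n) \<longleftrightarrow> sat (expand_P S P) e' (\<Phi> n)" for n
    by (rule BigAnd.IH[OF _ BigAnd.prems(1)]) (use BigAnd.prems(2,3) in auto)
  then show ?case by simp
next
  case (Ex x \<phi>)
  have U: "univ (expand_P S P) = univ S" by (simp add: expand_P_def)
  have ext: "sat (expand_P S P) (e(x := a)) \<phi> \<longleftrightarrow> sat (expand_P S P) (e'(x := a')) \<phi>"
    if "pair_iso K'" "K \<subseteq> K'" "(a, a') \<in> K'" for K' a a'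
    using that Ex.prems(2,3) by (intro Ex.IH[of K']) auto
  show ?case
  proof
    assume "sat (expand_P S P) e (Ex x \<phi>)"
    then obtain a where a: "a \<in> univ S" "sat (expand_P S P) (e(x := a)) \<phi>" by (auto simp: U)
    obtain K' where K': "pair_iso K'" "K \<subseteq> K'" "a \<in> Domain K'"
      using pair_iso_forth[OF Ex.prems(1) a(1)] by auto
    then obtain a' where a': "(a, a') \<in> K'" by auto
    then have "a' \<in> univ S" using pair_isoD(5)[OF K'(1)] by auto
    then show "sat (expand_P S P) e' (Ex x \<phi>)" using ext[OF K'(1,2) a'] a(2) by (auto simp: U)
  next
    assume "sat (expand_P S P) e' (Ex x \<phi>)"
    then obtain a' where a: "a' \<in> univ S" "sat (expand_P S P) (e'(x := a')) \<phi>" by (auto simp: U)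
    obtain K' where K': "pair_iso K'" "K \<subseteq> K'" "a' \<in> Range K'"
      using pair_iso_back[OF Ex.prems(1) a(1)] by auto
    then obtain a where a': "(a, a') \<in> K'" by auto
    then have "a \<in> univ S" using pair_isoD(4)[OF K'(1)] by auto
    then show "sat (expand_P S P) e (Ex x \<phi>)" using ext[OF K'(1,2) a'] a(2) by (auto simp: U)
  qed
qed

end

section \<open>Realizing types freely\<close>

lemma countable_fv:
  fixes \<phi> :: "('f, 'r, 'v) fm"
  shows "countable (fv \<phi>)"
  by (induction \<phi>) (simp_all add: finite_tm_vars countable_finite)

lemma Domain_set_zip: "length xs = length ys \<Longrightarrow> Domain (set (zip xs ys)) = set xs"
  and Range_set_zip: "length xs = length ys \<Longrightarrow> Range (set (zip xs ys)) = set ys"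
  by (simp_all add: Domain_fst Range_snd flip: set_map)

lemma tp_P_eqI:
  assumes "length as = length as'"
    and "\<And>\<phi>. wf_fm (lang_P L) \<phi> \<Longrightarrow> fv \<phi> \<subseteq> {..<length as} <+> B \<Longrightarrow>
      sat (expand_P M P) (case_sum (nth as) id) \<phi> \<longleftrightarrow> sat (expand_P M P) (case_sum (nth as') id) \<phi>"
  shows "tp_P L M P as B = tp_P L M P as' B"
  unfolding tp_P_def assms(1)[symmetric] using assms(2) by blast

lemma tp_P_eqD:
  assumes "tp_P L M P as B = tp_P L M P as' B" "length as = length as'"
    and "wf_fm (lang_P L) \<phi>" "fv \<phi> \<subseteq> {..<length as} <+> B"
  shows "sat (expand_P M P) (case_sum (nth as) id) \<phi> \<longleftrightarrow> sat (expand_P M P) (case_sum (nth as') id) \<phi>"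
proof -
  have "\<phi> \<in> tp_P L M P as B \<longleftrightarrow> \<phi> \<in> tp_P L M P as' B" using assms(1) by simp
  then show ?thesis unfolding tp_P_def using assms(2-4) by simp
qed

text \<open>A formula involves only countably many parameters, so the types over countable subsets determine
the type over \<open>C\<close>. With countably many candidates, one of them must work for all countable subsets at
once: otherwise each candidate fails on some formula, and all fail over the countable set of the
parameters that occur in these formulas.\<close>

lemma tp_P_eq_countably_directed:
  assumes N: "countable N" "\<And>as'. as' \<in> N \<Longrightarrow> length as' = length as"
    and cover: "\<And>C0. countable C0 \<Longrightarrow> C0 \<subseteq> C \<Longrightarrow> \<exists>as'\<in>N. tp_P L M P as' C0 = tp_P L M P as C0"
  shows "\<exists>as'\<in>N. tp_P L M P as' C = tp_P L M P as C"
proof (rule ccontr)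
  assume neg: "\<not> ?thesis"
  have "\<exists>\<phi>. wf_fm (lang_P L) \<phi> \<and> fv \<phi> \<subseteq> {..<length as} <+> C \<and>
      (sat (expand_P M P) (case_sum (nth as') id) \<phi> \<longleftrightarrow> \<not> sat (expand_P M P) (case_sum (nth as) id) \<phi>)"
    if as': "as' \<in> N" for as'
  proof (rule ccontr)
    assume "\<not> ?thesis"
    then have "tp_P L M P as' C = tp_P L M P as C"
      using N(2)[OF as'] by (intro tp_P_eqI) auto
    then show False using neg as' by blast
  qed
  then obtain \<Phi> where \<Phi>: "\<And>as'. as' \<in> N \<Longrightarrow> wf_fm (lang_P L) (\<Phi> as')"
    "\<And>as'. as' \<in> N \<Longrightarrow> fv (\<Phi> as') \<subseteq> {..<length as} <+> C"
    "\<And>as'. as' \<in> N \<Longrightarrow> sat (expand_P M P) (case_sum (nth as') id) (\<Phi> as') \<longleftrightarrow>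
       \<not> sat (expand_P M P) (case_sum (nth as) id) (\<Phi> as')"
    by metis
  define C0 where "C0 = (\<Union>as'\<in>N. Inr -` fv (\<Phi> as'))"
  have "countable (Inr -` fv (\<Phi> as'))" for as'
  proof (rule countable_image_inj_on[of "Inr :: _ \<Rightarrow> nat + _"])
    show "countable ((Inr :: _ \<Rightarrow> nat + _) ` (Inr -` fv (\<Phi> as')))"
      by (rule countable_subset[OF _ countable_fv[of "\<Phi> as'"]]) auto
  qed simp
  then have "countable C0" unfolding C0_def using N(1) by simp
  moreover have "C0 \<subseteq> C" using \<Phi>(2) unfolding C0_def by fastforce
  ultimately obtain as' where as': "as' \<in> N" "tp_P L M P as' C0 = tp_P L M P as C0"
    using cover by blast
  have len: "length as' = length as" by (rule N(2)[OF as'(1)])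
  have "fv (\<Phi> as') \<subseteq> {..<length as'} <+> C0"
  proof
    fix v assume v: "v \<in> fv (\<Phi> as')"
    then have "v \<in> {..<length as} <+> C" using \<Phi>(2)[OF as'(1)] by auto
    then show "v \<in> {..<length as'} <+> C0"
      using v as'(1) len unfolding C0_def by (cases v) auto
  qed
  then show False using tp_P_eqD[OF as'(2) len \<Phi>(1)[OF as'(1)]] \<Phi>(3)[OF as'(1)] by blast
qed

lemma (in pregeom) seq_indep_choose:
  assumes "B \<subseteq> U" "Y \<subseteq> U" "\<And>F. finite F \<Longrightarrow> F \<subseteq> U \<Longrightarrow> \<exists>y\<in>Y. y \<notin> c (B \<union> F)"
  shows "\<exists>ys. length ys = n \<and> set ys \<subseteq> Y \<and> seq_indep c B ys"
proof (induction n)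
  case (Suc n)
  then obtain ys where ys: "length ys = n" "set ys \<subseteq> Y" "seq_indep c B ys" by auto
  obtain y where "y \<in> Y" "y \<notin> c (B \<union> set ys)" using assms(3)[of "set ys"] ys(2) assms(2) by auto
  then have "length (ys @ [y]) = Suc n \<and> set (ys @ [y]) \<subseteq> Y \<and> seq_indep c B (ys @ [y])"
    using ys by (simp add: seq_indep_append)
  then show ?case by blast
qed simp

context dense_pair
begin

text \<open>Every finite set \<open>A\<close> is algebraic over finitely many elements of \<open>C\<close> together with a tuple \<open>ps\<close> of
\<open>P\<close> independent over \<open>C\<close> and a tuple \<open>es\<close> independent over \<open>C\<close> and \<open>P\<close>. First \<open>es\<close> is a basis of \<open>A\<close> over
\<open>C\<close> and \<open>P\<close>; then the finitely many elements of \<open>P\<close> still needed are thinned out to be independent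
over \<open>C\<close>.\<close>

lemma tuple_resolution:
  assumes "finite A" "A \<subseteq> univ S" "C \<subseteq> univ S"
  obtains x0 ps es where "finite x0" "x0 \<subseteq> C" "set ps \<subseteq> P" "seq_indep (cl S) C ps"
    "set es \<subseteq> univ S" "seq_indep (cl S) (C \<union> P) es" "A \<subseteq> cl S (x0 \<union> set ps \<union> set es)"
proof -
  have CP: "C \<union> P \<subseteq> univ S" using assms(3) P_subset by simp
  obtain es where es: "set es \<subseteq> A" "seq_indep (cl S) (C \<union> P) es" "A \<subseteq> cl S (C \<union> P \<union> set es)"
    using S.seq_indep_exists[OF assms(1,2) CP] .
  have esU: "set es \<subseteq> univ S" using es(1) assms(2) by simp
  obtain F where F: "finite F" "F \<subseteq> C \<union> P \<union> set es" "A \<subseteq> cl S F"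
    using S.cl_finite_cover[OF assms(1) _ es(3)] CP esU by auto
  have FP: "finite (F \<inter> P)" "F \<inter> P \<subseteq> univ S" using F(1) P_subset by auto
  obtain ps where ps: "set ps \<subseteq> F \<inter> P" "seq_indep (cl S) C ps" "F \<inter> P \<subseteq> cl S (C \<union> set ps)"
    using S.seq_indep_exists[OF FP assms(3)] .
  have U: "C \<union> set ps \<union> set es \<subseteq> univ S" using assms(3) ps(1) P_subset esU by auto
  have "cl S (C \<union> set ps) \<subseteq> cl S (C \<union> set ps \<union> set es)" by (rule S.cl_mono[OF _ U]) simp
  with ps(3) have "F \<inter> P \<subseteq> cl S (C \<union> set ps \<union> set es)" by (rule subset_trans)
  moreover have "C \<union> set es \<subseteq> cl S (C \<union> set ps \<union> set es)" using S.cl_extensive[OF U] by simp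
  ultimately have "F \<subseteq> cl S (C \<union> set ps \<union> set es)" using F(2) by blast
  then have "cl S F \<subseteq> cl S (C \<union> set ps \<union> set es)" by (rule S.cl_minimal[OF _ U])
  then have "A \<subseteq> cl S (C \<union> set ps \<union> set es)" using F(3) by simp
  then obtain G where G: "finite G" "G \<subseteq> C \<union> set ps \<union> set es" "A \<subseteq> cl S G"
    using S.cl_finite_cover[OF assms(1) U] by metis
  have sub: "G \<inter> C \<union> set ps \<union> set es \<subseteq> univ S" using U by auto
  have "cl S G \<subseteq> cl S (G \<inter> C \<union> set ps \<union> set es)" by (rule S.cl_mono[OF _ sub]) (use G(2) in auto)
  then show thesis
    using that[of "G \<inter> C" ps es] G(1,3) ps(1,2) esU es(2) by auto
qed

text \<open>Over a countable part of \<open>C\<close>, the identity extends to a partial isomorphism of the pair sending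
\<open>ps\<close> to \<open>ps'\<close> and \<open>es\<close> to \<open>es'\<close>, and it carries \<open>as\<close> along. The image depends on the countable part,
but always lies in the closure of \<open>x0\<close>, \<open>ps'\<close> and \<open>es'\<close>, a countable set fixed in advance.\<close>

lemma realize_over_countable:
  assumes C: "C \<subseteq> univ S" "countable C0" "C0 \<subseteq> C" "finite x0" "x0 \<subseteq> C"
    and ps: "set ps \<subseteq> P" "seq_indep (cl S) C ps" and ps': "set ps' \<subseteq> P" "seq_indep (cl S) C ps'"
    and es: "set es \<subseteq> univ S" "seq_indep (cl S) (C \<union> P) es"
    and es': "set es' \<subseteq> univ S" "seq_indep (cl S) (C \<union> P) es'"
    and len: "length ps = length ps'" "length es = length es'"
    and as: "set as \<subseteq> cl S (x0 \<union> set ps \<union> set es)"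
  shows "\<exists>as'. length as' = length as \<and> set as' \<subseteq> cl S (x0 \<union> set ps' \<union> set es') \<and>
    tp_P L S P as' C0 = tp_P L S P as C0"
proof -
  have X0: "C0 \<union> x0 \<subseteq> univ S" "countable (C0 \<union> x0)" "C0 \<union> x0 \<subseteq> C"
    using C by (auto simp: countable_finite)
  define X where "X = cl S (C0 \<union> x0)"
  have X: "X \<subseteq> univ S" "cl S X = X" "countable X" "C0 \<union> x0 \<subseteq> X" "X \<subseteq> cl S C"
    unfolding X_def using S.cl_subset[OF X0(1)] S.cl_idem[OF X0(1)] member_cl_countable[OF X0(2,1)]
      S.cl_extensive[OF X0(1)] S.cl_mono[OF X0(3) C(1)] by simp_all
  have CP: "C \<union> P \<subseteq> univ S" using C(1) P_subset by simp
  have K0: "pair_iso (Id_on X)"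
    unfolding pair_iso_def using ciso_Id_on[OF S.pg X(1,2)] X(3) by (auto simp: Id_on_def)
  have PU: "set ps \<subseteq> univ S" "set ps' \<subseteq> univ S" using ps(1) ps'(1) P_subset by auto
  have "seq_indep (cl S) (Domain (Id_on X)) ps" "seq_indep (cl S) (Range (Id_on X)) ps'"
    using S.seq_indep_antimono[OF ps(2) X(5) C(1) PU(1)] S.seq_indep_antimono[OF ps'(2) X(5) C(1) PU(2)]
    by simp_all
  then obtain K1 where K1: "pair_iso K1" "Id_on X \<union> set (zip ps ps') \<subseteq> K1"
    "Domain K1 \<subseteq> cl S (X \<union> set ps)" "Range K1 \<subseteq> cl S (X \<union> set ps')"
    using pair_iso_extend_P_list[OF K0 len(1) ps(1) ps'(1)] by auto
  have XCP: "cl S (X \<union> Q) \<union> P \<subseteq> cl S (C \<union> P)" if "Q \<subseteq> P" for Q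
  proof -
    have "cl S C \<subseteq> cl S (C \<union> P)" by (rule S.cl_mono[OF _ CP]) simp
    then have "X \<union> Q \<subseteq> cl S (C \<union> P)" using X(5) that S.cl_extensive[OF CP] by auto
    then have "cl S (X \<union> Q) \<subseteq> cl S (C \<union> P)" by (rule S.cl_minimal[OF _ CP])
    then show ?thesis using S.cl_extensive[OF CP] by simp
  qed
  have "Domain K1 \<union> P \<subseteq> cl S (C \<union> P)" "Range K1 \<union> P \<subseteq> cl S (C \<union> P)"
    using K1(3,4) XCP[OF ps(1)] XCP[OF ps'(1)] by auto
  then have "seq_indep (cl S) (Domain K1 \<union> P) es" "seq_indep (cl S) (Range K1 \<union> P) es'"
    using S.seq_indep_antimono[OF es(2) _ CP es(1)] S.seq_indep_antimono[OF es'(2) _ CP es'(1)] by simp_all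
  then obtain K where K: "pair_iso K" "K1 \<union> set (zip es es') \<subseteq> K"
    using pair_iso_extend_generic_list[OF K1(1) len(2) es(1) es'(1)] by metis
  note k = pair_isoD[OF K(1)]
  define G where "G = Id_on x0 \<union> set (zip ps ps') \<union> set (zip es es')"
  have G: "G \<subseteq> K" "Domain G = x0 \<union> set ps \<union> set es" "Range G = x0 \<union> set ps' \<union> set es'"
  proof -
    have "Id_on x0 \<subseteq> Id_on X" using X(4) by auto
    moreover have "Id_on X \<union> set (zip ps ps') \<subseteq> K" using subset_trans[OF K1(2)] K(2) by simp
    ultimately show "G \<subseteq> K" unfolding G_def using K(2) by (simp add: subset_trans)
    show "Domain G = x0 \<union> set ps \<union> set es" "Range G = x0 \<union> set ps' \<union> set es'"
      unfolding G_def by (simp_all add: Domain_Un_eq Range_Un_eq Domain_set_zip Range_set_zip len)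
  qed
  have "cl S (Domain G) \<subseteq> Domain K" using S.cl_mono[OF Domain_mono[OF G(1)] k(4)] k(6) by simp
  then have "\<forall>a\<in>set as. \<exists>a'. (a, a') \<in> K" using as G(2) by auto
  then obtain g where g: "\<And>a. a \<in> set as \<Longrightarrow> (a, g a) \<in> K" by metis
  have "set (map g as) \<subseteq> cl S (x0 \<union> set ps' \<union> set es')"
  proof
    fix y assume "y \<in> set (map g as)"
    then obtain a where a: "a \<in> set as" "y = g a" by auto
    have "a \<in> cl S (Domain G)" using a(1) as G(2) by auto
    then show "y \<in> cl S (x0 \<union> set ps' \<union> set es')"
      using ciso_mem_cl[OF k(1) S.pg S.pg g[OF a(1)] G(1)] G(3) a(2) by simp
  qed
  moreover have "tp_P L S P (map g as) C0 = tp_P L S P as C0"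
  proof (rule tp_P_eqI[symmetric])
    fix \<phi> :: "('f, 'r option, nat + 'a) fm"
    assume \<phi>: "wf_fm (lang_P L) \<phi>" "fv \<phi> \<subseteq> {..<length as} <+> C0"
    show "sat (expand_P S P) (case_sum (nth as) id) \<phi> \<longleftrightarrow> sat (expand_P S P) (case_sum (nth (map g as)) id) \<phi>"
    proof (rule pair_iso_sat[OF K(1) \<phi>(1)])
      fix v assume "v \<in> fv \<phi>"
      then have v: "v \<in> {..<length as} <+> C0" using \<phi>(2) by auto
      have "Id_on X \<subseteq> K" using subset_trans[OF K1(2)] K(2) by simp
      then have "(d, d) \<in> K" if "d \<in> C0" for d using that X(4) by auto
      then show "(case_sum (nth as) id v, case_sum (nth (map g as)) id v) \<in> K"
        using v g by (cases v) auto
    qed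
  qed simp
  ultimately show ?thesis by (intro exI[of _ "map g as"]) simp
qed

text \<open>The tuples \<open>ps'\<close> and \<open>es'\<close> are chosen independent over \<open>D\<close>, and over \<open>D\<close> and \<open>P\<close>. Anything in the closure
of \<open>C\<close>, \<open>ps'\<close> and \<open>es'\<close> is then free from \<open>D\<close> over \<open>C\<close>, and free from \<open>D\<close> over \<open>C\<close> when \<open>P\<close> is added
to the base. So it remains to realize the type of \<open>as\<close> by a tuple in that closure, and the
countable directedness of types does this.\<close>

theorem free_realization:
  assumes C: "C \<subseteq> D" "D \<subseteq> univ S" and as: "set as \<subseteq> univ S"
    and denseD: "\<And>F. finite F \<Longrightarrow> F \<subseteq> univ S \<Longrightarrow> \<exists>b\<in>P. b \<notin> cl S (D \<union> F)"
    and codenseD: "\<And>F. finite F \<Longrightarrow> F \<subseteq> univ S \<Longrightarrow> \<exists>b\<in>univ S. b \<notin> cl S (D \<union> P \<union> F)"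
  shows "\<exists>as'. set as' \<subseteq> univ S \<and> tp_P L S P as' C = tp_P L S P as C \<and> perp_clP S P as' C D"
proof -
  have CU: "C \<subseteq> univ S" using C by simp
  have DP: "D \<union> P \<subseteq> univ S" "C \<union> P \<subseteq> D \<union> P" using C P_subset by auto
  obtain x0 ps es where res: "finite x0" "x0 \<subseteq> C" "set ps \<subseteq> P" "seq_indep (cl S) C ps"
    "set es \<subseteq> univ S" "seq_indep (cl S) (C \<union> P) es" "set as \<subseteq> cl S (x0 \<union> set ps \<union> set es)"
    using tuple_resolution[OF finite_set as CU] .
  obtain ps' where ps': "length ps' = length ps" "set ps' \<subseteq> P" "seq_indep (cl S) D ps'"
    using S.seq_indep_choose[OF C(2) P_subset denseD] by blast
  obtain es' where es': "length es' = length es" "set es' \<subseteq> univ S" "seq_indep (cl S) (D \<union> P) es'"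
    using S.seq_indep_choose[OF DP(1) subset_refl codenseD] by blast
  have psU: "set ps' \<subseteq> univ S" using ps'(2) P_subset by simp
  have D: "C \<subseteq> cl S D" "C \<union> P \<subseteq> cl S (D \<union> P)"
    using C(1) DP(2) S.cl_extensive[OF C(2)] S.cl_extensive[OF DP(1)] by auto
  note indC = S.seq_indep_antimono[OF ps'(3) D(1) C(2) psU] S.seq_indep_antimono[OF es'(3) D(2) DP(1) es'(2)]
  define V where "V = cl S (x0 \<union> set ps' \<union> set es')"
  have VU: "x0 \<union> set ps' \<union> set es' \<subseteq> univ S" using res(2) CU psU es'(2) by auto
  \<comment> \<open>The countable set of candidates, independent of the part of \<open>C\<close> considered.\<close>
  define N where "N = {as'. length as' = length as \<and> set as' \<subseteq> V}"
  have "countable V" unfolding V_def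
    by (rule member_cl_countable[OF _ VU]) (simp add: countable_finite res(1))
  then have "countable (lists V)" by (rule countable_lists)
  then have N: "countable N" by (rule countable_subset[rotated]) (auto simp: N_def)
  have "\<exists>as'\<in>N. tp_P L S P as' C = tp_P L S P as C"
  proof (rule tp_P_eq_countably_directed[OF N])
    fix C0 assume C0: "countable C0" "C0 \<subseteq> C"
    obtain as' where "length as' = length as" "set as' \<subseteq> V" "tp_P L S P as' C0 = tp_P L S P as C0"
      using realize_over_countable[OF CU C0 res(1-4) ps'(2) indC(1) res(5,6) es'(2) indC(2)
          ps'(1)[symmetric] es'(1)[symmetric] res(7)]
      unfolding V_def by metis
    then show "\<exists>as'\<in>N. tp_P L S P as' C0 = tp_P L S P as C0"
      by (intro bexI[of _ as']) (simp_all add: N_def)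
  qed (simp add: N_def)
  then obtain as' where as': "as' \<in> N" "tp_P L S P as' C = tp_P L S P as C" by auto
  have V: "set as' \<subseteq> V" using as'(1) by (simp add: N_def)
  have "seq_indep (cl S) (D \<union> set ps') es'"
  proof (rule S.seq_indep_antimono[OF es'(3) _ DP(1) es'(2)])
    show "D \<union> set ps' \<subseteq> cl S (D \<union> P)" using S.cl_extensive[OF DP(1)] ps'(2) by auto
  qed
  then have ind: "seq_indep (cl S) D (ps' @ es')" using ps'(3) by (simp add: seq_indep_append)
  have "V \<subseteq> cl S (C \<union> set (ps' @ es'))"
    unfolding V_def by (rule S.cl_mono) (use res(2) CU psU es'(2) in auto)
  then have "dim_over (cl S) (set as') C = dim_over (cl S) (set as') D"
    using V by (intro S.dim_over_free[OF ind _ C]) (use psU es'(2) in auto)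
  moreover have "V \<subseteq> cl S (C \<union> P \<union> set es')"
    unfolding V_def by (rule S.cl_mono) (use res(2) CU P_subset ps'(2) es'(2) in auto)
  then have "dim_over (cl S) (set as') (C \<union> P) = dim_over (cl S) (set as') (D \<union> P)"
    using V by (intro S.dim_over_free[OF es'(3,2) DP(2,1)]) simp
  ultimately have "perp_clP S P as' C D"
    unfolding perp_clP_def dim_scl_def by (simp add: dim_over_def pg_dim_def card_of_refl)
  moreover have "set as' \<subseteq> univ S" using V S.cl_subset[OF VU] unfolding V_def by simp
  ultimately show ?thesis using as'(2) by blast
qed

end

lemma card_of_Un_countable_less:
  fixes \<kappa> :: "'k rel"
    and D F :: "'a set"
  assumes "Card_order \<kappa>" "natLeq <o \<kappa>" "|D| <o \<kappa>" "countable F"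
  shows "|D \<union> F| <o \<kappa>"
proof -
  have "infinite (Field \<kappa>)"
    using cinfinite_mono[OF ordLess_imp_ordLeq[OF assms(2)] natLeq_cinfinite] by (simp add: cinfinite_def)
  moreover have "|F| <o \<kappa>"
  proof -
    obtain f :: "'a \<Rightarrow> nat" where "inj_on f F" using assms(4) by (rule countableE)
    then have "|F| \<le>o |UNIV :: nat set|" using card_of_ordLeq by blast
    then have "|F| \<le>o natLeq" using card_of_nat ordLeq_ordIso_trans by blast
    then show ?thesis using assms(2) ordLeq_ordLess_trans by blast
  qed
  ultimately show ?thesis using assms(1,3) by (simp add: card_of_Un_ordLess_infinite_Field)
qed

theorem proposition5p23:
  fixes L :: "('f, 'r) lang" and \<C> :: "('a, 'f, 'r) pstr set"
    and M :: "('a, 'f, 'r) pstr" and P :: "'a set" and \<kappa> :: "'k rel"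
    and C D :: "'a set" and as :: "'a list"
  assumes "countable_lang L"
    and "quasiminimal_class L \<C>" and "modular_class \<C>"
    and "beautiful_pair L \<C> M P"
    and "Card_order \<kappa>" and "natLeq <o \<kappa>"
    and "\<kappa> \<le>o dim_over (cl M) (univ M) P" and "\<kappa> \<le>o pg_dim (cl M) P"
    and "C \<subseteq> D" and "D \<subseteq> univ M" and "|C| <o \<kappa>" and "|D| <o \<kappa>"
    and "set as \<subseteq> univ M"
  shows "\<exists>as'. set as' \<subseteq> univ M \<and> tp_P L M P as' C = tp_P L M P as C \<and> perp_clP M P as' C D"
proof -
  obtain S0 where S0: "qm_structure L S0" "\<C> = generated_class L S0"
    using assms(2) unfolding quasiminimal_class_def by auto
  have MC: "M \<in> \<C>" and sub: "closed_sub L (induced M P) M"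
    using assms(4) unfolding beautiful_pair_def by simp_all
  have qm: "qm L S0" by (rule qm_structure_qm[OF S0(1)])
  have loc: "locally_in L S0 M" using generated_class_locally_in[OF qm] MC S0(2) by simp
  interpret qm L S0 by (rule qm)
  interpret class_member L S0 M by unfold_locales (rule loc)
  have PU: "P \<subseteq> univ M" using sub by (simp add: closed_sub_def induced_def)
  have Pcl: "cl M P = P"
    using closed_sub_cl[OF sub, of P] S.cl_extensive[OF PU] by (auto simp: induced_def)
  have loc0: "localize (cl M) {} = cl M" by (simp add: localize_def fun_eq_iff)
  have denseA: "\<exists>b\<in>P. b \<notin> cl M A" if A: "|A| <o \<kappa>" "A \<subseteq> univ M" for A
  proof -
    have "\<kappa> \<le>o dim_over (cl M) P {}" using assms(8) by (simp add: dim_over_def loc0)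
    then obtain y where "y \<in> P" "y \<notin> cl M (A \<union> {})"
      using S.not_in_cl_of_small[OF assms(5,6) _ A(1) PU empty_subsetI A(2)] by metis
    then show ?thesis by auto
  qed
  have codenseA: "\<exists>b\<in>univ M. b \<notin> cl M (A \<union> P)" if "|A| <o \<kappa>" "A \<subseteq> univ M" for A
    using S.not_in_cl_of_small[OF assms(5-7) that(1) subset_refl PU that(2)] by metis
  note small = card_of_Un_countable_less[OF assms(5,6)]
  have countable_small: "|A| <o \<kappa>" if "countable A" for A :: "'a set"
  proof -
    have "|{} :: 'a set| <o \<kappa>"
      using ordLess_transitive[OF _ assms(6)] finite_iff_ordLess_natLeq by blast
    then show ?thesis using small[of "{}" A] that by simp
  qed
  interpret dense_pair L S0 M P
  proof unfold_locales
    show "perp_cl (cl M) as (cl M (set as) \<inter> cl M (set bs)) (set bs)"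
      if "set as \<subseteq> univ M" "set bs \<subseteq> univ M" for as bs
      using assms(3) MC that unfolding modular_class_def by simp
    show "\<exists>b\<in>P. b \<notin> cl M A" if "countable A" "A \<subseteq> univ M" for A
      using denseA[OF countable_small] that by simp
    show "\<exists>b\<in>univ M. b \<notin> cl M (A \<union> P)" if "countable A" "A \<subseteq> univ M" for A
      using codenseA[OF countable_small] that by simp
  qed (rule PU, rule Pcl)
  show ?thesis
  proof (rule free_realization[OF assms(9,10,13)])
    fix F assume F: "finite F" "F \<subseteq> univ M"
    have DF: "|D \<union> F| <o \<kappa>" "D \<union> F \<subseteq> univ M"
      using small[OF assms(12)] F assms(10) by (simp_all add: countable_finite)
    show "\<exists>b\<in>P. b \<notin> cl M (D \<union> F)" by (rule denseA[OF DF])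
    have "D \<union> F \<union> P = D \<union> P \<union> F" by auto
    then show "\<exists>b\<in>univ M. b \<notin> cl M (D \<union> P \<union> F)" using codenseA[OF DF] by simp
  qed
qed

end
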